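(* Let $\phi:\mathbb R^d\to\mathbb R\cup\{\infty\}$ be a symmetric measurable pair potential satisfying the conditions (RP), (BB), (T) listed in the context, and let $\rho_{\max}>0$, $\beta>0$. Then there exist constants $\xi>0$ and $\lambda_*>0$ such that for all $\lambda\ge\lambda_*$ and all $n\in\mathbb N_0$, $N\in\mathbb N$ with $n\le N\le\rho_{\max}(2\lambda)^d$ the canonical correlation function with periodic boundary $$k_\lambda^{(n,N)}(x_1,\dots,x_n):=\frac{N!}{(N-n)!}\,\frac1{Z_\lambda^{N,\beta}}\int_{\Lambda_\lambda^{N-n}}e^{-\beta\widetilde U_{\phi,\lambda}(\{x_1,\dots,x_N\})}\,dx_{n+1}\cdots dx_N,\qquad x_1,\dots,x_n\in\Lambda_\lambda,$$ is bounded by $\xi^n$.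
   Context: $|\cdot|$ is the maximum norm on $\mathbb R^d$; $\mathbb N_0=\mathbb N\cup\{0\}$; $\Lambda_\lambda:=(-\lambda,\lambda]^d$ for $\lambda>0$. Symmetric means $\phi(x)=\phi(-x)$. Conditions on $\phi$: (BB) There is $M<\infty$ with $\phi(x)\ge -M$ for all $x\in\mathbb R^d$. (RP) There exist $R_1>0$ and a decreasing continuous function $\Phi:(0,\infty)\to[0,\infty)$ with $\lim_{t\to0}\Phi(t)t^d=\infty$ such that $\phi(x)\ge\Phi(|x|)$ for $|x|\le R_1$ (with $\Phi(0):=+\infty$, so $\phi(0)=+\infty$); furthermore $\phi$ is bounded from above on $\{x:\ r\le|x|<\infty\}$ for every $r>0$. (T) There exist $G,R_2<\infty$ and $\varepsilon>0$ such that $|\phi(x)|\le G|x|^{-d-\varepsilon}$ for $|x|\ge R_2$. Periodic energy: for $x_1,\dots,x_N\in\Lambda_\lambda$, $$\widetilde U_{\phi,\lambda}(\{x_1,\dots,x_N\}):=\sum_{1\le i<j\le N}\ \sum_{r\in\mathbb Z^d}\phi(x_i-x_j+2\lambda r).$$ Partition function: $Z_\lambda^{N,\beta}:=\int_{\Lambda_\lambda^N}e^{-\beta\widetilde U_{\phi,\lambda}(\{x_1,\dots,x_N\})}dx_1\cdots dx_N$. For $n=0$ one sets $k_\lambda^{(0,N)}=1$; for $n=N$ there is no integration, i.e. $k_\lambda^{(N,N)}(x_1,\dots,x_N)=N!\,(Z_\lambda^{N,\beta})^{-1}e^{-\beta\widetilde U_{\phi,\lambda}(\{x_1,\dots,x_N\})}$.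 *)

theory Defs
  imports "HOL-Analysis.Analysis"
begin

text \<open>The maximum norm on \<open>real ^ 'd\<close> is \<^const>\<open>infnorm\<close>; the dimension is \<open>CARD('d)\<close>.\<close>

definition cond_BB :: "(real ^ 'd \<Rightarrow> ereal) \<Rightarrow> bool" where
  "cond_BB \<phi> \<longleftrightarrow> (\<exists>M::real. \<forall>x. \<phi> x \<ge> - ereal M)"

text \<open>The convention that the lower bound \<open>\<Phi>\<close> takes the value \<open>\<infinity>\<close> at \<open>0\<close> is expressed by
  \<open>\<phi> 0 = \<infinity>\<close>.  "Decreasing" is read as non-increasing.\<close>

definition cond_RP :: "(real ^ 'd \<Rightarrow> ereal) \<Rightarrow> bool" where
  "cond_RP \<phi> \<longleftrightarrow>
     (\<exists>(R\<^sub>1::real) (\<Phi>::real \<Rightarrow> real).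
        R\<^sub>1 > 0 \<and>
        antimono_on {0<..} \<Phi> \<and> continuous_on {0<..} \<Phi> \<and> (\<forall>t>0. \<Phi> t \<ge> 0) \<and>
        filterlim (\<lambda>t. \<Phi> t * t ^ CARD('d)) at_top (at_right 0) \<and>
        \<phi> 0 = \<infinity> \<and>
        (\<forall>x. x \<noteq> 0 \<and> infnorm x \<le> R\<^sub>1 \<longrightarrow> \<phi> x \<ge> ereal (\<Phi> (infnorm x)))) \<and>
     (\<forall>r>0. \<exists>B::real. \<forall>x. r \<le> infnorm x \<longrightarrow> \<phi> x \<le> ereal B)"

text \<open>Requiring \<open>R\<^sub>2 > 0\<close> loses no generality, since \<open>R\<^sub>2\<close> may always be enlarged; it
  avoids the value \<open>0 powr s = 0\<close>.\<close>

definition cond_T :: "(real ^ 'd \<Rightarrow> ereal) \<Rightarrow> bool" where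
  "cond_T \<phi> \<longleftrightarrow>
     (\<exists>(G::real) (R\<^sub>2::real) (\<epsilon>::real). R\<^sub>2 > 0 \<and> \<epsilon> > 0 \<and>
        (\<forall>x. infnorm x \<ge> R\<^sub>2 \<longrightarrow>
           \<bar>\<phi> x\<bar> \<le> ereal (G * infnorm x powr (- real CARD('d) - \<epsilon>))))"

definition cell :: "real \<Rightarrow> (real ^ 'd) set" where
  "cell L = {x. \<forall>i. - L < x $ i \<and> x $ i \<le> L}"

text \<open>The lattice sum is the unconditional sum in \<^typ>\<open>ereal\<close>, with value \<open>\<infinity>\<close> as soon as one
  term is \<open>\<infinity>\<close> and the others sum absolutely.  Particles are indexed by \<open>1, \<dots>, N\<close>.\<close>

definition periodic_energy ::
    "(real ^ 'd \<Rightarrow> ereal) \<Rightarrow> real \<Rightarrow> nat \<Rightarrow> (nat \<Rightarrow> real ^ 'd) \<Rightarrow> ereal" where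
  "periodic_energy \<phi> L N x =
     (\<Sum>(i, j)\<in>{(i, j). 1 \<le> i \<and> i < j \<and> j \<le> N}.
        \<Sum>\<^sub>\<infinity>r::int ^ 'd. \<phi> (x i - x j + (2 * L) *\<^sub>R (\<chi> k. real_of_int (r $ k))))"

text \<open>\<open>exp (- \<beta> u)\<close> for \<open>\<beta> > 0\<close> and an extended real \<open>u\<close>.\<close>

definition boltzmann :: "real \<Rightarrow> ereal \<Rightarrow> ennreal" where
  "boltzmann \<beta> u =
     (case u of ereal a \<Rightarrow> ennreal (exp (- \<beta> * a)) | PInfty \<Rightarrow> 0 | MInfty \<Rightarrow> top)"

text \<open>Lebesgue measure on \<open>(cell L)\<^sup>I\<close>; for \<open>I = {}\<close> this is the one-point probability space,
  so integrating over it means no integration at all.\<close>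

definition cell_measure :: "real \<Rightarrow> nat set \<Rightarrow> (nat \<Rightarrow> real ^ 'd) measure" where
  "cell_measure L I = PiM I (\<lambda>_. restrict_space lborel (cell L))"

definition partition_function ::
    "(real ^ 'd \<Rightarrow> ereal) \<Rightarrow> real \<Rightarrow> real \<Rightarrow> nat \<Rightarrow> ennreal" where
  "partition_function \<phi> \<beta> L N =
     (\<integral>\<^sup>+ x. boltzmann \<beta> (periodic_energy \<phi> L N x) \<partial>cell_measure L {1..N})"

text \<open>\<open>merge {1..n} {n<..N} (x, y)\<close> is the configuration \<open>x\<^sub>1, \<dots>, x\<^sub>n, y\<^sub>n\<^sub>+\<^sub>1, \<dots>, y\<^sub>N\<close>.\<close>

definition correlation_function ::
    "(real ^ 'd \<Rightarrow> ereal) \<Rightarrow> real \<Rightarrow> real \<Rightarrow> nat \<Rightarrow> nat \<Rightarrow> (nat \<Rightarrow> real ^ 'd) \<Rightarrow> ennreal" where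
  "correlation_function \<phi> \<beta> L n N x =
     (if n = 0 then 1
      else ennreal (fact N / fact (N - n)) * (1 / partition_function \<phi> \<beta> L N) *
        (\<integral>\<^sup>+ y. boltzmann \<beta> (periodic_energy \<phi> L N (merge {1..n} {n<..N} (x, y)))
           \<partial>cell_measure L {n<..N}))"

end

theory Submission
  imports Defs
begin

text \<open>
  Divide the torus into cubes of side about \<open>2 / M\<close>.  Since \<open>\<Phi> t * t ^ d \<rightarrow> \<infinity>\<close>, for large \<open>M\<close> the
  repulsion \<open>A\<close> inside one cube beats, by an arbitrary factor, the total attraction \<open>C\<close> (of order
  \<open>M ^ d\<close>) that a particle feels from one particle in every cube.  Fix a particle \<open>a\<close> and a slowly
  growing function \<open>h\<close> of the distance to its cube, and call a cube crowded if it contains more than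
  \<open>h\<close> other particles.  Removing \<open>a\<close> together with all particles in crowded cubes lowers the energy
  by at least the sum of \<open>2 n\<^sup>2\<close> over the crowded cubes, \<open>n\<close> being the number of particles in the cube,
  minus the constant \<open>C\<close>: the remaining particles have local density at most \<open>h\<close>, hence attract a
  crowded cube by at most \<open>C n h \<le> C n\<^sup>2\<close>.  As \<open>2 n\<^sup>2 \<ge> h + n h\<close>, the Boltzmann weight of what was
  removed is at most \<open>exp C\<close> times a factor \<open>exp (- h)\<close> for each crowded cube and each particle in it,
  which is summable over the choices of crowded cubes and removed particles, uniformly in the volume.
  The bounded density enters through \<open>N Z\<^sub>N\<^sub>-\<^sub>1 \<le> z Z\<^sub>N\<close>: by Markov's inequality, in at least half of
  the cubes an inserted particle has bounded energy.  The theorem follows by induction on the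
  number of fixed particles.
\<close>

section \<open>Pair weights and the removal of crowded cubes\<close>

text \<open>The threshold \<open>h\<close> is squeezed from two sides. Which cubes are crowded
  depends on the integrated particles, so all sets of cubes have to be summed over; this costs the
  exponential of the sum of \<open>exp (- h)\<close>, bounded uniformly in the volume only if
  \<open>h\<close> grows. Conversely, the attraction of particles of density \<open>h\<close> must
  again be at most a constant times \<open>h\<close>, so the tail of the potential has to stay
  summable after multiplication by \<open>h\<close>. A power of the distance with half of the
  surplus decay exponent meets both demands. The fixed number of particles is the other obstacle: a
  removal leaves a smaller system, whose size varies with the configuration. Hence systems of all
  smaller sizes are compared with the full partition function, each missing particle being paid for
  by a factor \<open>z\<close>. The fineness of the cubes serves twice: it makes the repulsion
  dominant, and it makes the number of particles per cube small, so that the neighbourhoods of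
  existing particles, where the potential may be unbounded, block only a small fraction of the cubes
  for insertion.\<close>

definition pair_weight :: "('a \<Rightarrow> 'a \<Rightarrow> ennreal) \<Rightarrow> nat set \<Rightarrow> (nat \<Rightarrow> 'a) \<Rightarrow> ennreal" where
  "pair_weight b I x = (\<Prod>(i, j)\<in>{(i, j). i \<in> I \<and> j \<in> I \<and> i < j}. b (x i) (x j))"

lemma pair_weight_empty [simp]: "pair_weight b {} x = 1"
  by (simp add: pair_weight_def)

lemma pair_weight_cong:
  assumes "\<And>i. i \<in> I \<Longrightarrow> x i = y i"
  shows "pair_weight b I x = pair_weight b I y"
  unfolding pair_weight_def by (rule prod.cong) (auto simp: assms)

lemma pair_weight_insert:
  assumes sym: "\<And>u v. b u v = b v u" and J: "finite J" "i \<notin> J"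
  shows "pair_weight b (insert i J) x = pair_weight b J x * (\<Prod>j\<in>J. b (x i) (x j))"
proof -
  let ?P = "\<lambda>I. {(k, l). k \<in> I \<and> l \<in> I \<and> k < (l::nat)}"
  \<comment> \<open>Pairs are indexed in increasing order, so a pair containing the new index has to
    be sorted; the symmetry of \<open>b\<close> undoes the sorting.\<close>
  let ?f = "\<lambda>j. if i < j then (i, j) else (j, i)"
  have fin: "finite (?P J)"
    by (rule finite_subset[of _ "J \<times> J"]) (use J in auto)
  have eq: "?P (insert i J) = ?P J \<union> ?f ` J"
  proof (intro equalityI subsetI)
    fix p assume "p \<in> ?P (insert i J)"
    then obtain k l where p: "p = (k, l)" "k < l" "k = i \<or> k \<in> J" "l = i \<or> l \<in> J" by auto
    show "p \<in> ?P J \<union> ?f ` J"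
    proof (cases "k = i")
      case True
      then have "l \<in> J" "p = ?f l" using p by auto
      then show ?thesis by blast
    next
      case False
      show ?thesis
      proof (cases "l = i")
        case True
        then have "k \<in> J" "p = ?f k" using p False by auto
        then show ?thesis by blast
      qed (use p False in auto)
    qed
  next
    fix p assume "p \<in> ?P J \<union> ?f ` J"
    then show "p \<in> ?P (insert i J)"
      using J(2) by (auto split: if_splits) (metis linorder_neqE_nat)
  qed
  have inj: "inj_on ?f J" using J by (auto simp: inj_on_def split: if_splits)
  have "pair_weight b (insert i J) x = (\<Prod>(k, l)\<in>?P J. b (x k) (x l)) * (\<Prod>(k, l)\<in>?f ` J. b (x k) (x l))"
    unfolding pair_weight_def eq by (rule prod.union_disjoint) (use J fin in \<open>auto split: if_splits\<close>)
  also have "(\<Prod>(k, l)\<in>?f ` J. b (x k) (x l)) = (\<Prod>j\<in>J. b (x i) (x j))"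
    unfolding prod.reindex[OF inj] by (rule prod.cong) (auto simp: sym)
  finally show ?thesis by (simp add: pair_weight_def)
qed

lemma pair_weight_Un:
  assumes sym: "\<And>u v. b u v = b v u"
    and "finite A" "finite B" "A \<inter> B = {}"
  shows "pair_weight b (A \<union> B) x
    = pair_weight b A x * pair_weight b B x * (\<Prod>i\<in>A. \<Prod>j\<in>B. b (x i) (x j))"
  using assms(2,4)
proof (induction A)
  case (insert i A)
  have "pair_weight b (insert i A \<union> B) x = pair_weight b (A \<union> B) x * (\<Prod>j\<in>A \<union> B. b (x i) (x j))"
    using insert assms(3) by (simp add: pair_weight_insert[where b = b, OF sym])
  also have "(\<Prod>j\<in>A \<union> B. b (x i) (x j)) = (\<Prod>j\<in>A. b (x i) (x j)) * (\<Prod>j\<in>B. b (x i) (x j))"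
    using insert assms(3) by (intro prod.union_disjoint) auto
  finally show ?case
    using insert by (simp add: pair_weight_insert[where b = b, OF sym] mult_ac)
qed auto

lemma prod_le_ennreal_exp_sum:
  fixes f :: "'i \<Rightarrow> ennreal"
  assumes "\<And>i. i \<in> A \<Longrightarrow> f i \<le> ennreal (exp (u i))"
  shows "(\<Prod>i\<in>A. f i) \<le> ennreal (exp (\<Sum>i\<in>A. u i))"
proof (cases "finite A")
  case True
  have "(\<Prod>i\<in>A. f i) \<le> (\<Prod>i\<in>A. ennreal (exp (u i)))"
    by (rule prod_mono_ennreal) (rule assms)
  also have "\<dots> = ennreal (exp (\<Sum>i\<in>A. u i))"
    using True by (simp add: exp_sum prod_ennreal)
  finally show ?thesis .
qed auto

text \<open>The weight runs over unordered pairs and the double sum over ordered ones, hence the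
  factor 1/2. The double sum is the convenient form because its rows can be estimated one particle
  at a time; the zero diagonal of \<open>v\<close> keeps self-interaction out.\<close>

lemma pair_weight_le_exp:
  assumes sym: "\<And>u v. b u v = b v u" and "finite B"
    and "\<And>i j. i \<in> B \<Longrightarrow> j \<in> B \<Longrightarrow> i \<noteq> j \<Longrightarrow> b (x i) (x j) \<le> ennreal (exp (v i j))"
    and vsym: "\<And>i j. v i j = v j i" and v0: "\<And>i. v i i = 0"
  shows "pair_weight b B x \<le> ennreal (exp ((\<Sum>i\<in>B. \<Sum>j\<in>B. v i j) / 2))"
  using assms(2,3)
proof (induction B)
  case (insert i B)
  have "pair_weight b (insert i B) x = pair_weight b B x * (\<Prod>j\<in>B. b (x i) (x j))"
    using insert by (simp add: pair_weight_insert[where b = b, OF sym])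
  also have "\<dots> \<le> ennreal (exp ((\<Sum>i\<in>B. \<Sum>j\<in>B. v i j) / 2)) * ennreal (exp (\<Sum>j\<in>B. v i j))"
    using insert.hyps insert.prems by (intro mult_mono insert.IH prod_le_ennreal_exp_sum) auto
  also have "\<dots> = ennreal (exp ((\<Sum>i\<in>B. \<Sum>j\<in>B. v i j) / 2 + (\<Sum>j\<in>B. v i j)))"
    by (simp add: exp_add ennreal_mult)
  also have "(\<Sum>i\<in>B. \<Sum>j\<in>B. v i j) / 2 + (\<Sum>j\<in>B. v i j)
      = (\<Sum>k\<in>insert i B. \<Sum>j\<in>insert i B. v k j) / 2"
  proof -
    have "(\<Sum>j\<in>B. \<Sum>l\<in>insert i B. v j l) = (\<Sum>j\<in>B. v i j) + (\<Sum>i\<in>B. \<Sum>j\<in>B. v i j)"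
      using insert.hyps by (simp add: sum.distrib vsym[of _ i])
    moreover have "(\<Sum>k\<in>insert i B. \<Sum>j\<in>insert i B. v k j)
        = (\<Sum>j\<in>B. v i j) + (\<Sum>j\<in>B. \<Sum>l\<in>insert i B. v j l)"
    proof -
      have "(\<Sum>k\<in>insert i B. \<Sum>j\<in>insert i B. v k j)
          = (\<Sum>j\<in>insert i B. v i j) + (\<Sum>j\<in>B. \<Sum>l\<in>insert i B. v j l)"
        by (rule sum.insert[OF insert.hyps])
      also have "(\<Sum>j\<in>insert i B. v i j) = v i i + (\<Sum>j\<in>B. v i j)"
        by (rule sum.insert[OF insert.hyps])
      finally show ?thesis by (simp only: v0 add_0)
    qed
    ultimately show ?thesis by simp
  qed
  finally show ?case .
qed simp

section \<open>Energy balance in terms of particle numbers per cube\<close>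

lemma sum_fibres:
  fixes f :: "'q \<Rightarrow> real"
  assumes "finite B" "finite S" "\<And>i. i \<in> B \<Longrightarrow> c i \<in> S"
  shows "(\<Sum>i\<in>B. f (c i)) = (\<Sum>q\<in>S. real (card {i\<in>B. c i = q}) * f q)"
proof -
  have "(\<Sum>i\<in>B. f (c i)) = (\<Sum>q\<in>S. \<Sum>i\<in>{i\<in>B. c i = q}. f (c i))"
    by (rule sum.group[symmetric]) (use assms in auto)
  also have "\<dots> = (\<Sum>q\<in>S. real (card {i\<in>B. c i = q}) * f q)"
    by (rule sum.cong) auto
  finally show ?thesis .
qed

text \<open>\<open>\<Psi> p q\<close> stands for the attraction between particles in the cubes
  \<open>p\<close> and \<open>q\<close>, all periodic images included, and \<open>A\<close> for the
  repulsion of two particles in one cube. \<open>Psi_h\<close> is a Schur-type condition: the kernel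
  maps each weight \<open>h a\<close> to at most \<open>C\<close> times itself. The numbers in
  \<open>A_large\<close> come from the balance of exponents in the removal estimate.\<close>

locale cell_kernel =
  fixes Q :: "'q set" and \<Psi> h :: "'q \<Rightarrow> 'q \<Rightarrow> real" and A C :: real
  assumes finite_Q: "finite Q"
    and Psi_nonneg: "\<And>p q. \<Psi> p q \<ge> 0"
    and Psi_sym: "\<And>p q. \<Psi> p q = \<Psi> q p"
    and h_ge_1: "\<And>p q. h p q \<ge> 1"
    and h_self: "\<And>p. h p p = 1"
    and Psi_h: "\<And>a p. a \<in> Q \<Longrightarrow> p \<in> Q \<Longrightarrow> (\<Sum>q\<in>Q. \<Psi> p q * h a q) \<le> C * h a p"
    and A_large: "A \<ge> 10 * C + 8"
begin

lemma Psi_row: "p \<in> Q \<Longrightarrow> (\<Sum>q\<in>Q. \<Psi> p q) \<le> C"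
proof -
  assume p: "p \<in> Q"
  have "(\<Sum>q\<in>Q. \<Psi> p q) \<le> (\<Sum>q\<in>Q. \<Psi> p q * h p q)"
    using mult_left_mono[OF h_ge_1 Psi_nonneg] by (intro sum_mono) simp
  also have "\<dots> \<le> C * h p p" by (rule Psi_h[OF p p])
  finally show ?thesis by (simp add: h_self)
qed

lemma Psi_le: "p \<in> Q \<Longrightarrow> q \<in> Q \<Longrightarrow> \<Psi> p q \<le> C"
  by (rule order_trans[OF member_le_sum[of q Q "\<Psi> p"] Psi_row])
     (auto simp: finite_Q Psi_nonneg)

lemma C_nonneg: "p \<in> Q \<Longrightarrow> C \<ge> 0"
  using Psi_le[of p p] Psi_nonneg[of p p] by linarith

text \<open>The factors \<open>exp (- H q)\<close> indexed by the cubes are what makes the later sum over all sets \<open>S\<close> of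
  crowded cubes converge even if fixed particles accumulate near \<open>a\<close>.\<close>

lemma pair_weight_remove_crowded:
  fixes b :: "'a \<Rightarrow> 'a \<Rightarrow> ennreal" and c :: "'a \<Rightarrow> 'q" and x :: "nat \<Rightarrow> 'a"
  assumes bsym: "\<And>u v. b u v = b v u"
    and I: "finite I" "a \<notin> I"
    and cQ: "\<And>i. i \<in> insert a I \<Longrightarrow> c (x i) \<in> Q"
    and b_le: "\<And>i j. i \<in> insert a I \<Longrightarrow> j \<in> insert a I \<Longrightarrow> i \<noteq> j \<Longrightarrow>
        b (x i) (x j) \<le> ennreal (exp (\<Psi> (c (x i)) (c (x j)) - (if c (x i) = c (x j) then A else 0)))"
  defines "H \<equiv> h (c (x a))"
  defines "S \<equiv> {q\<in>Q. H q < real (card {i\<in>I. c (x i) = q})}"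
  shows "pair_weight b (insert a I) x \<le>
      ennreal (exp C) * (\<Prod>q\<in>S. ennreal (exp (- H q))) * (\<Prod>i\<in>{i\<in>I. c (x i) \<in> S}. ennreal (exp (- H (c (x i)))))
      * pair_weight b {i\<in>I. c (x i) \<notin> S} x"
proof -
  define k where "k i = c (x i)" for i
  define n where "n q = real (card {i\<in>I. k i = q})" for q
  define B where "B = {i\<in>I. k i \<in> S}"
  define R where "R = {i\<in>I. k i \<notin> S}"
  define v where "v i j = (if i = j then 0 else \<Psi> (k i) (k j) - (if k i = k j then A else 0))" for i j
  have finS: "finite S" using finite_Q by (simp add: S_def)
  have SQ: "S \<subseteq> Q" by (auto simp: S_def)
  have fin: "finite B" "finite R" using I by (auto simp: B_def R_def)
  have disj: "B \<inter> R = {}" and IBR: "I = B \<union> R" by (auto simp: B_def R_def)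
  have kQ: "k i \<in> Q" if "i \<in> insert a I" for i using cQ[OF that] by (simp add: k_def)
  have oQ: "k a \<in> Q" by (rule kQ) simp
  have C0: "C \<ge> 0" by (rule C_nonneg[OF oQ])
  have A0: "A \<ge> 0" using A_large C0 by linarith
  have H1: "H q \<ge> 1" for q by (simp add: H_def h_ge_1)
  have nS: "n q > H q" if "q \<in> S" for q using that by (simp add: S_def n_def k_def)
  \<comment> \<open>An integer exceeding \<open>H q \<ge> 1\<close> is at least 2; this later gives
    \<open>n p - 1 \<ge> n p / 2\<close>.\<close>
  have n2: "n q \<ge> 2" if "q \<in> S" for q
  proof -
    have "real (card {i\<in>I. k i = q}) > 1" using nS[OF that] H1[of q] by (simp add: n_def)
    then have "card {i\<in>I. k i = q} \<ge> 2" by linarith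
    then show ?thesis unfolding n_def by linarith
  qed
  have nB: "real (card {i\<in>B. k i = q}) = n q" if "q \<in> S" for q
    unfolding n_def B_def using that by (intro arg_cong[where f = "\<lambda>X. real (card X)"]) auto
  have nR: "real (card {i\<in>R. k i = q}) \<le> H q" if "q \<in> Q" for q
  proof (cases "q \<in> S")
    case True
    then have e: "{i\<in>R. k i = q} = {}" by (auto simp: R_def)
    show ?thesis unfolding e using H1[of q] by simp
  next
    case False
    then have "{i\<in>R. k i = q} = {i\<in>I. k i = q}" by (auto simp: R_def)
    then show ?thesis using False that by (auto simp: S_def n_def k_def)
  qed
  have sumB: "(\<Sum>i\<in>B. f (k i)) = (\<Sum>q\<in>S. n q * f q)" for f
    using sum_fibres[of B S k f] fin finS by (simp add: nB) (simp add: B_def)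
  have sumR: "(\<Sum>i\<in>R. f (k i)) \<le> (\<Sum>q\<in>Q. f q * H q)" if "\<And>q. f q \<ge> 0" for f
  proof -
    have "(\<Sum>i\<in>R. f (k i)) = (\<Sum>q\<in>Q. real (card {i\<in>R. k i = q}) * f q)"
      by (rule sum_fibres) (use fin finite_Q kQ in \<open>auto simp: R_def\<close>)
    also have "\<dots> \<le> (\<Sum>q\<in>Q. H q * f q)"
      by (intro sum_mono mult_right_mono nR that)
    finally show ?thesis by (simp add: mult.commute)
  qed
  define X where "X = (\<Sum>q\<in>S. (n q)\<^sup>2)"
  \<comment> \<open>Bounding \<open>n p * n q\<close> by the mean of the squares reduces the
    attraction among crowded cubes to row sums of \<open>\<Psi>\<close>, while the repulsion
    \<open>A * n p * (n p - 1)\<close> keeps at least half of \<open>A * (n p)\<^sup>2\<close>.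
    Every pair is counted twice here; the halving happens at the end.\<close>
  have BB: "(\<Sum>i\<in>B. \<Sum>j\<in>B. v i j) \<le> C * X - A * X / 2"
  proof -
    have row: "(\<Sum>j\<in>B. v i j) \<le> (\<Sum>q\<in>S. n q * \<Psi> (k i) q) - A * (n (k i) - 1)" if i: "i \<in> B" for i
    proof -
      have "(\<Sum>j\<in>B. v i j) = (\<Sum>j\<in>B-{i}. \<Psi> (k i) (k j)) - (\<Sum>j\<in>B-{i}. if k i = k j then A else 0)"
        using fin i by (subst sum.remove[of B i]) (auto simp: v_def sum_subtractf intro!: sum.cong)
      also have "(\<Sum>j\<in>B-{i}. if k i = k j then A else 0) = real (card {j\<in>B-{i}. k i = k j}) * A"
        using fin by (simp add: sum.If_cases Int_def)
      also have "{j\<in>B-{i}. k i = k j} = {j\<in>B. k j = k i} - {i}" by auto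
      also have "real (card ({j\<in>B. k j = k i} - {i})) = n (k i) - 1"
      proof -
        have "card {j\<in>B. k j = k i} = Suc (card ({j\<in>B. k j = k i} - {i}))"
          by (rule card.remove) (use fin i in auto)
        moreover have "real (card {j\<in>B. k j = k i}) = n (k i)"
          by (rule nB) (use i in \<open>simp add: B_def\<close>)
        ultimately show ?thesis by simp
      qed
      also have "(\<Sum>j\<in>B-{i}. \<Psi> (k i) (k j)) \<le> (\<Sum>j\<in>B. \<Psi> (k i) (k j))"
        by (rule sum_mono2) (use fin Psi_nonneg in auto)
      also have "\<dots> = (\<Sum>q\<in>S. n q * \<Psi> (k i) q)" by (rule sumB)
      finally show ?thesis by (simp add: mult.commute)
    qed
    have "(\<Sum>i\<in>B. \<Sum>j\<in>B. v i j) \<le> (\<Sum>i\<in>B. (\<Sum>q\<in>S. n q * \<Psi> (k i) q) - A * (n (k i) - 1))"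
      by (intro sum_mono row)
    also have "\<dots> = (\<Sum>p\<in>S. n p * ((\<Sum>q\<in>S. n q * \<Psi> p q) - A * (n p - 1)))"
      by (rule sumB)
    also have "\<dots> = (\<Sum>p\<in>S. \<Sum>q\<in>S. n p * n q * \<Psi> p q) - (\<Sum>p\<in>S. A * (n p * (n p - 1)))"
      by (simp add: right_diff_distrib sum_subtractf sum_distrib_left mult_ac)
    also have "(\<Sum>p\<in>S. \<Sum>q\<in>S. n p * n q * \<Psi> p q) \<le> (\<Sum>p\<in>S. \<Sum>q\<in>S. ((n p)\<^sup>2 / 2 + (n q)\<^sup>2 / 2) * \<Psi> p q)"
    proof (intro sum_mono mult_right_mono Psi_nonneg)
      fix p q show "n p * n q \<le> (n p)\<^sup>2 / 2 + (n q)\<^sup>2 / 2"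
        using zero_le_power2[of "n p - n q"] unfolding power2_diff by argo
    qed
    also have "\<dots> = (\<Sum>p\<in>S. \<Sum>q\<in>S. (n p)\<^sup>2 / 2 * \<Psi> p q) + (\<Sum>p\<in>S. \<Sum>q\<in>S. (n q)\<^sup>2 / 2 * \<Psi> p q)"
      by (simp add: distrib_right sum.distrib)
    also have "(\<Sum>p\<in>S. \<Sum>q\<in>S. (n q)\<^sup>2 / 2 * \<Psi> p q) = (\<Sum>p\<in>S. \<Sum>q\<in>S. (n p)\<^sup>2 / 2 * \<Psi> p q)"
      by (subst sum.swap) (simp add: Psi_sym)
    also have "(\<Sum>p\<in>S. \<Sum>q\<in>S. (n p)\<^sup>2 / 2 * \<Psi> p q) + (\<Sum>p\<in>S. \<Sum>q\<in>S. (n p)\<^sup>2 / 2 * \<Psi> p q)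
       = (\<Sum>p\<in>S. (n p)\<^sup>2 * (\<Sum>q\<in>S. \<Psi> p q))"
      by (simp add: sum_distrib_left sum_distrib_right mult_ac flip: sum.distrib)
    also have "\<dots> \<le> (\<Sum>p\<in>S. (n p)\<^sup>2 * C)"
    proof (intro sum_mono mult_left_mono)
      fix p assume "p \<in> S"
      then have "(\<Sum>q\<in>S. \<Psi> p q) \<le> (\<Sum>q\<in>Q. \<Psi> p q)"
        using SQ finite_Q Psi_nonneg by (intro sum_mono2) auto
      also have "\<dots> \<le> C" using \<open>p \<in> S\<close> SQ by (intro Psi_row) auto
      finally show "(\<Sum>q\<in>S. \<Psi> p q) \<le> C" .
    qed auto
    also have "\<dots> = C * X" by (simp add: X_def sum_distrib_left mult.commute)
    finally have "(\<Sum>i\<in>B. \<Sum>j\<in>B. v i j) \<le> C * X - (\<Sum>p\<in>S. A * (n p * (n p - 1)))" by simp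
    moreover have "A * X / 2 \<le> (\<Sum>p\<in>S. A * (n p * (n p - 1)))"
      unfolding X_def sum_distrib_left sum_divide_distrib
    proof (rule sum_mono)
      fix p assume "p \<in> S"
      then have "n p * (n p / 2) \<le> n p * (n p - 1)"
        using n2[of p] by (intro mult_left_mono) auto
      then have "A * (n p * (n p / 2)) \<le> A * (n p * (n p - 1))" using A0 by (rule mult_left_mono)
      then show "A * (n p)\<^sup>2 / 2 \<le> A * (n p * (n p - 1))" by (simp add: power2_eq_square)
    qed
    ultimately show ?thesis by linarith
  qed
  have BR: "(\<Sum>i\<in>B. \<Sum>j\<in>R. \<Psi> (k i) (k j)) \<le> C * X"
  proof -
    have "(\<Sum>i\<in>B. \<Sum>j\<in>R. \<Psi> (k i) (k j)) \<le> (\<Sum>i\<in>B. C * H (k i))"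
    proof (rule sum_mono)
      fix i assume "i \<in> B"
      then have "k i \<in> Q" using kQ by (auto simp: B_def)
      have "(\<Sum>j\<in>R. \<Psi> (k i) (k j)) \<le> (\<Sum>q\<in>Q. \<Psi> (k i) q * H q)"
        by (rule sumR) (rule Psi_nonneg)
      also have "\<dots> \<le> C * H (k i)"
        unfolding H_def using oQ \<open>k i \<in> Q\<close> by (intro Psi_h) (auto simp: k_def)
      finally show "(\<Sum>j\<in>R. \<Psi> (k i) (k j)) \<le> C * H (k i)" .
    qed
    also have "\<dots> = (\<Sum>q\<in>S. n q * (C * H q))" by (rule sumB)
    also have "\<dots> \<le> (\<Sum>q\<in>S. n q * (C * n q))"
      using nS n2 C0 by (intro sum_mono mult_left_mono) (auto simp: less_imp_le intro: order_trans[OF _ n2])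
    also have "\<dots> = C * X" by (simp add: X_def sum_distrib_left power2_eq_square mult_ac)
    finally show ?thesis .
  qed
  \<comment> \<open>The pointwise bound \<open>\<Psi> \<le> C\<close> suffices, since any moderate
    multiple of \<open>X\<close> is absorbed by the repulsion.\<close>
  have oB: "(\<Sum>j\<in>B. \<Psi> (k a) (k j)) \<le> C * X"
  proof -
    have "(\<Sum>j\<in>B. \<Psi> (k a) (k j)) = (\<Sum>q\<in>S. n q * \<Psi> (k a) q)" by (rule sumB)
    also have "\<dots> \<le> (\<Sum>q\<in>S. n q * (C * n q))"
    proof (intro sum_mono mult_left_mono)
      fix q assume q: "q \<in> S"
      have "\<Psi> (k a) q \<le> C" by (rule Psi_le) (use oQ q SQ in auto)
      also have "\<dots> \<le> C * n q" using n2[OF q] C0 by (simp add: mult_le_cancel_left1)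
      finally show "\<Psi> (k a) q \<le> C * n q" .
      show "n q \<ge> 0" using n2[OF q] by simp
    qed
    also have "\<dots> = C * X" by (simp add: X_def sum_distrib_left power2_eq_square mult_ac)
    finally show ?thesis .
  qed
  \<comment> \<open>The normalisation of \<open>h\<close> at the cube of \<open>a\<close> turns the
    bound \<open>C * H\<close> into a constant independent of the configuration.\<close>
  have oR: "(\<Sum>j\<in>R. \<Psi> (k a) (k j)) \<le> C"
  proof -
    have "(\<Sum>j\<in>R. \<Psi> (k a) (k j)) \<le> (\<Sum>q\<in>Q. \<Psi> (k a) q * H q)"
      by (rule sumR) (rule Psi_nonneg)
    also have "\<dots> \<le> C * H (k a)" unfolding H_def using oQ by (intro Psi_h) (auto simp: k_def)
    finally show ?thesis by (simp add: H_def k_def h_self)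
  qed
  have XS: "(\<Sum>q\<in>S. H q) + (\<Sum>i\<in>B. H (k i)) \<le> 2 * X"
  proof -
    have "(\<Sum>q\<in>S. H q) + (\<Sum>i\<in>B. H (k i)) = (\<Sum>q\<in>S. H q + n q * H q)"
      by (simp add: sumB sum.distrib)
    also have "\<dots> \<le> (\<Sum>q\<in>S. 2 * (n q)\<^sup>2)"
    proof (rule sum_mono)
      fix q assume q: "q \<in> S"
      have "n q * H q \<le> n q * n q" using nS[OF q] n2[OF q] by (intro mult_left_mono) auto
      moreover have "1 * H q \<le> n q * n q" using nS[OF q] n2[OF q] H1[of q] by (intro mult_mono) auto
      ultimately show "H q + n q * H q \<le> 2 * (n q)\<^sup>2" by (simp add: power2_eq_square)
    qed
    finally show ?thesis by (simp add: X_def sum_distrib_left)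
  qed
  have X0: "X \<ge> 0" by (simp add: X_def sum_nonneg)
  have AX: "(10 * C + 8) * X \<le> A * X" using A_large X0 by (rule mult_right_mono)
  have b_le': "b (x i) (x j) \<le> ennreal (exp (\<Psi> (k i) (k j)))"
    if "i \<in> insert a I" "j \<in> insert a I" "i \<noteq> j" for i j
    using b_le[OF that] A0 by (elim order_trans) (auto simp: k_def intro!: ennreal_leI)
  have oI: "a \<notin> B \<union> R" using I IBR by auto
  have "pair_weight b (insert a I) x
     = pair_weight b R x * (pair_weight b B x * (\<Prod>i\<in>B. \<Prod>j\<in>R. b (x i) (x j))
         * (\<Prod>j\<in>B. b (x a) (x j)) * (\<Prod>j\<in>R. b (x a) (x j)))"
    using fin disj oI
    by (simp add: IBR pair_weight_insert[where b = b, OF bsym] pair_weight_Un[where b = b, OF bsym]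
        prod.union_disjoint mult_ac)
  also have "\<dots> \<le> pair_weight b R x * (ennreal (exp ((\<Sum>i\<in>B. \<Sum>j\<in>B. v i j) / 2))
      * ennreal (exp (\<Sum>i\<in>B. \<Sum>j\<in>R. \<Psi> (k i) (k j)))
      * ennreal (exp (\<Sum>j\<in>B. \<Psi> (k a) (k j))) * ennreal (exp (\<Sum>j\<in>R. \<Psi> (k a) (k j))))"
  proof (intro mult_mono order_refl)
    show "pair_weight b B x \<le> ennreal (exp ((\<Sum>i\<in>B. \<Sum>j\<in>B. v i j) / 2))"
    proof (rule pair_weight_le_exp[where b = b, OF bsym])
      show "b (x i) (x j) \<le> ennreal (exp (v i j))" if "i \<in> B" "j \<in> B" "i \<noteq> j" for i j
        using b_le[of i j] that by (auto simp: v_def k_def IBR)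
    qed (use fin in \<open>auto simp: v_def Psi_sym\<close>)
    show "(\<Prod>i\<in>B. \<Prod>j\<in>R. b (x i) (x j)) \<le> ennreal (exp (\<Sum>i\<in>B. \<Sum>j\<in>R. \<Psi> (k i) (k j)))"
      by (intro prod_le_ennreal_exp_sum b_le') (use disj in \<open>auto simp: IBR\<close>)
    show "(\<Prod>j\<in>B. b (x a) (x j)) \<le> ennreal (exp (\<Sum>j\<in>B. \<Psi> (k a) (k j)))"
      by (intro prod_le_ennreal_exp_sum b_le') (use oI in \<open>auto simp: IBR\<close>)
    show "(\<Prod>j\<in>R. b (x a) (x j)) \<le> ennreal (exp (\<Sum>j\<in>R. \<Psi> (k a) (k j)))"
      by (intro prod_le_ennreal_exp_sum b_le') (use oI in \<open>auto simp: IBR\<close>)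
  qed auto
  also have "\<dots> = pair_weight b R x * ennreal (exp ((\<Sum>i\<in>B. \<Sum>j\<in>B. v i j) / 2
      + (\<Sum>i\<in>B. \<Sum>j\<in>R. \<Psi> (k i) (k j)) + (\<Sum>j\<in>B. \<Psi> (k a) (k j)) + (\<Sum>j\<in>R. \<Psi> (k a) (k j))))"
    by (simp add: exp_add ennreal_mult)
  \<comment> \<open>Pairs within the crowded cubes give \<open>C * X / 2 - A * X / 4\<close>, the
    mixed pairs \<open>C * X\<close> twice and \<open>C\<close> once. With
    \<open>A \<ge> 10 * C + 8\<close> the total is at most \<open>C - 2 * X\<close>, and
    \<open>XS\<close> spends the \<open>2 * X\<close>.\<close>
  also have "\<dots> \<le> pair_weight b R x * ennreal (exp (C + (\<Sum>q\<in>S. - H q) + (\<Sum>i\<in>B. - H (k i))))"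
    using BB BR oB oR XS AX X0
    by (intro mult_left_mono ennreal_leI) (auto simp: sum_negf algebra_simps)
  also have "\<dots> = pair_weight b R x * (ennreal (exp C) * (\<Prod>q\<in>S. ennreal (exp (- H q)))
      * (\<Prod>i\<in>B. ennreal (exp (- H (k i)))))"
    using finS fin by (simp add: exp_add exp_sum ennreal_mult prod_ennreal prod_nonneg)
  finally show ?thesis unfolding B_def R_def k_def by (simp add: mult_ac)
qed

end

section \<open>Correlation integrals\<close>

lemma sum_Pow_card:
  fixes g :: "nat \<Rightarrow> real"
  assumes "finite J"
  shows "(\<Sum>T\<in>Pow J. g (card T)) = (\<Sum>t\<le>card J. real (card J choose t) * g t)"
proof -
  have "(\<Sum>T\<in>Pow J. g (card T)) = (\<Sum>t\<le>card J. \<Sum>T\<in>{T \<in> Pow J. card T = t}. g (card T))"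
    by (rule sum.group[symmetric]) (use assms in \<open>auto intro: card_mono\<close>)
  also have "\<dots> = (\<Sum>t\<le>card J. real (card {T. T \<subseteq> J \<and> card T = t}) * g t)"
    by (rule sum.cong) (auto intro!: sum.cong)
  finally show ?thesis by (simp add: n_subsets assms)
qed

text \<open>Choosing the \<open>t\<close> removed particles costs a binomial coefficient, the
  smaller system brings the factorial of its size, and together they leave
  \<open>fact (card J) / fact t\<close>: the sum over removals is a partial sum of the exponential
  series.\<close>

lemma sum_Pow_fact_le:
  fixes a :: real
  assumes "finite J" "a \<ge> 0"
  shows "(\<Sum>T\<in>Pow J. a ^ card T * fact (card J - card T)) \<le> fact (card J) * exp a"
proof -
  have "(\<Sum>T\<in>Pow J. a ^ card T * fact (card J - card T))
      = (\<Sum>t\<le>card J. real (card J choose t) * (a ^ t * fact (card J - t)))"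
    by (rule sum_Pow_card[OF assms(1)])
  also have "\<dots> = (\<Sum>t\<le>card J. fact (card J) * (a ^ t /\<^sub>R fact t))"
    by (rule sum.cong) (auto simp: binomial_fact field_simps)
  also have "\<dots> = fact (card J) * (\<Sum>t\<le>card J. a ^ t /\<^sub>R fact t)"
    by (simp add: sum_distrib_left)
  also have "(\<Sum>t\<le>card J. a ^ t /\<^sub>R fact t) \<le> exp a"
    unfolding exp_def using summable_exp_generic[of a] assms(2)
    by (intro sum_le_suminf) auto
  finally show ?thesis by simp
qed

text \<open>The sum over all sets of crowded cubes is the expansion of the product of the factors
  \<open>1 + f q\<close>.\<close>

lemma sum_Pow_prod_le:
  fixes f :: "'q \<Rightarrow> real"
  assumes "finite Q" "\<And>q. q \<in> Q \<Longrightarrow> f q \<ge> 0"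
  shows "(\<Sum>S\<in>Pow Q. \<Prod>q\<in>S. f q) \<le> exp (\<Sum>q\<in>Q. f q)"
proof -
  have "(\<Sum>S\<in>Pow Q. \<Prod>q\<in>S. f q) = (\<Prod>q\<in>Q. f q + 1)"
    by (simp add: prod_add[OF assms(1)])
  also have "\<dots> \<le> (\<Prod>q\<in>Q. exp (f q))"
    by (intro prod_mono) (use assms(2) in \<open>auto simp: add.commute[of _ 1]\<close>)
  finally show ?thesis using assms(1) by (simp add: exp_sum)
qed

text \<open>\<open>\<nu>\<close> is the volume on the one-particle space, \<open>c\<close> assigns
  cubes and \<open>b\<close> is the Boltzmann factor of a pair. \<open>kappa\<close> and
  \<open>kappa'\<close> control the same quantity, once integrated over a removed particle and once
  summed over cubes. \<open>insertion\<close> is demanded for every configuration rather than on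
  average, so it can be integrated against any weight.\<close>

locale lattice_gas = cell_kernel Q \<Psi> h A C
  for Q :: "'q set" and \<Psi> h A C +
  fixes \<nu> :: "'a measure" and b :: "'a \<Rightarrow> 'a \<Rightarrow> ennreal" and c :: "'a \<Rightarrow> 'q"
    and \<kappa> \<kappa>' z :: real and N\<^sub>m\<^sub>a\<^sub>x :: nat
  assumes sigma_finite_nu: "sigma_finite_measure \<nu>"
    and b_sym: "\<And>x y. b x y = b y x"
    and b_measurable [measurable]: "case_prod b \<in> borel_measurable (\<nu> \<Otimes>\<^sub>M \<nu>)"
    and c_measurable [measurable]: "c \<in> measurable \<nu> (count_space UNIV)"
    and c_in_Q: "\<And>x. x \<in> space \<nu> \<Longrightarrow> c x \<in> Q"
    and b_le: "\<And>x y. x \<in> space \<nu> \<Longrightarrow> y \<in> space \<nu> \<Longrightarrow>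
        b x y \<le> ennreal (exp (\<Psi> (c x) (c y) - (if c x = c y then A else 0)))"
    and kappa: "\<And>p. p \<in> Q \<Longrightarrow> (\<integral>\<^sup>+y. ennreal (exp (- h p (c y))) \<partial>\<nu>) \<le> ennreal \<kappa>"
    and kappa': "\<And>p. p \<in> Q \<Longrightarrow> (\<Sum>q\<in>Q. exp (- h p q)) \<le> \<kappa>'"
    and kappa_nonneg: "\<kappa> \<ge> 0"
    and z_ge_1: "z \<ge> 1"
    and insertion: "\<And>(J::nat set) x. finite J \<Longrightarrow> card J < N\<^sub>m\<^sub>a\<^sub>x \<Longrightarrow> (\<And>j. j \<in> J \<Longrightarrow> x j \<in> space \<nu>) \<Longrightarrow>
        of_nat (Suc (card J)) \<le> ennreal z * (\<integral>\<^sup>+y. (\<Prod>j\<in>J. b y (x j)) \<partial>\<nu>)"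
begin

sublocale product_sigma_finite "\<lambda>_ :: nat. \<nu>"
  by unfold_locales (rule sigma_finite_measure.sigma_finite_countable[OF sigma_finite_nu])

text \<open>The particles in \<open>F\<close> are fixed at \<open>x\<close>, those in \<open>J\<close> are integrated over.\<close>

definition corr :: "nat set \<Rightarrow> nat set \<Rightarrow> (nat \<Rightarrow> 'a) \<Rightarrow> ennreal" where
  "corr F J x = (\<integral>\<^sup>+y. pair_weight b (F \<union> J) (\<lambda>i. if i \<in> J then y i else x i) \<partial>PiM J (\<lambda>_. \<nu>))"

lemma b_measurable':
  assumes "f \<in> measurable M \<nu>" "g \<in> measurable M \<nu>"
  shows "(\<lambda>y. b (f y) (g y)) \<in> borel_measurable M"
  using measurable_compose[OF measurable_Pair[OF assms] b_measurable] by simp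

lemma pair_weight_measurable:
  assumes "\<And>i. i \<in> I \<Longrightarrow> (\<lambda>y. w y i) \<in> measurable M \<nu>"
  shows "(\<lambda>y. pair_weight b I (w y)) \<in> borel_measurable M"
  unfolding pair_weight_def case_prod_beta
  by (intro borel_measurable_prod_ennreal b_measurable' assms) auto

lemma override_measurable:
  assumes "J \<subseteq> J'" and "i \<notin> J \<Longrightarrow> x i \<in> space \<nu>"
  shows "(\<lambda>y. if i \<in> J then y i else x i) \<in> measurable (PiM J' (\<lambda>_. \<nu>)) \<nu>"
proof (cases "i \<in> J")
  case True
  then have "i \<in> J'" using assms by auto
  from measurable_component_singleton[OF this, of "\<lambda>_. \<nu>"] True show ?thesis by simp
qed (use assms in simp)

text \<open>A removed particle occurs in no pair factor any more, only in \<open>f\<close>; by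
  Fubini its variable splits off as one factor of the integral of \<open>f\<close>.\<close>

lemma integrate_out:
  assumes J: "finite J" "T \<subseteq> J" and F: "F \<inter> J = {}" "\<And>i. i \<in> F \<Longrightarrow> x i \<in> space \<nu>"
    and f [measurable]: "f \<in> borel_measurable \<nu>"
  shows "(\<integral>\<^sup>+y. (\<Prod>i\<in>T. f (y i)) * pair_weight b (F \<union> (J - T)) (\<lambda>i. if i \<in> J then y i else x i) \<partial>PiM J (\<lambda>_. \<nu>))
    = (\<integral>\<^sup>+y. f y \<partial>\<nu>) ^ card T * corr F (J - T) x"
proof -
  have fin: "finite T" "finite (J - T)" using J finite_subset by auto
  have JT: "(J - T) \<union> T = J" "(J - T) \<inter> T = {}" using J by auto
  have [measurable]: "(\<lambda>y. \<Prod>i\<in>T. f (y i)) \<in> borel_measurable (PiM T (\<lambda>_. \<nu>))"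
    by (intro borel_measurable_prod_ennreal) measurable
  have "(\<lambda>y. \<Prod>i\<in>T. f (y i)) \<in> borel_measurable (PiM J (\<lambda>_. \<nu>))"
  proof (intro borel_measurable_prod_ennreal)
    fix i assume "i \<in> T"
    then have "i \<in> J" using J by auto
    then show "(\<lambda>y. f (y i)) \<in> borel_measurable (PiM J (\<lambda>_. \<nu>))" by measurable
  qed
  then have meas: "(\<lambda>y. (\<Prod>i\<in>T. f (y i)) * pair_weight b (F \<union> (J - T)) (\<lambda>i. if i \<in> J then y i else x i))
      \<in> borel_measurable (PiM ((J - T) \<union> T) (\<lambda>_. \<nu>))"
    unfolding JT
    by (intro borel_measurable_times_ennreal pair_weight_measurable override_measurable) (use F in auto)
  have "(\<integral>\<^sup>+y. (\<Prod>i\<in>T. f (y i)) * pair_weight b (F \<union> (J - T)) (\<lambda>i. if i \<in> J then y i else x i) \<partial>PiM J (\<lambda>_. \<nu>))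
    = (\<integral>\<^sup>+u. \<integral>\<^sup>+v. (\<Prod>i\<in>T. f (merge (J - T) T (u, v) i)) * pair_weight b (F \<union> (J - T)) (\<lambda>i. if i \<in> J then merge (J - T) T (u, v) i else x i)
         \<partial>PiM T (\<lambda>_. \<nu>) \<partial>PiM (J - T) (\<lambda>_. \<nu>))"
    using product_nn_integral_fold[OF JT(2) fin(2,1) meas] by (simp only: JT(1))
  also have "\<dots> = (\<integral>\<^sup>+u. \<integral>\<^sup>+v. (\<Prod>i\<in>T. f (v i)) * pair_weight b (F \<union> (J - T)) (\<lambda>i. if i \<in> J - T then u i else x i)
         \<partial>PiM T (\<lambda>_. \<nu>) \<partial>PiM (J - T) (\<lambda>_. \<nu>))"
  proof (intro nn_integral_cong arg_cong2[where f = "(*)"] prod.cong refl pair_weight_cong)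
    fix u v and i assume "i \<in> F \<union> (J - T)"
    then show "(if i \<in> J then merge (J - T) T (u, v) i else x i) = (if i \<in> J - T then u i else x i)"
      using F(1) J(2) by (auto simp: merge_def)
  qed (auto simp: merge_def)
  also have "\<dots> = (\<integral>\<^sup>+u. (\<integral>\<^sup>+v. (\<Prod>i\<in>T. f (v i)) \<partial>PiM T (\<lambda>_. \<nu>))
      * pair_weight b (F \<union> (J - T)) (\<lambda>i. if i \<in> J - T then u i else x i) \<partial>PiM (J - T) (\<lambda>_. \<nu>))"
    by (intro nn_integral_cong nn_integral_multc) measurable
  also have "(\<integral>\<^sup>+v. (\<Prod>i\<in>T. f (v i)) \<partial>PiM T (\<lambda>_. \<nu>)) = (\<integral>\<^sup>+y. f y \<partial>\<nu>) ^ card T"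
    using product_nn_integral_prod[of T "\<lambda>_. f"] fin by simp
  also have "(\<integral>\<^sup>+u. (\<integral>\<^sup>+y. f y \<partial>\<nu>) ^ card T
      * pair_weight b (F \<union> (J - T)) (\<lambda>i. if i \<in> J - T then u i else x i) \<partial>PiM (J - T) (\<lambda>_. \<nu>))
      = (\<integral>\<^sup>+y. f y \<partial>\<nu>) ^ card T * corr F (J - T) x"
    unfolding corr_def
    by (intro nn_integral_cmult pair_weight_measurable override_measurable) (use F in auto)
  finally show ?thesis .
qed

text \<open>Weighted with \<open>pair_weight\<close> and integrated, the pointwise insertion bound
  becomes a ratio estimate for partition functions of consecutive sizes.\<close>

lemma corr_empty_insert:
  assumes "finite J" "i \<notin> J" "card J < N\<^sub>m\<^sub>a\<^sub>x"
  shows "of_nat (Suc (card J)) * corr {} J x \<le> ennreal z * corr {} (insert i J) x"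
proof -
  have meas: "(\<lambda>y. pair_weight b (insert i J) y) \<in> borel_measurable (PiM (insert i J) (\<lambda>_. \<nu>))"
    by (rule pair_weight_measurable) measurable
  have meas': "(\<lambda>y. pair_weight b J y) \<in> borel_measurable (PiM J (\<lambda>_. \<nu>))"
    by (rule pair_weight_measurable) measurable
  have E: "corr {} J x = (\<integral>\<^sup>+y. pair_weight b J y \<partial>PiM J (\<lambda>_. \<nu>))" for J
    unfolding corr_def by (intro nn_integral_cong) (auto intro: pair_weight_cong)
  have "of_nat (Suc (card J)) * corr {} J x = (\<integral>\<^sup>+y. of_nat (Suc (card J)) * pair_weight b J y \<partial>PiM J (\<lambda>_. \<nu>))"
    unfolding E by (rule nn_integral_cmult[symmetric, OF meas'])
  also have "\<dots> \<le> (\<integral>\<^sup>+y. ennreal z * (pair_weight b J y * (\<integral>\<^sup>+u. (\<Prod>j\<in>J. b u (y j)) \<partial>\<nu>)) \<partial>PiM J (\<lambda>_. \<nu>))"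
  proof (rule nn_integral_mono)
    fix y assume "y \<in> space (PiM J (\<lambda>_. \<nu>))"
    then have "of_nat (Suc (card J)) \<le> ennreal z * (\<integral>\<^sup>+u. (\<Prod>j\<in>J. b u (y j)) \<partial>\<nu>)"
      by (intro insertion assms) (auto simp: space_PiM)
    from mult_right_mono[OF this, of "pair_weight b J y"]
    show "of_nat (Suc (card J)) * pair_weight b J y \<le>
        ennreal z * (pair_weight b J y * (\<integral>\<^sup>+u. (\<Prod>j\<in>J. b u (y j)) \<partial>\<nu>))"
      by (simp add: mult_ac)
  qed
  also have "\<dots> = (\<integral>\<^sup>+y. ennreal z * (\<integral>\<^sup>+u. pair_weight b (insert i J) (y(i := u)) \<partial>\<nu>) \<partial>PiM J (\<lambda>_. \<nu>))"
  proof (intro nn_integral_cong arg_cong2[where f = "(*)"] refl)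
    fix y assume y: "y \<in> space (PiM J (\<lambda>_. \<nu>))"
    have "pair_weight b (insert i J) (y(i := u)) = pair_weight b J y * (\<Prod>j\<in>J. b u (y j))" for u
    proof -
      have "pair_weight b J (y(i := u)) = pair_weight b J y"
        by (rule pair_weight_cong) (use assms in auto)
      moreover have "(\<Prod>j\<in>J. b u ((y(i := u)) j)) = (\<Prod>j\<in>J. b u (y j))"
        by (rule prod.cong) (use assms in auto)
      ultimately show ?thesis
        using assms by (simp add: pair_weight_insert[where b = b, OF b_sym])
    qed
    moreover have "(\<lambda>u. \<Prod>j\<in>J. b u (y j)) \<in> borel_measurable \<nu>"
      using y by (intro borel_measurable_prod_ennreal b_measurable' measurable_ident measurable_const)
        (auto simp: space_PiM PiE_def)
    ultimately show "pair_weight b J y * (\<integral>\<^sup>+u. (\<Prod>j\<in>J. b u (y j)) \<partial>\<nu>) = (\<integral>\<^sup>+u. pair_weight b (insert i J) (y(i := u)) \<partial>\<nu>)"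
      by (simp add: nn_integral_cmult)
  qed
  also have "\<dots> = ennreal z * (\<integral>\<^sup>+y. \<integral>\<^sup>+u. pair_weight b (insert i J) (y(i := u)) \<partial>\<nu> \<partial>PiM J (\<lambda>_. \<nu>))"
  proof (rule nn_integral_cmult)
    have m: "(\<lambda>(y, u). pair_weight b (insert i J) (y(i := u))) \<in> borel_measurable (PiM J (\<lambda>_. \<nu>) \<Otimes>\<^sub>M \<nu>)"
      using measurable_compose[OF measurable_add_dim meas] by (simp add: case_prod_beta)
    show "(\<lambda>y. \<integral>\<^sup>+u. pair_weight b (insert i J) (y(i := u)) \<partial>\<nu>) \<in> borel_measurable (PiM J (\<lambda>_. \<nu>))"
      by (rule sigma_finite_measure.borel_measurable_nn_integral[OF sigma_finite_nu m])
  qed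
  also have "\<dots> = ennreal z * corr {} (insert i J) x"
    unfolding E product_nn_integral_insert[OF assms(1,2) meas] ..
  finally show ?thesis .
qed

text \<open>Inserts the missing particles one at a time. All factors stay multiplicative, because a
  partition function in \<open>ennreal\<close> may be zero or infinite and cannot safely be divided
  by.\<close>

lemma corr_empty_subset:
  assumes "finite I" "J \<subseteq> I" "card I \<le> N\<^sub>m\<^sub>a\<^sub>x"
  shows "ennreal (fact (card I)) * corr {} J x \<le> ennreal (fact (card J) * z ^ (card I - card J)) * corr {} I x"
  using assms
proof (induction "card I - card J" arbitrary: J)
  case 0
  then have "J = I" using card_mono[OF assms(1)] by (intro card_subset_eq) (auto intro: antisym)
  then show ?case by simp
next
  case (Suc k)
  then have finJ: "finite J" using finite_subset by auto
  from Suc have "J \<noteq> I" by auto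
  then obtain i where i: "i \<in> I" "i \<notin> J" using Suc by auto
  have "k = card I - card (insert i J)" using Suc(2) finJ i by simp
  note IH = Suc.hyps(1)[OF this]
  have lt: "card J < card I" using Suc(2) by linarith
  have IH: "ennreal (fact (card I)) * corr {} (insert i J) x
      \<le> ennreal (fact (Suc (card J)) * z ^ (card I - Suc (card J))) * corr {} I x"
    using IH Suc.prems i finJ by simp
  have "of_nat (Suc (card J)) * (ennreal (fact (card I)) * corr {} J x)
      = ennreal (fact (card I)) * (of_nat (Suc (card J)) * corr {} J x)"
    by (simp add: mult_ac)
  also have "\<dots> \<le> ennreal (fact (card I)) * (ennreal z * corr {} (insert i J) x)"
    using finJ i lt Suc.prems by (intro mult_left_mono corr_empty_insert) auto
  also have "\<dots> = ennreal z * (ennreal (fact (card I)) * corr {} (insert i J) x)"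
    by (simp add: mult_ac)
  also have "\<dots> \<le> ennreal z * (ennreal (fact (Suc (card J)) * z ^ (card I - Suc (card J))) * corr {} I x)"
    by (intro mult_left_mono IH) auto
  also have "\<dots> = ennreal (z * (fact (Suc (card J)) * z ^ (card I - Suc (card J)))) * corr {} I x"
    using z_ge_1 by (subst ennreal_mult) (auto simp: mult_ac simp del: fact_Suc)
  also have "z * (fact (Suc (card J)) * z ^ (card I - Suc (card J))) = real (Suc (card J)) * (fact (card J) * z ^ (card I - card J))"
  proof -
    have "card I - card J = Suc (card I - Suc (card J))" using lt by simp
    then show ?thesis by simp
  qed
  also have "ennreal \<dots> = of_nat (Suc (card J)) * ennreal (fact (card J) * z ^ (card I - card J))"
    using z_ge_1 by (subst ennreal_mult) (auto simp: ennreal_of_nat_eq_real_of_nat)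
  finally have "ennreal (real (Suc (card J))) * (ennreal (fact (card I)) * corr {} J x)
      \<le> ennreal (real (Suc (card J))) * (ennreal (fact (card J) * z ^ (card I - card J)) * corr {} I x)"
    by (simp add: mult.assoc ennreal_of_nat_eq_real_of_nat)
  \<comment> \<open>The factor \<open>card J + 1\<close> is finite and nonzero, so it cancels even
    in \<open>ennreal\<close>.\<close>
  then show ?case
    by (subst (asm) ennreal_mult_le_mult_iff) auto
qed

text \<open>One induction step costs \<open>exp C\<close> for the energy,
  \<open>exp \<kappa>'\<close> for the choice of crowded cubes, \<open>exp (\<kappa> * z)\<close>
  for the removed integrated particles and \<open>z\<close> for the particle \<open>a\<close>. The
  maximum with \<open>z\<close> covers other fixed particles removed along with
  \<open>a\<close>.\<close>

definition xi :: real where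
  "xi = max z (exp C * exp \<kappa>' * exp (\<kappa> * z) * z)"

lemma xi_ge: "xi \<ge> z" "xi \<ge> 1" "xi \<ge> exp C * exp \<kappa>' * exp (\<kappa> * z) * z"
  using z_ge_1 by (auto simp: xi_def)

text \<open>The crowded cubes \<open>S\<close> and the integrated particles \<open>T\<close> in them
  vary with the integration variables, so the pointwise bound is enlarged to a sum over all
  \<open>S\<close> and \<open>T\<close> before integrating. The fixed particles that are lost are
  determined by \<open>S\<close> and bring no further sum.\<close>

lemma corr_le_sum:
  assumes F: "finite F" "F \<inter> J = {}" "\<And>i. i \<in> F \<Longrightarrow> x i \<in> space \<nu>" and J: "finite J"
    and a: "a \<in> F"
  defines "H \<equiv> h (c (x a))"
  shows "corr F J x \<le> (\<Sum>S\<in>Pow Q. \<Sum>T\<in>Pow J.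
      ennreal (exp C * (\<Prod>q\<in>S. exp (- H q)) * \<kappa> ^ card T) * corr {i\<in>F - {a}. c (x i) \<notin> S} (J - T) x)"
proof -
  let ?w = "\<lambda>y i. if i \<in> J then y i else x i"
  let ?e = "\<lambda>u. ennreal (exp (- H (c u)))"
  let ?F = "\<lambda>S. {i\<in>F - {a}. c (x i) \<notin> S}"
  let ?t = "\<lambda>S T y. ennreal (exp C) * (\<Prod>q\<in>S. ennreal (exp (- H q))) *
      ((\<Prod>i\<in>T. ?e (y i)) * pair_weight b (?F S \<union> (J - T)) (?w y))"
  let ?M = "PiM J (\<lambda>_. \<nu>)"
  have aJ: "a \<notin> J" using a F by auto
  have xa: "c (x a) \<in> Q" using a F c_in_Q by auto
  have e_meas [measurable]: "?e \<in> borel_measurable \<nu>"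
    using measurable_compose[OF c_measurable, of "\<lambda>q. ennreal (exp (- H q))" borel] by simp
  have pointwise: "pair_weight b (F \<union> J) (?w y) \<le> (\<Sum>S\<in>Pow Q. \<Sum>T\<in>Pow J. ?t S T y)"
    if y: "y \<in> space ?M" for y
  proof -
    define I where "I = (F - {a}) \<union> J"
    have FJ: "F \<union> J = insert a I" using a by (auto simp: I_def)
    have sp: "?w y i \<in> space \<nu>" if "i \<in> insert a I" for i
      using that F(3) y unfolding FJ[symmetric] by (auto simp: space_PiM)
    define S where "S = {q\<in>Q. h (c (?w y a)) q < real (card {i\<in>I. c (?w y i) = q})}"
    define T where "T = {i\<in>J. c (y i) \<in> S}"
    have H: "h (c (?w y a)) = H" using aJ by (simp add: H_def)
    have Iprop: "finite I" "a \<notin> I" using F(1) J aJ by (auto simp: I_def)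
    have eR: "{i\<in>I. c (?w y i) \<notin> S} = ?F S \<union> (J - T)"
      using F(2) by (auto simp: I_def T_def)
    have "pair_weight b (F \<union> J) (?w y) \<le>
      ennreal (exp C) * (\<Prod>q\<in>S. ennreal (exp (- H q))) * (\<Prod>i\<in>{i\<in>I. c (?w y i) \<in> S}. ?e (?w y i))
      * pair_weight b {i\<in>I. c (?w y i) \<notin> S} (?w y)"
      unfolding FJ S_def H[symmetric] using Iprop sp c_in_Q b_le b_sym
      by (intro pair_weight_remove_crowded) auto
    also have "\<dots> \<le> ennreal (exp C) * (\<Prod>q\<in>S. ennreal (exp (- H q))) * (\<Prod>i\<in>T. ?e (y i))
      * pair_weight b (?F S \<union> (J - T)) (?w y)"
      unfolding eR
    proof (intro mult_mono order_refl)
      \<comment> \<open>The factors of the removed fixed particles are at most 1 and are dropped;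
        those of the integrated particles make the integrals over \<open>T\<close> bounded by powers
        of \<open>\<kappa>\<close>.\<close>
      have "T \<subseteq> {i\<in>I. c (?w y i) \<in> S}" by (auto simp: T_def I_def)
      then have "(\<Prod>i\<in>{i\<in>I. c (?w y i) \<in> S}. ?e (?w y i))
          = (\<Prod>i\<in>{i\<in>I. c (?w y i) \<in> S} - T. ?e (?w y i)) * (\<Prod>i\<in>T. ?e (?w y i))"
        using Iprop by (intro prod.subset_diff) auto
      also have "\<dots> \<le> 1 * (\<Prod>i\<in>T. ?e (?w y i))"
      proof (rule mult_right_mono)
        show "(\<Prod>i\<in>{i\<in>I. c (?w y i) \<in> S} - T. ?e (?w y i)) \<le> 1"
        proof -
          have "?e u \<le> 1" for u
            using h_ge_1[of "c (x a)" "c u"] by (simp add: H_def)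
          then have "(\<Prod>i\<in>{i\<in>I. c (?w y i) \<in> S} - T. ?e (?w y i)) \<le> (\<Prod>i\<in>{i\<in>I. c (?w y i) \<in> S} - T. 1)"
            by (intro prod_mono_ennreal) auto
          then show ?thesis by simp
        qed
      qed auto
      also have "\<dots> = (\<Prod>i\<in>T. ?e (y i))"
        unfolding mult_1 by (rule prod.cong) (auto simp: T_def)
      finally show "(\<Prod>i\<in>{i\<in>I. c (?w y i) \<in> S}. ?e (?w y i)) \<le> (\<Prod>i\<in>T. ?e (y i))" .
    qed auto
    also have "\<dots> = ?t S T y" by (simp add: mult.assoc)
    also have "\<dots> \<le> (\<Sum>T\<in>Pow J. ?t S T y)"
      by (rule member_le_sum) (use J in \<open>auto simp: T_def\<close>)
    also have "\<dots> \<le> (\<Sum>S\<in>Pow Q. \<Sum>T\<in>Pow J. ?t S T y)"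
      by (rule member_le_sum[of S "Pow Q" "\<lambda>S. \<Sum>T\<in>Pow J. ?t S T y"])
         (use finite_Q in \<open>auto simp: S_def\<close>)
    finally show ?thesis .
  qed
  have meas: "(\<lambda>y. (\<Prod>i\<in>T. ?e (y i)) * pair_weight b (?F S \<union> (J - T)) (?w y)) \<in> borel_measurable ?M"
    if "T \<subseteq> J" for S T
  proof (intro borel_measurable_times_ennreal borel_measurable_prod_ennreal pair_weight_measurable override_measurable)
    fix i assume "i \<in> T"
    then have "i \<in> J" using that by auto
    then show "(\<lambda>y. ?e (y i)) \<in> borel_measurable ?M" by measurable
  qed (use F in auto)
  have "corr F J x \<le> (\<integral>\<^sup>+y. (\<Sum>S\<in>Pow Q. \<Sum>T\<in>Pow J. ?t S T y) \<partial>?M)"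
    unfolding corr_def by (rule nn_integral_mono) (rule pointwise)
  also have "\<dots> = (\<Sum>S\<in>Pow Q. \<Sum>T\<in>Pow J. \<integral>\<^sup>+y. ?t S T y \<partial>?M)"
  proof -
    have t: "?t S T \<in> borel_measurable ?M" if "T \<in> Pow J" for S T
      by (intro borel_measurable_times_ennreal[OF borel_measurable_const] meas) (use that in auto)
    have "(\<integral>\<^sup>+y. (\<Sum>S\<in>Pow Q. \<Sum>T\<in>Pow J. ?t S T y) \<partial>?M) = (\<Sum>S\<in>Pow Q. \<integral>\<^sup>+y. (\<Sum>T\<in>Pow J. ?t S T y) \<partial>?M)"
      by (intro nn_integral_sum borel_measurable_sum t)
    also have "\<dots> = (\<Sum>S\<in>Pow Q. \<Sum>T\<in>Pow J. \<integral>\<^sup>+y. ?t S T y \<partial>?M)"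
      by (intro sum.cong refl nn_integral_sum t)
    finally show ?thesis .
  qed
  also have "\<dots> \<le> (\<Sum>S\<in>Pow Q. \<Sum>T\<in>Pow J. ennreal (exp C * (\<Prod>q\<in>S. exp (- H q)) * \<kappa> ^ card T) * corr (?F S) (J - T) x)"
  proof (intro sum_mono)
    fix S T assume S: "S \<in> Pow Q" and T: "T \<in> Pow J"
    have "(\<integral>\<^sup>+y. ?t S T y \<partial>?M) = ennreal (exp C) * (\<Prod>q\<in>S. ennreal (exp (- H q))) *
        (\<integral>\<^sup>+y. (\<Prod>i\<in>T. ?e (y i)) * pair_weight b (?F S \<union> (J - T)) (?w y) \<partial>?M)"
      by (rule nn_integral_cmult) (use meas T in auto)
    also have "(\<integral>\<^sup>+y. (\<Prod>i\<in>T. ?e (y i)) * pair_weight b (?F S \<union> (J - T)) (?w y) \<partial>?M)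
        = (\<integral>\<^sup>+u. ?e u \<partial>\<nu>) ^ card T * corr (?F S) (J - T) x"
      by (rule integrate_out[OF J _ _ _ e_meas]) (use T F in auto)
    also have "(\<integral>\<^sup>+u. ?e u \<partial>\<nu>) ^ card T \<le> ennreal \<kappa> ^ card T"
      unfolding H_def by (intro power_mono kappa xa) auto
    finally have "(\<integral>\<^sup>+y. ?t S T y \<partial>?M) \<le> ennreal (exp C) * (\<Prod>q\<in>S. ennreal (exp (- H q))) *
        (ennreal \<kappa> ^ card T * corr (?F S) (J - T) x)"
      by (simp add: mult_left_mono mult_right_mono)
    also have "\<dots> = ennreal (exp C * (\<Prod>q\<in>S. exp (- H q)) * \<kappa> ^ card T) * corr (?F S) (J - T) x"
      using kappa_nonneg
      by (simp add: ennreal_mult prod_ennreal prod_nonneg ennreal_power mult.assoc)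
    finally show "(\<integral>\<^sup>+y. ?t S T y \<partial>?M) \<le> ennreal (exp C * (\<Prod>q\<in>S. exp (- H q)) * \<kappa> ^ card T) * corr (?F S) (J - T) x" .
  qed
  finally show ?thesis .
qed

text \<open>For the induction to close, \<open>F\<close> and \<open>J\<close> together may miss part
  of \<open>I\<close>, since a removal takes particles out of both. The missing ones are made up by
  powers of \<open>z\<close> against the full system \<open>I\<close>.\<close>

theorem corr_le:
  assumes I: "finite I" "card I \<le> N\<^sub>m\<^sub>a\<^sub>x"
    and "F \<union> J \<subseteq> I" "F \<inter> J = {}" "\<And>i. i \<in> F \<Longrightarrow> x i \<in> space \<nu>"
  shows "ennreal (fact (card I)) * corr F J x
    \<le> ennreal (fact (card J) * xi ^ card F * z ^ (card I - card F - card J)) * corr {} I y"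
  using assms(3-)
proof (induction "card F" arbitrary: F J rule: less_induct)
  case less
  have fin: "finite F" "finite J" using less.prems I finite_subset by auto
  show ?case
  proof (cases "F = {}")
    case True
    \<comment> \<open>Without fixed particles the configuration is read only at integrated indices,
      so the point does not matter.\<close>
    have "corr {} K x = corr {} K y" for K
      unfolding corr_def by (intro nn_integral_cong pair_weight_cong) auto
    then show ?thesis using corr_empty_subset[OF I(1) _ I(2), of J x] less.prems True by simp
  next
    case False
    then obtain a where a: "a \<in> F" by auto
    define H where "H = h (c (x a))"
    define G where "G S = {i\<in>F - {a}. c (x i) \<notin> S}" for S
    define m where "m = card I - card F - card J"
    have xa: "c (x a) \<in> Q" using a less.prems c_in_Q by auto
    have cFJ: "card F + card J \<le> card I"
      using card_mono[OF I(1) less.prems(1)] card_Un_disjoint[OF fin less.prems(2)] by simp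
    have F1: "card F = Suc (card (F - {a}))" using fin a by (metis card.remove)
    let ?W = "\<lambda>S. \<Prod>q\<in>S. exp (- H q)"
    have step: "ennreal (fact (card I)) * (ennreal (exp C * ?W S * \<kappa> ^ card T) * corr (G S) (J - T) x)
        \<le> ennreal (exp C * ?W S * ((\<kappa> * z) ^ card T * fact (card J - card T)) * (xi ^ (card F - 1) * z * z ^ m)) * corr {} I y"
      if T: "T \<subseteq> J" for S T
    proof -
      have GF: "G S \<subseteq> F - {a}" by (auto simp: G_def)
      have cG: "card (G S) \<le> card F - 1" using card_mono[OF _ GF] fin F1 by simp
      have lt: "card (G S) < card F" using cG F1 by linarith
      have cT: "card T \<le> card J" "card (J - T) = card J - card T"
        using T fin by (auto intro: card_mono card_Diff_subset finite_subset)
      have "ennreal (fact (card I)) * corr (G S) (J - T) x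
          \<le> ennreal (fact (card (J - T)) * xi ^ card (G S) * z ^ (card I - card (G S) - card (J - T))) * corr {} I y"
        by (rule less.hyps[OF lt]) (use less.prems GF in auto)
      also have "\<dots> \<le> ennreal (fact (card J - card T) * (xi ^ (card F - 1) * z * z ^ m) * z ^ card T) * corr {} I y"
      proof (intro mult_right_mono ennreal_leI)
        \<comment> \<open>The missing particles are the fixed ones removed with \<open>a\<close>,
          then \<open>a\<close> itself, those missing before, and the removed integrated ones. The
          first powers of \<open>z\<close> are absorbed by \<open>xi\<close>, the last combine with
          \<open>\<kappa> ^ card T\<close>.\<close>
        have "card I - card (G S) - card (J - T) = (card F - 1 - card (G S)) + 1 + m + card T"
          using cG cFJ cT F1 by (simp add: m_def)
        then have "xi ^ card (G S) * z ^ (card I - card (G S) - card (J - T))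
            = xi ^ card (G S) * z ^ (card F - 1 - card (G S)) * (z * z ^ m * z ^ card T)"
          by (simp add: power_add)
        also have "\<dots> \<le> xi ^ card (G S) * xi ^ (card F - 1 - card (G S)) * (z * z ^ m * z ^ card T)"
          using xi_ge z_ge_1 by (intro mult_right_mono mult_left_mono power_mono) auto
        also have "xi ^ card (G S) * xi ^ (card F - 1 - card (G S)) = xi ^ (card F - 1)"
        proof -
          have "card (G S) + (card F - 1 - card (G S)) = card F - 1" using cG by linarith
          then show ?thesis by (metis power_add)
        qed
        finally have "xi ^ card (G S) * z ^ (card I - card (G S) - card (J - T))
            \<le> xi ^ (card F - 1) * z * z ^ m * z ^ card T" by (simp add: mult_ac)
        from mult_left_mono[OF this, of "fact (card J - card T)"]
        show "fact (card (J - T)) * xi ^ card (G S) * z ^ (card I - card (G S) - card (J - T))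
            \<le> fact (card J - card T) * (xi ^ (card F - 1) * z * z ^ m) * z ^ card T"
          unfolding cT by (simp add: mult_ac)
      qed auto
      finally have "ennreal (exp C * ?W S * \<kappa> ^ card T) * (ennreal (fact (card I)) * corr (G S) (J - T) x)
          \<le> ennreal (exp C * ?W S * \<kappa> ^ card T) * (ennreal (fact (card J - card T) * (xi ^ (card F - 1) * z * z ^ m) * z ^ card T) * corr {} I y)"
        by (rule mult_left_mono) auto
      also have "\<dots> = ennreal (exp C * ?W S * \<kappa> ^ card T * (fact (card J - card T) * (xi ^ (card F - 1) * z * z ^ m) * z ^ card T)) * corr {} I y"
        using kappa_nonneg z_ge_1 xi_ge
        by (subst (2) ennreal_mult) (auto simp: mult.assoc prod_nonneg)
      also have "exp C * ?W S * \<kappa> ^ card T * (fact (card J - card T) * (xi ^ (card F - 1) * z * z ^ m) * z ^ card T)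
         = exp C * ?W S * ((\<kappa> * z) ^ card T * fact (card J - card T)) * (xi ^ (card F - 1) * z * z ^ m)"
        by (simp add: power_mult_distrib mult_ac)
      finally show ?thesis by (simp add: mult_ac)
    qed
    have "ennreal (fact (card I)) * corr F J x \<le> ennreal (fact (card I)) *
        (\<Sum>S\<in>Pow Q. \<Sum>T\<in>Pow J. ennreal (exp C * ?W S * \<kappa> ^ card T) * corr (G S) (J - T) x)"
      unfolding G_def H_def
      by (intro mult_left_mono corr_le_sum fin less.prems a) auto
    also have "\<dots> \<le> (\<Sum>S\<in>Pow Q. \<Sum>T\<in>Pow J.
        ennreal (exp C * ?W S * ((\<kappa> * z) ^ card T * fact (card J - card T)) * (xi ^ (card F - 1) * z * z ^ m)) * corr {} I y)"
      unfolding sum_distrib_left by (intro sum_mono step) auto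
    also have "\<dots> = ennreal (\<Sum>S\<in>Pow Q. \<Sum>T\<in>Pow J.
        exp C * ?W S * ((\<kappa> * z) ^ card T * fact (card J - card T)) * (xi ^ (card F - 1) * z * z ^ m)) * corr {} I y"
      using kappa_nonneg z_ge_1 xi_ge
      by (simp only: sum_distrib_right[symmetric, of _ "corr {} I y"])
         (subst sum_ennreal, auto intro!: sum_nonneg prod_nonneg mult_nonneg_nonneg)+
    also have "\<dots> \<le> ennreal (fact (card J) * xi ^ card F * z ^ m) * corr {} I y"
    proof (intro mult_right_mono ennreal_leI)
      have "(\<Sum>S\<in>Pow Q. \<Sum>T\<in>Pow J.
          exp C * ?W S * ((\<kappa> * z) ^ card T * fact (card J - card T)) * (xi ^ (card F - 1) * z * z ^ m))
        = exp C * (\<Sum>S\<in>Pow Q. ?W S) * (\<Sum>T\<in>Pow J. (\<kappa> * z) ^ card T * fact (card J - card T)) * (xi ^ (card F - 1) * z * z ^ m)"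
      proof -
        let ?k = "exp C * (xi ^ (card F - 1) * z * z ^ m)" and ?g = "\<lambda>T. (\<kappa> * z) ^ card T * fact (card J - card T)"
        have "(\<Sum>S\<in>Pow Q. \<Sum>T\<in>Pow J. exp C * ?W S * ?g T * (xi ^ (card F - 1) * z * z ^ m))
            = (\<Sum>S\<in>Pow Q. \<Sum>T\<in>Pow J. ?k * (?W S * ?g T))"
          by (simp only: mult_ac)
        also have "\<dots> = ?k * ((\<Sum>S\<in>Pow Q. ?W S) * (\<Sum>T\<in>Pow J. ?g T))"
          by (simp only: sum_distrib_left[symmetric] sum_product)
        finally show ?thesis by (simp only: mult_ac)
      qed
      also have "\<dots> \<le> exp C * exp \<kappa>' * (fact (card J) * exp (\<kappa> * z)) * (xi ^ (card F - 1) * z * z ^ m)"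
      proof (intro mult_right_mono mult_mono order_refl)
        have "(\<Sum>S\<in>Pow Q. ?W S) \<le> exp (\<Sum>q\<in>Q. exp (- H q))"
          by (rule sum_Pow_prod_le) (auto simp: finite_Q)
        also have "\<dots> \<le> exp \<kappa>'" using kappa'[OF xa] by (simp add: H_def)
        finally show "(\<Sum>S\<in>Pow Q. ?W S) \<le> exp \<kappa>'" .
        show "(\<Sum>T\<in>Pow J. (\<kappa> * z) ^ card T * fact (card J - card T)) \<le> fact (card J) * exp (\<kappa> * z)"
          by (rule sum_Pow_fact_le) (use fin kappa_nonneg z_ge_1 in auto)
      qed (use kappa_nonneg z_ge_1 xi_ge in \<open>auto intro!: sum_nonneg prod_nonneg mult_nonneg_nonneg\<close>)
      also have "\<dots> = fact (card J) * ((exp C * exp \<kappa>' * exp (\<kappa> * z) * z) * xi ^ (card F - 1)) * z ^ m"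
        by (simp add: mult_ac)
      also have "\<dots> \<le> fact (card J) * (xi * xi ^ (card F - 1)) * z ^ m"
        using z_ge_1 xi_ge by (intro mult_right_mono mult_left_mono) auto
      also have "xi * xi ^ (card F - 1) = xi ^ card F" using F1 by (metis power_Suc diff_Suc_1)
      finally show "(\<Sum>S\<in>Pow Q. \<Sum>T\<in>Pow J.
          exp C * ?W S * ((\<kappa> * z) ^ card T * fact (card J - card T)) * (xi ^ (card F - 1) * z * z ^ m))
        \<le> fact (card J) * xi ^ card F * z ^ m" .
    qed auto
    finally show ?thesis by (simp add: m_def)
  qed
qed

end

text \<open>Averaged over the cubes, the energy \<open>w q\<close> of an inserted particle is at
  most \<open>H / 2\<close>, so at most half of the cubes reach \<open>H\<close>. The lower bound on
  \<open>b\<close> is demanded only where \<open>\<Xi>\<close> is below \<open>H\<close>; thus a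
  singular core can be encoded by giving \<open>\<Xi>\<close> the value \<open>H\<close>
  there.\<close>

lemma insertion_integral_ge:
  fixes b :: "'a \<Rightarrow> 'a \<Rightarrow> ennreal" and c :: "'a \<Rightarrow> 'q" and x :: "nat \<Rightarrow> 'a" and \<Xi> :: "'q \<Rightarrow> 'q \<Rightarrow> real"
  assumes Q: "finite Q" and J: "finite J"
    and c [measurable]: "c \<in> measurable \<nu> (count_space UNIV)"
    and vol: "\<And>q. q \<in> Q \<Longrightarrow> emeasure \<nu> {y \<in> space \<nu>. c y = q} \<ge> ennreal v" and v: "v \<ge> 0"
    and Xi_nonneg: "\<And>p q. \<Xi> p q \<ge> 0"
    and column: "\<And>p. p \<in> Q \<Longrightarrow> (\<Sum>q\<in>Q. \<Xi> q p) \<le> D"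
    and b_ge: "\<And>y u. y \<in> space \<nu> \<Longrightarrow> u \<in> space \<nu> \<Longrightarrow> \<Xi> (c y) (c u) < H \<Longrightarrow>
        b y u \<ge> ennreal (exp (- \<Xi> (c y) (c u)))"
    and x: "\<And>j. j \<in> J \<Longrightarrow> x j \<in> space \<nu>" "\<And>j. j \<in> J \<Longrightarrow> c (x j) \<in> Q"
    and density: "real (card J) * D \<le> H * real (card Q) / 2" and H: "H > 0"
  shows "ennreal (real (card Q) / 2 * v * exp (- H)) \<le> (\<integral>\<^sup>+y. (\<Prod>j\<in>J. b y (x j)) \<partial>\<nu>)"
proof -
  define w where "w q = (\<Sum>j\<in>J. \<Xi> q (c (x j)))" for q
  define G where "G = {q\<in>Q. w q < H}"
  have finG: "finite G" "G \<subseteq> Q" using Q by (auto simp: G_def)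
  have w0: "w q \<ge> 0" for q unfolding w_def by (intro sum_nonneg Xi_nonneg)
  have "real (card (Q - G)) * H = (\<Sum>q\<in>Q - G. H)" by simp
  also have "\<dots> \<le> (\<Sum>q\<in>Q - G. w q)" by (rule sum_mono) (auto simp: G_def)
  also have "\<dots> \<le> (\<Sum>q\<in>Q. w q)" by (rule sum_mono2) (use Q w0 in auto)
  also have "\<dots> = (\<Sum>j\<in>J. \<Sum>q\<in>Q. \<Xi> q (c (x j)))" unfolding w_def by (rule sum.swap)
  also have "\<dots> \<le> (\<Sum>j\<in>J. D)" by (intro sum_mono column x)
  also have "\<dots> \<le> H * real (card Q) / 2" using density by simp
  finally have "H * real (card (Q - G)) \<le> H * (real (card Q) / 2)" by (simp add: mult.commute)
  then have "real (card (Q - G)) \<le> real (card Q) / 2" using H by (subst (asm) mult_le_cancel_left_pos) auto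
  moreover have "card (Q - G) = card Q - card G" "card G \<le> card Q"
    using Q finG by (auto simp: card_Diff_subset card_mono)
  ultimately have cG: "real (card Q) / 2 \<le> real (card G)" by simp
  have pos: "ennreal (exp (- H)) * (\<Sum>q\<in>G. indicator {y\<in>space \<nu>. c y = q} y) \<le> (\<Prod>j\<in>J. b y (x j))"
    if y: "y \<in> space \<nu>" for y
  proof (cases "c y \<in> G")
    case False
    then have "(\<Sum>q\<in>G. indicator {y\<in>space \<nu>. c y = q} y :: ennreal) = 0"
      by (intro sum.neutral) (auto simp: indicator_def)
    then show ?thesis by simp
  next
    case True
    have "(\<Sum>q\<in>G. indicator {y\<in>space \<nu>. c y = q} y :: ennreal) = (\<Sum>q\<in>G. if q = c y then 1 else 0)"
      by (rule sum.cong) (use y in \<open>auto simp: indicator_def\<close>)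
    also have "\<dots> = 1" using True finG by simp
    finally have "ennreal (exp (- H)) * (\<Sum>q\<in>G. indicator {y\<in>space \<nu>. c y = q} y) = ennreal (exp (- H))" by simp
    also have "\<dots> \<le> ennreal (exp (\<Sum>j\<in>J. - \<Xi> (c y) (c (x j))))"
      using True by (intro ennreal_leI) (simp add: G_def w_def sum_negf)
    also have "\<dots> = (\<Prod>j\<in>J. ennreal (exp (- \<Xi> (c y) (c (x j)))))"
      using J by (simp add: exp_sum prod_ennreal)
    also have "\<dots> \<le> (\<Prod>j\<in>J. b y (x j))"
    proof (intro prod_mono_ennreal b_ge y x)
      fix j assume "j \<in> J"
      then have "\<Xi> (c y) (c (x j)) \<le> w (c y)"
        unfolding w_def using J Xi_nonneg by (intro member_le_sum[of j J "\<lambda>j. \<Xi> (c y) (c (x j))"]) auto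
      also have "\<dots> < H" using True by (simp add: G_def)
      finally show "\<Xi> (c y) (c (x j)) < H" .
    qed
    finally show ?thesis .
  qed
  have "ennreal (real (card Q) / 2 * v * exp (- H)) \<le> ennreal (exp (- H) * (real (card G) * v))"
    using mult_left_mono[OF mult_right_mono[OF cG v], of "exp (- H)"]
    by (intro ennreal_leI) (simp only: mult.commute[of _ "exp (- H)"], simp)
  also have "\<dots> = ennreal (exp (- H)) * (\<Sum>q\<in>G. ennreal v)"
    using v by (simp add: ennreal_mult ennreal_of_nat_eq_real_of_nat)
  also have "\<dots> \<le> ennreal (exp (- H)) * (\<Sum>q\<in>G. emeasure \<nu> {y\<in>space \<nu>. c y = q})"
    by (intro mult_left_mono sum_mono vol) (use finG in auto)
  also have "\<dots> = (\<integral>\<^sup>+y. ennreal (exp (- H)) * (\<Sum>q\<in>G. indicator {y\<in>space \<nu>. c y = q} y) \<partial>\<nu>)"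
    by (simp add: nn_integral_cmult nn_integral_sum)
  also have "\<dots> \<le> (\<integral>\<^sup>+y. (\<Prod>j\<in>J. b y (x j)) \<partial>\<nu>)"
    by (rule nn_integral_mono) (rule pos)
  finally show ?thesis .
qed

section \<open>Lattice sums\<close>

definition max_abs :: "int ^ 'd \<Rightarrow> nat" where
  "max_abs k = Max (range (\<lambda>i. nat \<bar>k $ i\<bar>))"

lemma max_abs_ge: "nat \<bar>k $ i\<bar> \<le> max_abs k"
  unfolding max_abs_def by (rule Max_ge) auto

lemma max_abs_attained: obtains i where "max_abs k = nat \<bar>k $ i\<bar>"
proof -
  have "max_abs k \<in> range (\<lambda>i. nat \<bar>k $ i\<bar>)" unfolding max_abs_def by (rule Max_in) auto
  then show ?thesis using that by auto
qed

lemma max_abs_le_iff: "max_abs k \<le> n \<longleftrightarrow> (\<forall>i. \<bar>k $ i\<bar> \<le> int n)"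
  unfolding max_abs_def by (subst Max_le_iff) (auto simp: nat_le_iff)

lemma max_abs_minus [simp]: "max_abs (- k) = max_abs k"
  by (simp add: max_abs_def)

lemma max_abs_diff_le: "max_abs (k - l) \<le> max_abs k + max_abs l"
  unfolding max_abs_le_iff
proof
  fix i
  have "\<bar>(k - l) $ i\<bar> \<le> \<bar>k $ i\<bar> + \<bar>l $ i\<bar>" by simp
  also have "\<dots> \<le> int (max_abs k) + int (max_abs l)"
    using max_abs_ge[of k i] max_abs_ge[of l i] by linarith
  finally show "\<bar>(k - l) $ i\<bar> \<le> int (max_abs k + max_abs l)" by simp
qed

lemma bij_betw_vec_box:
  "bij_betw (\<lambda>f. \<chi> i. f i) (PiE UNIV (\<lambda>_. G)) {k :: 'b ^ 'd. \<forall>i. k $ i \<in> G}"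
  by (rule bij_betw_byWitness[where f' = "\<lambda>k i. k $ i"]) (auto simp: PiE_UNIV_domain)

lemma finite_vec_box:
  assumes "finite G"
  shows "finite {k :: 'b ^ 'd. \<forall>i. k $ i \<in> G}"
proof -
  have "bij_betw (\<lambda>f. \<chi> i. f i) (PiE UNIV (\<lambda>_. G)) {k :: 'b ^ 'd. \<forall>i. k $ i \<in> G}"
    by (rule bij_betw_vec_box)
  from bij_betw_finite[OF this] show ?thesis using assms by (simp add: finite_PiE)
qed

lemma card_vec_box: "card {k :: 'b ^ 'd. \<forall>i. k $ i \<in> G} = card G ^ CARD('d)"
proof -
  have "bij_betw (\<lambda>f. \<chi> i. f i) (PiE UNIV (\<lambda>_. G)) {k :: 'b ^ 'd. \<forall>i. k $ i \<in> G}"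
    by (rule bij_betw_vec_box)
  from bij_betw_same_card[OF this] show ?thesis by (simp add: card_PiE)
qed

lemma finite_max_abs_le: "finite {k :: int ^ 'd. max_abs k \<le> n}"
  unfolding max_abs_le_iff
  by (rule finite_subset[OF _ finite_vec_box[of "{- int n..int n}"]]) (auto simp: abs_le_iff minus_le_iff)

lemma sum_vec_box_prod:
  fixes f :: "'b \<Rightarrow> real"
  assumes "finite G"
  shows "(\<Sum>k\<in>{k :: 'b ^ 'd. \<forall>i. k $ i \<in> G}. \<Prod>i\<in>UNIV. f (k $ i)) = (\<Sum>m\<in>G. f m) ^ CARD('d)"
proof -
  have "(\<Sum>k\<in>{k :: 'b ^ 'd. \<forall>i. k $ i \<in> G}. \<Prod>i\<in>UNIV. f (k $ i))
     = (\<Sum>g\<in>PiE (UNIV :: 'd set) (\<lambda>_. G). \<Prod>i\<in>UNIV. f (g i))"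
    by (subst sum.reindex_bij_betw[OF bij_betw_vec_box, symmetric]) simp
  also have "\<dots> = (\<Prod>i\<in>(UNIV :: 'd set). \<Sum>m\<in>G. f m)"
    by (rule prod_sum_PiE[symmetric]) (use assms in auto)
  finally show ?thesis by simp
qed

text \<open>Block \<open>n\<close> consists of the integers with absolute value in
  \<open>[n * M, n * M + M)\<close>. It has at most \<open>2 * M\<close> elements, and the summand
  is at most \<open>(n + 1) powr (- s)\<close> on it; hence a constant independent of
  \<open>M\<close>.\<close>

lemma int_power_sum_le:
  fixes s :: real
  assumes "s > 1"
  obtains B where "B \<ge> 0" "\<And>(M::nat) F. M \<ge> 1 \<Longrightarrow> finite F \<Longrightarrow>
    (\<Sum>m\<in>F. (1 + real_of_int \<bar>m\<bar> / real M) powr (- s)) \<le> B * real M"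
proof
  have sm: "summable (\<lambda>n. real (Suc n) powr (- s))"
    using assms by (subst summable_Suc_iff) (simp add: summable_real_powr_iff)
  let ?B = "2 * (\<Sum>n. real (Suc n) powr (- s))"
  show "?B \<ge> 0" by (intro mult_nonneg_nonneg suminf_nonneg sm) auto
  fix M :: nat and F :: "int set"
  assume M: "M \<ge> 1" and F: "finite F"
  define q where "q m = nat \<bar>m\<bar> div M" for m
  have le: "(1 + real_of_int \<bar>m\<bar> / real M) powr (- s) \<le> real (Suc (q m)) powr (- s)" for m
  proof (rule powr_mono2')
    have "real (q m) * real M \<le> real (nat \<bar>m\<bar>)"
      unfolding q_def of_nat_mult[symmetric] of_nat_le_iff by simp
    then show "real (Suc (q m)) \<le> 1 + real_of_int \<bar>m\<bar> / real M" using M by (simp add: field_simps)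
  qed (use assms in auto)
  have card: "card {m\<in>F. q m = n} \<le> 2 * M" for n
  proof -
    have "{m\<in>F. q m = n} \<subseteq> {int (n * M)..<int (n * M + M)} \<union> uminus ` {int (n * M)..<int (n * M + M)}"
    proof
      fix m assume "m \<in> {m\<in>F. q m = n}"
      then have "nat \<bar>m\<bar> div M = n" by (simp add: q_def)
      then have "n * M + nat \<bar>m\<bar> mod M = nat \<bar>m\<bar>" by auto
      moreover have "nat \<bar>m\<bar> mod M < M" using M by simp
      ultimately have "n * M \<le> nat \<bar>m\<bar>" "nat \<bar>m\<bar> < n * M + M" by linarith+
      then have "\<bar>m\<bar> \<in> {int (n * M)..<int (n * M + M)}"
        by (simp only: atLeastLessThan_iff) linarith
      then show "m \<in> {int (n * M)..<int (n * M + M)} \<union> uminus ` {int (n * M)..<int (n * M + M)}"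
        by (cases "m \<ge> 0") (auto intro!: image_eqI[of _ _ "- m"])
    qed
    then have "card {m\<in>F. q m = n} \<le> card ({int (n * M)..<int (n * M + M)} \<union> uminus ` {int (n * M)..<int (n * M + M)})"
      by (intro card_mono) auto
    also have "\<dots> \<le> card {int (n * M)..<int (n * M + M)} + card (uminus ` {int (n * M)..<int (n * M + M)})"
      by (rule card_Un_le)
    also have "\<dots> \<le> card {int (n * M)..<int (n * M + M)} + card {int (n * M)..<int (n * M + M)}"
      by (intro add_left_mono card_image_le) auto
    finally show ?thesis by simp
  qed
  have "(\<Sum>m\<in>F. (1 + real_of_int \<bar>m\<bar> / real M) powr (- s)) \<le> (\<Sum>m\<in>F. real (Suc (q m)) powr (- s))"
    by (intro sum_mono le)
  also have "\<dots> = (\<Sum>n\<in>q ` F. \<Sum>m\<in>{m\<in>F. q m = n}. real (Suc (q m)) powr (- s))"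
    by (rule sum.group[symmetric]) (use F in auto)
  also have "\<dots> = (\<Sum>n\<in>q ` F. real (card {m\<in>F. q m = n}) * real (Suc n) powr (- s))"
    by (rule sum.cong) auto
  also have "\<dots> \<le> (\<Sum>n\<in>q ` F. real (2 * M) * real (Suc n) powr (- s))"
    by (intro sum_mono mult_right_mono of_nat_mono card) auto
  also have "\<dots> = real (2 * M) * (\<Sum>n\<in>q ` F. real (Suc n) powr (- s))" by (simp add: sum_distrib_left)
  also have "\<dots> \<le> real (2 * M) * (\<Sum>n. real (Suc n) powr (- s))"
    using F by (intro mult_left_mono sum_le_suminf sm) auto
  finally show "(\<Sum>m\<in>F. (1 + real_of_int \<bar>m\<bar> / real M) powr (- s)) \<le> ?B * real M" by (simp add: mult_ac)
qed

text \<open>The maximum norm dominates every coordinate, so the term is at most a product of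
  one-dimensional terms with exponent \<open>s = 1 + p / d\<close>, and the sum factorises. The
  scaling \<open>M ^ d\<close> is that of the core repulsion, which allows \<open>M\<close> to be
  chosen after \<open>B\<close>.\<close>

lemma lattice_power_sum:
  fixes p :: real
  assumes "p > 0"
  obtains B where "B \<ge> 0"
    "\<And>M::nat. M \<ge> 1 \<Longrightarrow> (\<lambda>k::int ^ 'd. (1 + real (max_abs k) / real M) powr (- real CARD('d) - p)) summable_on UNIV"
    "\<And>M::nat. M \<ge> 1 \<Longrightarrow> (\<Sum>\<^sub>\<infinity>k::int ^ 'd. (1 + real (max_abs k) / real M) powr (- real CARD('d) - p)) \<le> B * real M ^ CARD('d)"
proof -
  let ?d = "real CARD('d)"
  have d: "?d > 0" by simp
  define s where "s = 1 + p / ?d"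
  have s: "s > 1" "?d * s = ?d + p" using assms d by (auto simp: s_def field_simps)
  obtain B where B: "B \<ge> 0" "\<And>(M::nat) F. M \<ge> 1 \<Longrightarrow> finite F \<Longrightarrow>
    (\<Sum>m\<in>F. (1 + real_of_int \<bar>m\<bar> / real M) powr (- s)) \<le> B * real M"
    using int_power_sum_le[OF s(1)] by blast
  have fin: "(\<Sum>k\<in>F. (1 + real (max_abs k) / real M) powr (- ?d - p)) \<le> (B * real M) ^ CARD('d)"
    if M: "M \<ge> 1" and F: "finite F" for M :: nat and F :: "(int ^ 'd) set"
  proof -
    define G where "G = (\<Union>k\<in>F. range (\<lambda>i. k $ i))"
    have G: "finite G" using F by (auto simp: G_def)
    have "(1 + real (max_abs k) / real M) powr (- ?d - p) \<le> (\<Prod>i\<in>UNIV. (1 + real_of_int \<bar>k $ i\<bar> / real M) powr (- s))"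
      for k :: "int ^ 'd"
    proof -
      have "(1 + real (max_abs k) / real M) powr (- ?d - p) = (\<Prod>i\<in>(UNIV :: 'd set). (1 + real (max_abs k) / real M) powr (- s))"
      proof -
        have "((1 + real (max_abs k) / real M) powr (- s)) ^ CARD('d) = (1 + real (max_abs k) / real M) powr (- s * ?d)"
          by (subst powr_power) (auto simp: add_pos_nonneg mult.commute intro!: add_pos_nonneg less_imp_neq[symmetric])
        also have "- s * ?d = - ?d - p" using s(2) by (simp add: mult.commute)
        finally show ?thesis by simp
      qed
      also have "\<dots> \<le> (\<Prod>i\<in>UNIV. (1 + real_of_int \<bar>k $ i\<bar> / real M) powr (- s))"
      proof (intro prod_mono conjI powr_mono2')
        fix i
        have "real_of_int \<bar>k $ i\<bar> \<le> real (max_abs k)" using max_abs_ge[of k i] by linarith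
        then show "1 + real_of_int \<bar>k $ i\<bar> / real M \<le> 1 + real (max_abs k) / real M"
          by (simp add: divide_right_mono)
      qed (use s in \<open>auto intro: add_pos_nonneg\<close>)
      finally show ?thesis .
    qed
    then have "(\<Sum>k\<in>F. (1 + real (max_abs k) / real M) powr (- ?d - p))
        \<le> (\<Sum>k\<in>F. \<Prod>i\<in>UNIV. (1 + real_of_int \<bar>k $ i\<bar> / real M) powr (- s))"
      by (intro sum_mono)
    also have "\<dots> \<le> (\<Sum>k\<in>{k :: int ^ 'd. \<forall>i. k $ i \<in> G}. \<Prod>i\<in>UNIV. (1 + real_of_int \<bar>k $ i\<bar> / real M) powr (- s))"
      by (rule sum_mono2[OF finite_vec_box[OF G]]) (auto simp: G_def intro!: prod_nonneg)
    also have "\<dots> = (\<Sum>m\<in>G. (1 + real_of_int \<bar>m\<bar> / real M) powr (- s)) ^ CARD('d)"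
      by (rule sum_vec_box_prod[OF G])
    also have "\<dots> \<le> (B * real M) ^ CARD('d)"
      by (intro power_mono B(2) M G sum_nonneg) auto
    finally show ?thesis .
  qed
  have summ: "(\<lambda>k::int ^ 'd. (1 + real (max_abs k) / real M) powr (- ?d - p)) summable_on UNIV" if "M \<ge> 1" for M :: nat
    by (rule nonneg_bdd_above_summable_on) (auto intro!: bdd_aboveI2 fin that)
  show ?thesis
  proof (rule that[of "B ^ CARD('d)"])
    show "(\<Sum>\<^sub>\<infinity>k::int ^ 'd. (1 + real (max_abs k) / real M) powr (- ?d - p)) \<le> B ^ CARD('d) * real M ^ CARD('d)"
      if "M \<ge> 1" for M :: nat
      unfolding power_mult_distrib[symmetric] by (intro infsum_le_finite_sums summ fin that)
  qed (use B summ in auto)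
qed

text \<open>The exponential series dominates its single term of order \<open>m\<close>, with
  \<open>m\<close> so large that \<open>e * m \<ge> s\<close>.\<close>

lemma exp_neg_le_powr:
  fixes e s :: real
  assumes "e > 0"
  obtains B where "B \<ge> 0" "\<And>t. t \<ge> 1 \<Longrightarrow> exp (- (t powr e)) \<le> B * t powr (- s)"
proof
  define m where "m = nat \<lceil>s / e\<rceil>"
  have "s / e \<le> real m" unfolding m_def by linarith
  then have m: "s \<le> e * real m" using assms by (simp add: field_simps)
  show "(fact m :: real) \<ge> 0" by simp
  fix t :: real assume t: "t \<ge> 1"
  let ?u = "t powr e"
  have u: "?u > 0" using t by simp
  have "(\<Sum>n\<in>{m}. ?u ^ n /\<^sub>R fact n) \<le> exp ?u"
    unfolding exp_def using summable_exp_generic[of ?u] u by (intro sum_le_suminf) auto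
  then have "?u ^ m \<le> fact m * exp ?u" by (simp add: field_simps)
  moreover have "?u ^ m = t powr (e * real m)" using t by (simp add: powr_realpow[symmetric] powr_powr)
  moreover have "t powr s \<le> t powr (e * real m)" using t m by (intro powr_mono) auto
  ultimately have "t powr s \<le> fact m * exp ?u" by linarith
  then show "exp (- ?u) \<le> fact m * t powr (- s)"
    using t by (simp add: exp_minus powr_minus field_simps)
qed

section \<open>The discrete torus and periodized kernels\<close>

definition torus :: "int \<Rightarrow> (int ^ 'd) set" where
  "torus K = {k. \<forall>i. - K < k $ i \<and> k $ i \<le> K}"

lemma torus_eq: "torus K = {k. \<forall>i. k $ i \<in> {- K<..K}}"
  by (auto simp: torus_def)

lemma finite_torus: "finite (torus K)"
  unfolding torus_eq by (rule finite_vec_box) simp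

lemma card_torus: "K \<ge> 0 \<Longrightarrow> real (card (torus K :: (int ^ 'd) set)) = (2 * real_of_int K) ^ CARD('d)"
  unfolding torus_eq by (subst card_vec_box) auto

lemma bij_betw_torus_translates:
  assumes K: "K > 0"
  shows "bij_betw (\<lambda>(q, r). q - p + (2 * K) *s r) (torus K \<times> UNIV) (UNIV :: (int ^ 'd) set)"
proof -
  have inj: "inj_on (\<lambda>(q, r). q - p + (2 * K) *s r) (torus K \<times> (UNIV :: (int ^ 'd) set))"
  proof (rule inj_onI, clarify)
    fix q r q' r' :: "int ^ 'd"
    assume q: "q \<in> torus K" "q' \<in> torus K" and e: "q - p + (2 * K) *s r = q' - p + (2 * K) *s r'"
    have "q $ i = q' $ i \<and> r $ i = r' $ i" for i
    proof -
      have e: "q $ i - q' $ i = 2 * K * (r' $ i - r $ i)"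
        using arg_cong[OF e, of "\<lambda>v. v $ i"] by (simp add: algebra_simps)
      have "\<bar>q $ i - q' $ i\<bar> < 2 * K" using q by (auto simp: torus_def abs_if dest!: spec[of _ i])
      then have "2 * K * \<bar>r' $ i - r $ i\<bar> < 2 * K * 1" unfolding e abs_mult using K by simp
      moreover have "0 < 2 * K" using K by simp
      ultimately have "\<bar>r' $ i - r $ i\<bar> < 1" by (simp only: mult_less_cancel_left_pos)
      then show ?thesis using e by auto
    qed
    then show "q = q' \<and> r = r'" by (simp add: vec_eq_iff)
  qed
  have surj: "\<exists>q\<in>torus K. \<exists>r. k = q - p + (2 * K) *s r" for k :: "int ^ 'd"
  proof -
    \<comment> \<open>The representatives are \<open>- K + 1, ..., K\<close>; the offset
      \<open>K - 1\<close> moves them to \<open>0, ..., 2 * K - 1\<close>, where division with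
      remainder applies.\<close>
    define r :: "int ^ 'd" where "r = (\<chi> i. (k $ i + p $ i + K - 1) div (2 * K))"
    define q where "q = k + p - (2 * K) *s r"
    have "q $ i = (k $ i + p $ i + K - 1) mod (2 * K) - K + 1" for i
      by (simp add: q_def r_def minus_div_mult_eq_mod[symmetric] algebra_simps)
    moreover have "0 \<le> a mod (2 * K)" "a mod (2 * K) < 2 * K" for a using K by auto
    ultimately have "q \<in> torus K" by (auto simp: torus_def) (smt (verit))
    moreover have "k = q - p + (2 * K) *s r" by (simp add: q_def)
    ultimately show ?thesis by blast
  qed
  show ?thesis
    unfolding bij_betw_def using inj surj by (force simp: image_iff)
qed

lemma periodize_summable:
  fixes f :: "int ^ 'd \<Rightarrow> real"
  assumes f: "f summable_on UNIV" and K: "K > 0"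
  shows "(\<lambda>r. f (k + (2 * K) *s r)) summable_on UNIV"
proof -
  have "inj (\<lambda>r. k + (2 * K) *s r)" using K by (auto simp: inj_on_def vec_eq_iff)
  moreover have "f summable_on range (\<lambda>r. k + (2 * K) *s r)"
    by (rule summable_on_subset_banach[OF f]) simp
  ultimately show ?thesis by (simp add: summable_on_reindex comp_def)
qed

text \<open>Residue and image together run once through the lattice. The result depends on neither
  \<open>K\<close> nor \<open>p\<close>, which is the source of the volume-independent
  constants.\<close>

lemma sum_torus_periodize:
  fixes f :: "int ^ 'd \<Rightarrow> real"
  assumes f: "f summable_on UNIV" and K: "K > 0"
  shows "(\<Sum>q\<in>torus K. \<Sum>\<^sub>\<infinity>r. f (q - p + (2 * K) *s r)) = (\<Sum>\<^sub>\<infinity>k. f k)"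
proof -
  note bij = bij_betw_torus_translates[OF K, of p]
  let ?g = "\<lambda>x. f (case x of (q, r) \<Rightarrow> q - p + (2 * K) *s r)"
  have s: "?g summable_on (torus K \<times> UNIV)"
    using summable_on_reindex_bij_betw[OF bij, of f] f by simp
  have "(\<Sum>\<^sub>\<infinity>k. f k) = infsum ?g (torus K \<times> UNIV)"
    by (rule infsum_reindex_bij_betw[OF bij, symmetric])
  also have "\<dots> = (\<Sum>\<^sub>\<infinity>q\<in>torus K. \<Sum>\<^sub>\<infinity>r. ?g (q, r))"
    using infsum_Sigma_banach[of ?g "torus K" "\<lambda>_. UNIV"] s by simp
  also have "\<dots> = (\<Sum>q\<in>torus K. \<Sum>\<^sub>\<infinity>r. f (q - p + (2 * K) *s r))"
    unfolding infsum_finite[OF finite_torus] by simp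
  finally show ?thesis by simp
qed

text \<open>The quotient distance modulo \<open>2 * K\<close>. As a least natural number it is
  attained by some image.\<close>

definition torus_dist :: "int \<Rightarrow> int ^ 'd \<Rightarrow> int ^ 'd \<Rightarrow> nat" where
  "torus_dist K p q = (LEAST n. \<exists>r. max_abs (q - p + (2 * K) *s r) = n)"

lemma torus_dist_le: "torus_dist K p q \<le> max_abs (q - p + (2 * K) *s r)"
  unfolding torus_dist_def by (rule Least_le) blast

lemma torus_dist_attained: obtains r where "torus_dist K p q = max_abs (q - p + (2 * K) *s r)"
proof -
  have "\<exists>r. max_abs (q - p + (2 * K) *s r) = torus_dist K p q"
    unfolding torus_dist_def by (rule LeastI_ex) blast
  then show ?thesis using that by metis
qed

lemma torus_dist_self [simp]: "torus_dist K p p = 0"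
  using torus_dist_le[of K p p 0] by (simp add: max_abs_def)

lemma torus_dist_triangle:
  "torus_dist K a q \<le> torus_dist K a p + max_abs (p - q + (2 * K) *s r)"
proof -
  obtain r' where r': "torus_dist K a p = max_abs (p - a + (2 * K) *s r')" using torus_dist_attained .
  have "torus_dist K a q \<le> max_abs (q - a + (2 * K) *s (r' - r))" by (rule torus_dist_le)
  also have "q - a + (2 * K) *s (r' - r) = (p - a + (2 * K) *s r') - (p - q + (2 * K) *s r)"
    by (simp add: vec_eq_iff algebra_simps)
  also have "max_abs \<dots> \<le> max_abs (p - a + (2 * K) *s r') + max_abs (p - q + (2 * K) *s r)"
    by (rule max_abs_diff_le)
  finally show ?thesis by (simp add: r')
qed

lemma infsum_lattice_uminus:
  fixes f :: "int ^ 'd \<Rightarrow> 'b :: {comm_monoid_add, t2_space}"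
  shows "(\<Sum>\<^sub>\<infinity>r. f (- r)) = (\<Sum>\<^sub>\<infinity>r. f r)"
  by (rule infsum_reindex_bij_betw) (rule bij_uminus)

lemma periodize_sym:
  fixes g :: "nat \<Rightarrow> real" and p q :: "int ^ 'd"
  shows "(\<Sum>\<^sub>\<infinity>r. g (max_abs (p - q + (2 * K) *s r))) = (\<Sum>\<^sub>\<infinity>r. g (max_abs (q - p + (2 * K) *s r)))"
proof -
  have "(\<Sum>\<^sub>\<infinity>r. g (max_abs (p - q + (2 * K) *s r))) = (\<Sum>\<^sub>\<infinity>r. g (max_abs (p - q + (2 * K) *s (- r))))"
    by (rule infsum_lattice_uminus[symmetric])
  also have "\<dots> = (\<Sum>\<^sub>\<infinity>r. g (max_abs (q - p + (2 * K) *s r)))"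
  proof (rule infsum_cong)
    fix r :: "int ^ 'd"
    have "p - q + (2 * K) *s (- r) = - (q - p + (2 * K) *s r)" by (simp add: vec_eq_iff)
    then show "g (max_abs (p - q + (2 * K) *s (- r))) = g (max_abs (q - p + (2 * K) *s r))"
      by (metis max_abs_minus)
  qed
  finally show ?thesis .
qed

definition periodized :: "(nat \<Rightarrow> real) \<Rightarrow> int \<Rightarrow> int ^ 'd \<Rightarrow> int ^ 'd \<Rightarrow> real" where
  "periodized g K p q = (\<Sum>\<^sub>\<infinity>r. g (max_abs (p - q + (2 * K) *s r)))"

lemma periodized_sym: "periodized g K p q = periodized g K q p"
  unfolding periodized_def by (rule periodize_sym)

lemma periodized_nonneg: "(\<And>n. g n \<ge> 0) \<Longrightarrow> periodized g K p q \<ge> 0"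
  unfolding periodized_def by (rule infsum_nonneg) auto

lemma periodized_column:
  fixes p :: "int ^ 'd"
  assumes "(\<lambda>k::int ^ 'd. g (max_abs k)) summable_on UNIV" "K > 0"
  shows "(\<Sum>q\<in>torus K. periodized g K q p) = (\<Sum>\<^sub>\<infinity>k::int ^ 'd. g (max_abs k))"
  unfolding periodized_def by (rule sum_torus_periodize[OF assms])

lemma periodized_ge_term:
  fixes p q :: "int ^ 'd"
  assumes "(\<lambda>k::int ^ 'd. g (max_abs k)) summable_on UNIV" "K > 0" "\<And>n. g n \<ge> 0"
  shows "g (max_abs (p - q + (2 * K) *s r)) \<le> periodized g K p q"
  unfolding periodized_def
  using finite_sum_le_infsum[OF periodize_summable[OF assms(1,2), of "p - q"], of "{r}"] assms(3) by simp

text \<open>Submultiplicativity of \<open>W\<close> and the triangle inequality move the weight at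
  \<open>q\<close> into the kernel, separately for each image, and leave the weight at
  \<open>p\<close>. What remains is a row sum of the periodization of \<open>g * W\<close>, that is,
  a sum over the whole lattice.\<close>

lemma periodized_weighted_row:
  fixes g W :: "nat \<Rightarrow> real" and p :: "int ^ 'd"
  assumes g: "\<And>n. g n \<ge> 0" and K: "K > 0"
    and W: "\<And>n. W n \<ge> 1" "\<And>m n. W (m + n) \<le> W m * W n" "mono W"
    and summ: "(\<lambda>k::int ^ 'd. g (max_abs k) * W (max_abs k)) summable_on UNIV"
  shows "(\<Sum>q\<in>torus K. periodized g K p q * W (torus_dist K a q))
    \<le> (\<Sum>\<^sub>\<infinity>k::int ^ 'd. g (max_abs k) * W (max_abs k)) * W (torus_dist K a p)"
proof -
  let ?gW = "\<lambda>n. g n * W n"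
  let ?k = "\<lambda>q r. max_abs (p - q + (2 * K) *s r)"
  have W0: "W n \<ge> 0" for n using W(1)[of n] by linarith
  have g_le: "g n \<le> ?gW n" for n using mult_left_mono[OF W(1) g] by simp
  have summg: "(\<lambda>k::int ^ 'd. g (max_abs k)) summable_on UNIV"
    by (rule summable_on_comparison_test[OF summ]) (use g g_le in auto)
  have "(\<Sum>q\<in>torus K. periodized g K p q * W (torus_dist K a q))
      \<le> (\<Sum>q\<in>torus K. periodized ?gW K p q * W (torus_dist K a p))"
  proof (rule sum_mono)
    fix q
    have s1: "(\<lambda>r. g (?k q r)) summable_on UNIV" by (rule periodize_summable[OF summg K])
    have s2: "(\<lambda>r. ?gW (?k q r)) summable_on UNIV" by (rule periodize_summable[OF summ K])
    have "periodized g K p q * W (torus_dist K a q) = (\<Sum>\<^sub>\<infinity>r. g (?k q r) * W (torus_dist K a q))"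
      unfolding periodized_def by (rule infsum_cmult_left'[symmetric])
    also have "\<dots> \<le> (\<Sum>\<^sub>\<infinity>r. ?gW (?k q r) * W (torus_dist K a p))"
    proof (rule infsum_mono)
      fix r
      have "W (torus_dist K a q) \<le> W (torus_dist K a p + ?k q r)"
        by (rule monoD[OF W(3) torus_dist_triangle])
      also have "\<dots> \<le> W (torus_dist K a p) * W (?k q r)" by (rule W(2))
      finally have "g (?k q r) * W (torus_dist K a q) \<le> g (?k q r) * (W (torus_dist K a p) * W (?k q r))"
        by (rule mult_left_mono) (rule g)
      then show "g (?k q r) * W (torus_dist K a q) \<le> ?gW (?k q r) * W (torus_dist K a p)"
        by (simp only: mult_ac)
    qed (use s1 s2 in \<open>auto intro: summable_on_cmult_left\<close>)
    also have "\<dots> = periodized ?gW K p q * W (torus_dist K a p)"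
      unfolding periodized_def by (rule infsum_cmult_left')
    finally show "periodized g K p q * W (torus_dist K a q) \<le> periodized ?gW K p q * W (torus_dist K a p)" .
  qed
  also have "\<dots> = (\<Sum>q\<in>torus K. periodized ?gW K q p) * W (torus_dist K a p)"
    by (simp add: sum_distrib_right periodized_sym[of _ _ p])
  also have "(\<Sum>q\<in>torus K. periodized ?gW K q p) = (\<Sum>\<^sub>\<infinity>k::int ^ 'd. ?gW (max_abs k))"
    by (rule periodized_column[OF summ K])
  finally show ?thesis .
qed

text \<open>The value at the closest image is one term of the periodization of
  \<open>u\<close>.\<close>

lemma sum_torus_dist_le:
  fixes u :: "nat \<Rightarrow> real" and p :: "int ^ 'd"
  assumes u: "\<And>n. u n \<ge> 0" "(\<lambda>k::int ^ 'd. u (max_abs k)) summable_on UNIV" and K: "K > 0"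
  shows "(\<Sum>q\<in>torus K. u (torus_dist K p q)) \<le> (\<Sum>\<^sub>\<infinity>k::int ^ 'd. u (max_abs k))"
proof -
  have "(\<Sum>q\<in>torus K. u (torus_dist K p q)) \<le> (\<Sum>q\<in>torus K. periodized u K q p)"
  proof (rule sum_mono)
    fix q
    obtain r where "torus_dist K p q = max_abs (q - p + (2 * K) *s r)" using torus_dist_attained .
    then show "u (torus_dist K p q) \<le> periodized u K q p"
      using periodized_ge_term[OF u(2) K u(1)] by simp
  qed
  also have "\<dots> = (\<Sum>\<^sub>\<infinity>k::int ^ 'd. u (max_abs k))" by (rule periodized_column[OF u(2) K])
  finally show ?thesis .
qed

section \<open>The periodized potential\<close>

lemma has_sum_ereal:
  assumes "(f has_sum s) A"
  shows "((\<lambda>x. ereal (f x)) has_sum ereal s) A"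
proof -
  have "((ereal \<circ> f) has_sum ereal s) A"
    by (rule has_sum_comm_additive_general[OF _ _ assms]) (auto simp: tendsto_ereal)
  then show ?thesis by (simp add: comp_def)
qed

lemma infsum_ereal:
  assumes "f summable_on A"
  shows "(\<lambda>x. ereal (f x)) summable_on A" "(\<Sum>\<^sub>\<infinity>x\<in>A. ereal (f x)) = ereal (\<Sum>\<^sub>\<infinity>x\<in>A. f x)"
  using has_sum_ereal[OF has_sum_infsum[OF assms]] by (auto simp: summable_on_def intro: infsumI)

lemma sum_ereal_not_MInf:
  fixes f :: "'r \<Rightarrow> ereal"
  assumes "\<And>r. f r \<noteq> - \<infinity>"
  shows "sum f F \<noteq> - \<infinity>"
  using assms by (induction F rule: infinite_finite_induct) (auto simp: ereal_plus_eq_MInfty)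

text \<open>An infinite term makes all large partial sums infinite, as no term is
  \<open>- \<infinity>\<close>. Otherwise all terms are real, and the finite set \<open>E\<close>,
  on which no bound is known, does not affect summability.\<close>

lemma summable_on_ereal_dominated:
  fixes f :: "'r \<Rightarrow> ereal"
  assumes f: "\<And>r. f r \<noteq> - \<infinity>" and E: "finite E"
    and g: "g summable_on UNIV" and dom: "\<And>r. r \<notin> E \<Longrightarrow> \<bar>f r\<bar> \<le> ereal (g r)"
  shows "f summable_on UNIV"
proof (cases "\<exists>r. f r = \<infinity>")
  case True
  then obtain r where r: "f r = \<infinity>" by auto
  have "\<forall>\<^sub>F F in finite_subsets_at_top UNIV. \<infinity> = sum f F"
    unfolding eventually_finite_subsets_at_top
  proof (intro exI[of _ "{r}"] conjI allI impI)
    fix F assume F: "finite F \<and> {r} \<subseteq> F \<and> F \<subseteq> UNIV"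
    then have "sum f F = f r + sum f (F - {r})" by (intro sum.remove) auto
    moreover have "sum f (F - {r}) \<noteq> - \<infinity>" using f by (rule sum_ereal_not_MInf)
    ultimately show "\<infinity> = sum f F" using r by simp
  qed auto
  then have "(f has_sum \<infinity>) UNIV"
    unfolding has_sum_def by (rule tendsto_eventually[OF eventually_mono]) auto
  then show ?thesis by (auto simp: summable_on_def)
next
  case False
  define f' where "f' r = real_of_ereal (f r)" for r
  have ff': "f r = ereal (f' r)" for r
    using f[of r] False by (cases "f r") (auto simp: f'_def)
  have "f' summable_on (UNIV - E)"
  proof (rule abs_summable_summable, rule summable_on_comparison_test)
    show "g summable_on (UNIV - E)" by (rule summable_on_subset_banach[OF g]) auto
    show "norm (f' r) \<le> g r" if "r \<in> UNIV - E" for r using dom[of r] that by (simp add: ff')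
    show "0 \<le> norm (f' r)" for r by simp
  qed
  then have "f' summable_on ((UNIV - E) \<union> E)" using E by (intro summable_on_Un_disjoint) auto
  then have "f' summable_on UNIV" by simp
  then show ?thesis using infsum_ereal(1)[of f' UNIV] by (simp add: ff'[abs_def])
qed

text \<open>Rounding up gives cubes that are open on the left and closed on the right, like the
  cell; for \<open>L = K * \<delta>\<close> the cubes with index in \<open>torus K\<close> tile it
  exactly.\<close>

definition cube_index :: "real \<Rightarrow> real ^ 'd \<Rightarrow> int ^ 'd" where
  "cube_index \<delta> x = (\<chi> i. \<lceil>x $ i / \<delta>\<rceil>)"

definition of_int_vec :: "int ^ 'd \<Rightarrow> real ^ 'd" where
  "of_int_vec r = (\<chi> k. real_of_int (r $ k))"

definition periodic_potential :: "(real ^ 'd \<Rightarrow> ereal) \<Rightarrow> real \<Rightarrow> real ^ 'd \<Rightarrow> ereal" where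
  "periodic_potential \<phi> L x = (\<Sum>\<^sub>\<infinity>r. \<phi> (x + (2 * L) *\<^sub>R of_int_vec r))"

text \<open>Rounding both points changes a coordinate difference by at most 1 in units of
  \<open>\<delta>\<close>, and a shift by \<open>2 * L\<close> is exactly a shift by
  \<open>2 * K\<close> indices.\<close>

lemma infnorm_ge_cube_index:
  fixes x y :: "real ^ 'd"
  assumes \<delta>: "\<delta> > 0" and L: "L = real_of_int K * \<delta>"
  shows "\<delta> * (real (max_abs (cube_index \<delta> x - cube_index \<delta> y + (2 * K) *s r)) - 1)
    \<le> infnorm (x - y + (2 * L) *\<^sub>R of_int_vec r)"
proof -
  let ?k = "cube_index \<delta> x - cube_index \<delta> y + (2 * K) *s r"
  let ?v = "x - y + (2 * L) *\<^sub>R of_int_vec r"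
  obtain i where i: "max_abs ?k = nat \<bar>?k $ i\<bar>" using max_abs_attained .
  have k: "real_of_int (?k $ i) = real_of_int \<lceil>x $ i / \<delta>\<rceil> - real_of_int \<lceil>y $ i / \<delta>\<rceil> + 2 * real_of_int K * real_of_int (r $ i)"
    by (simp add: cube_index_def)
  have v: "?v $ i / \<delta> = x $ i / \<delta> - y $ i / \<delta> + 2 * real_of_int K * real_of_int (r $ i)"
    using \<delta> by (simp add: L of_int_vec_def field_simps)
  have "\<bar>real_of_int (?k $ i) - ?v $ i / \<delta>\<bar> \<le> 1" unfolding k v by linarith
  then have "\<bar>real_of_int (?k $ i)\<bar> - 1 \<le> \<bar>?v $ i / \<delta>\<bar>" by linarith
  also have "\<dots> = \<bar>?v $ i\<bar> / \<delta>" using \<delta> by simp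
  finally have "\<delta> * (\<bar>real_of_int (?k $ i)\<bar> - 1) \<le> \<bar>?v $ i\<bar>" using \<delta> by (simp add: field_simps)
  also have "\<dots> \<le> infnorm ?v" by (rule component_le_infnorm_cart)
  finally show ?thesis by (simp add: i)
qed

lemma infnorm_le_same_cube:
  fixes x y :: "real ^ 'd"
  assumes "\<delta> > 0" "cube_index \<delta> x = cube_index \<delta> y"
  shows "infnorm (x - y) \<le> \<delta>"
proof -
  have "\<bar>(x - y) $ i\<bar> \<le> \<delta>" for i
  proof -
    have "\<lceil>x $ i / \<delta>\<rceil> = \<lceil>y $ i / \<delta>\<rceil>"
      using arg_cong[OF assms(2), of "\<lambda>v. v $ i"] by (simp add: cube_index_def)
    then have "\<bar>x $ i / \<delta> - y $ i / \<delta>\<bar> \<le> 1" by linarith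
    also have "x $ i / \<delta> - y $ i / \<delta> = (x - y) $ i / \<delta>" by (simp add: diff_divide_distrib)
    finally show ?thesis using assms(1) by (simp add: field_simps)
  qed
  then show ?thesis unfolding infnorm_cart by (intro cSup_least) auto
qed

text \<open>The decay is expressed in powers of \<open>1 + infnorm x\<close>, which are harmless at
  the origin. The lower bound holds everywhere, the upper one only away from the origin with a
  constant depending on the excluded radius.\<close>

locale tempered_potential =
  fixes \<phi> :: "real ^ 'd \<Rightarrow> ereal" and s G\<^sub>1 :: real
  assumes not_MInf: "\<And>x. \<phi> x \<noteq> - \<infinity>"
    and phi_even: "\<And>x. \<phi> (- x) = \<phi> x"
    and measurable_phi [measurable]: "\<phi> \<in> borel_measurable borel"
    and s_gt: "s > real CARD('d)"
    and G1: "G\<^sub>1 \<ge> 0" "\<And>x. \<phi> x \<ge> - ereal (G\<^sub>1 * (1 + infnorm x) powr (- s))"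
    and upper: "\<And>r. r > 0 \<Longrightarrow> \<exists>B\<ge>0. \<forall>x. r \<le> infnorm x \<longrightarrow> \<phi> x \<le> ereal (B * (1 + infnorm x) powr (- s))"
begin

text \<open>The decay at distance \<open>n / M\<close>. It involves \<open>M\<close> and not the
  actual side \<open>\<delta>\<close>, which varies with the volume; this keeps later constants
  independent of \<open>L\<close>.\<close>

definition profile :: "nat \<Rightarrow> nat \<Rightarrow> real" where
  "profile M n = (1 + real n / real M) powr (- s)"

lemma profile_nonneg: "profile M n \<ge> 0"
  by (simp add: profile_def)

lemma profile_summable:
  assumes "M \<ge> 1"
  shows "(\<lambda>k :: int ^ 'd. profile M (max_abs k)) summable_on UNIV"
proof -
  have p: "s - real CARD('d) > 0" using s_gt by simp
  show ?thesis
    using lattice_power_sum[where 'd = 'd, OF p] assms unfolding profile_def by (simp add: algebra_simps) blast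
qed

text \<open>Points at index distance \<open>n\<close> may be as close as \<open>n - 1\<close> sides.
  Since \<open>1 / M \<le> 1\<close>, halving \<open>1 + n / M\<close> makes up for the lost side,
  at the price of \<open>2 powr s\<close>.\<close>

lemma infnorm_powr_le_profile:
  fixes x :: "real ^ 'd"
  assumes M: "M \<ge> 2" and \<delta>: "1 / real M \<le> \<delta>" and x: "\<delta> * (real n - 1) \<le> infnorm x"
  shows "(1 + infnorm x) powr (- s) \<le> 2 powr s * profile M n"
proof -
  have M0: "real M > 0" using M by simp
  have "(1 + real n / real M) / 2 \<le> 1 + infnorm x"
  proof (cases n)
    case 0
    then show ?thesis using infnorm_pos_le[of x] by simp
  next
    case (Suc m)
    have "1 / real M * real m \<le> \<delta> * real m" by (rule mult_right_mono[OF \<delta>]) simp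
    also have "\<dots> \<le> infnorm x" using x Suc by simp
    finally have m: "real m / real M \<le> infnorm x" by simp
    have "1 / real M \<le> 1" using M by simp
    then show ?thesis using m infnorm_pos_le[of x] by (simp add: Suc add_divide_distrib)
  qed
  then have "(1 + infnorm x) powr (- s) \<le> ((1 + real n / real M) / 2) powr (- s)"
    using s_gt M0 by (intro powr_mono2') (auto intro: add_pos_nonneg)
  also have "\<dots> = 2 powr s * profile M n"
    using M0 by (subst powr_divide) (auto simp: profile_def powr_minus divide_inverse mult.commute)
  finally show ?thesis .
qed

text \<open>Translates within distance 1 of the origin may lack an upper bound, but there are
  finitely many: with cubes of side \<open>L\<close>, the case \<open>K = 1\<close>, different
  \<open>r\<close> have different indices, and these are bounded.\<close>

lemma summable_translates:
  assumes L: "L > 0"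
  shows "(\<lambda>r. \<phi> (x + (2 * L) *\<^sub>R of_int_vec r)) summable_on UNIV"
proof -
  obtain B where B: "B \<ge> 0" "\<And>x. 1 \<le> infnorm x \<Longrightarrow> \<phi> x \<le> ereal (B * (1 + infnorm x) powr (- s))"
    using upper[of 1] by auto
  let ?G = "max G\<^sub>1 B"
  have bound: "\<bar>\<phi> v\<bar> \<le> ereal (?G * (1 + infnorm v) powr (- s))" if "1 \<le> infnorm v" for v
  proof -
    have "G\<^sub>1 * (1 + infnorm v) powr (- s) \<le> ?G * (1 + infnorm v) powr (- s)"
      "B * (1 + infnorm v) powr (- s) \<le> ?G * (1 + infnorm v) powr (- s)"
      by (auto intro: mult_right_mono)
    then show ?thesis using G1(2)[of v] B(2)[OF that] by (cases "\<phi> v") auto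
  qed
  define M where "M = nat \<lceil>max 2 (1 / L)\<rceil>"
  have M: "M \<ge> 2" "1 / L \<le> real M" unfolding M_def by linarith+
  then have ML1: "1 / real M \<le> L" using L by (simp add: field_simps)
  let ?k = "\<lambda>r. cube_index L x - cube_index L 0 + (2 * 1) *s r"
  have ge: "L * (real (max_abs (?k r)) - 1) \<le> infnorm (x + (2 * L) *\<^sub>R of_int_vec r)" for r
    using infnorm_ge_cube_index[OF L, of L 1 x 0 r] by simp
  define E where "E = {r. infnorm (x + (2 * L) *\<^sub>R of_int_vec r) < 1}"
  have "?k ` E \<subseteq> {k. max_abs k \<le> M + 1}"
  proof clarify
    fix r assume "r \<in> E"
    then have "L * (real (max_abs (?k r)) - 1) < 1" using ge[of r] by (simp add: E_def)
    then have "real (max_abs (?k r)) - 1 < 1 / L" using L by (simp add: field_simps)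
    then show "max_abs (?k r) \<le> M + 1" using M by linarith
  qed
  moreover have "inj_on ?k E" by (auto simp: inj_on_def vec_eq_iff)
  ultimately have "finite E" using inj_on_finite[OF _ _ finite_max_abs_le] by metis
  then show ?thesis
  proof (rule summable_on_ereal_dominated[rotated])
    show "(\<lambda>r. ?G * (2 powr s * profile M (max_abs (?k r)))) summable_on UNIV"
      using M by (intro summable_on_cmult_right periodize_summable profile_summable) auto
    fix r assume "r \<notin> E"
    then have "\<bar>\<phi> (x + (2 * L) *\<^sub>R of_int_vec r)\<bar> \<le> ereal (?G * (1 + infnorm (x + (2 * L) *\<^sub>R of_int_vec r)) powr (- s))"
      by (intro bound) (simp add: E_def)
    also have "\<dots> \<le> ereal (?G * (2 powr s * profile M (max_abs (?k r))))"
      unfolding ereal_less_eq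
      by (intro mult_left_mono infnorm_powr_le_profile[OF M(1) ML1 ge]) (use G1 in auto)
    finally show "\<bar>\<phi> (x + (2 * L) *\<^sub>R of_int_vec r)\<bar> \<le> ereal (?G * (2 powr s * profile M (max_abs (?k r))))" .
  qed (rule not_MInf)
qed

lemma periodic_potential_even: "periodic_potential \<phi> L (- x) = periodic_potential \<phi> L x"
proof -
  have "periodic_potential \<phi> L (- x) = (\<Sum>\<^sub>\<infinity>r. \<phi> (- x + (2 * L) *\<^sub>R of_int_vec (- r)))"
    unfolding periodic_potential_def
    by (rule infsum_lattice_uminus[of "\<lambda>r. \<phi> (- x + (2 * L) *\<^sub>R of_int_vec r)", symmetric])
  also have "\<dots> = periodic_potential \<phi> L x"
    unfolding periodic_potential_def
  proof (rule infsum_cong)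
    fix r
    have "- x + (2 * L) *\<^sub>R of_int_vec (- r) = - (x + (2 * L) *\<^sub>R of_int_vec r)"
      by (simp add: vec_eq_iff of_int_vec_def)
    then show "\<phi> (- x + (2 * L) *\<^sub>R of_int_vec (- r)) = \<phi> (x + (2 * L) *\<^sub>R of_int_vec r)" by (metis phi_even)
  qed
  finally show ?thesis .
qed

text \<open>An unconditional sum is also the limit along growing boxes, whose finite sums are
  measurable.\<close>

lemma periodic_potential_measurable:
  assumes L: "L > 0"
  shows "periodic_potential \<phi> L \<in> borel_measurable borel"
proof (rule borel_measurable_LIMSEQ_order)
  let ?F = "\<lambda>n. {r :: int ^ 'd. max_abs r \<le> n}"
  have F: "filterlim ?F (finite_subsets_at_top UNIV) sequentially"
    unfolding filterlim_finite_subsets_at_top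
  proof safe
    fix X :: "(int ^ 'd) set" assume X: "finite X"
    have "\<forall>\<^sub>F n in sequentially. n \<ge> Max (insert 0 (max_abs ` X))" by (rule eventually_ge_at_top)
    then show "\<forall>\<^sub>F n in sequentially. finite (?F n) \<and> X \<subseteq> ?F n \<and> ?F n \<subseteq> UNIV"
    proof eventually_elim
      case (elim n)
      then show ?case using X finite_max_abs_le by auto
    qed
  qed
  show "(\<lambda>n. \<Sum>r\<in>?F n. \<phi> (x + (2 * L) *\<^sub>R of_int_vec r)) \<longlonglongrightarrow> periodic_potential \<phi> L x"
    if "x \<in> space borel" for x
    unfolding periodic_potential_def
    by (rule filterlim_compose[OF infsum_tendsto[OF summable_translates[OF L]] F])
  show "(\<lambda>x. \<Sum>r\<in>?F n. \<phi> (x + (2 * L) *\<^sub>R of_int_vec r)) \<in> borel_measurable borel" for n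
    by measurable
qed

text \<open>The bound \<open>e\<close> is credited to the image \<open>r = 0\<close> only, while the
  attraction is charged for every image, this one included; the overcharge gives a full
  periodization. With \<open>max 0 e\<close> the same estimate also serves pairs without a repulsive
  core.\<close>

lemma periodic_potential_lower:
  fixes x y :: "real ^ 'd"
  assumes M: "M \<ge> 2" and \<delta>: "1 / real M \<le> \<delta>" and K: "K > 0" and L: "L = real_of_int K * \<delta>"
    and \<phi>0: "\<phi> (x - y) \<ge> ereal e"
  shows "periodic_potential \<phi> L (x - y) \<ge>
    ereal (max 0 e - periodized (\<lambda>n. G\<^sub>1 * 2 powr s * profile M n) K (cube_index \<delta> x) (cube_index \<delta> y))"
proof -
  have d0: "\<delta> > 0" using M \<delta> by (smt (verit) divide_pos_pos of_nat_0_less_iff pos2 order_less_le_trans)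
  then have L0: "L > 0" using L K by simp
  let ?k = "\<lambda>r. cube_index \<delta> x - cube_index \<delta> y + (2 * K) *s r"
  let ?g = "\<lambda>n. G\<^sub>1 * 2 powr s * profile M n"
  let ?e = "\<lambda>r :: int ^ 'd. if r = 0 then max 0 e else 0"
  have sg: "(\<lambda>r. ?g (max_abs (?k r))) summable_on UNIV"
    using M K by (intro periodize_summable summable_on_cmult_right profile_summable) auto
  have se: "(?e has_sum max 0 e) UNIV"
    by (rule has_sum_finite_neutralI[of "{0}"]) auto
  have lower: "ereal (?e r - ?g (max_abs (?k r))) \<le> \<phi> (x - y + (2 * L) *\<^sub>R of_int_vec r)" for r
  proof -
    have "(1 + infnorm (x - y + (2 * L) *\<^sub>R of_int_vec r)) powr (- s) \<le> 2 powr s * profile M (max_abs (?k r))"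
      by (rule infnorm_powr_le_profile[OF M \<delta> infnorm_ge_cube_index[OF d0 L]])
    then have "G\<^sub>1 * (1 + infnorm (x - y + (2 * L) *\<^sub>R of_int_vec r)) powr (- s) \<le> ?g (max_abs (?k r))"
      using G1(1) by (simp add: mult.assoc mult_left_mono)
    then have 1: "ereal (- ?g (max_abs (?k r))) \<le> \<phi> (x - y + (2 * L) *\<^sub>R of_int_vec r)"
      using G1(2)[of "x - y + (2 * L) *\<^sub>R of_int_vec r"] by (elim order_trans[rotated]) auto
    show ?thesis
    proof (cases "r = 0 \<and> e > 0")
      case True
      have "of_int_vec r = 0" using True by (simp add: of_int_vec_def vec_eq_iff)
      moreover have "ereal (?e r - ?g (max_abs (?k r))) \<le> ereal e"
        using True G1(1) profile_nonneg by simp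
      ultimately show ?thesis using order_trans[OF _ \<phi>0] True by simp
    next
      case False
      then have "?e r = 0" by auto
      then show ?thesis using 1 by simp
    qed
  qed
  have hs: "((\<lambda>r. ?e r - ?g (max_abs (?k r))) has_sum (max 0 e - (\<Sum>\<^sub>\<infinity>r. ?g (max_abs (?k r))))) UNIV"
    using has_sum_add[OF se has_sum_uminusI[OF has_sum_infsum[OF sg]]] by simp
  show ?thesis
    unfolding periodic_potential_def periodized_def
    by (rule has_sum_mono[OF has_sum_ereal[OF hs] has_sum_infsum[OF summable_translates[OF L0]]]) (rule lower)
qed

lemma periodic_potential_not_MInf:
  assumes "L > 0"
  shows "periodic_potential \<phi> L x \<noteq> - \<infinity>"
proof -
  define M where "M = nat \<lceil>max 2 (1 / L)\<rceil>"
  have M: "M \<ge> 2" "1 / L \<le> real M" unfolding M_def by linarith+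
  then have ML1: "1 / real M \<le> L" using assms by (simp add: field_simps)
  have "\<phi> (x - 0) \<ge> ereal (- G\<^sub>1 * (1 + infnorm x) powr (- s))" using G1(2)[of x] by simp
  from periodic_potential_lower[OF M(1) ML1 _ _ this, of 1 L] show ?thesis
    by (metis MInfty_neq_ereal(1) diff_zero ereal_infty_less_eq(2) mult_1 of_int_1 zero_less_one)
qed

text \<open>Index distance at least 2 keeps every image at distance at least \<open>1 / M\<close>,
  where the potential is bounded above. The values \<open>g 0\<close> and \<open>g 1\<close> stay
  free and later encode the insertion threshold.\<close>

lemma periodic_potential_upper:
  fixes x y :: "real ^ 'd"
  assumes M: "M \<ge> 2" and \<delta>: "1 / real M \<le> \<delta>" and K: "K > 0" and L: "L = real_of_int K * \<delta>"
    and B: "\<And>x. 1 / real M \<le> infnorm x \<Longrightarrow> \<phi> x \<le> ereal (B * (1 + infnorm x) powr (- s))" "B \<ge> 0"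
    and g: "\<And>n. n \<ge> 2 \<Longrightarrow> g n = B * 2 powr s * profile M n" "(\<lambda>k :: int ^ 'd. g (max_abs k)) summable_on UNIV"
    and far: "\<And>r. 2 \<le> max_abs (cube_index \<delta> x - cube_index \<delta> y + (2 * K) *s r)"
  shows "periodic_potential \<phi> L (x - y) \<le> ereal (periodized g K (cube_index \<delta> x) (cube_index \<delta> y))"
proof -
  have d0: "\<delta> > 0" using M \<delta> by (smt (verit) divide_pos_pos of_nat_0_less_iff pos2 order_less_le_trans)
  then have L0: "L > 0" using L K by simp
  let ?k = "\<lambda>r. cube_index \<delta> x - cube_index \<delta> y + (2 * K) *s r"
  have "\<phi> (x - y + (2 * L) *\<^sub>R of_int_vec r) \<le> ereal (g (max_abs (?k r)))" for r
  proof -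
    let ?v = "x - y + (2 * L) *\<^sub>R of_int_vec r"
    have ge: "\<delta> * (real (max_abs (?k r)) - 1) \<le> infnorm ?v" by (rule infnorm_ge_cube_index[OF d0 L])
    have "1 / real M * 1 \<le> \<delta> * (real (max_abs (?k r)) - 1)"
      using far[of r] d0 by (intro mult_mono \<delta>) auto
    then have "1 / real M \<le> infnorm ?v" using ge by simp
    then have "\<phi> ?v \<le> ereal (B * (1 + infnorm ?v) powr (- s))" by (rule B)
    also have "\<dots> \<le> ereal (B * (2 powr s * profile M (max_abs (?k r))))"
      unfolding ereal_less_eq by (intro mult_left_mono infnorm_powr_le_profile[OF M \<delta> ge] B)
    also have "\<dots> = ereal (g (max_abs (?k r)))" using g(1)[OF far] by (simp add: mult.assoc)
    finally show ?thesis .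
  qed
  then show ?thesis
    unfolding periodic_potential_def periodized_def
    using has_sum_mono[OF has_sum_infsum[OF summable_translates[OF L0]]
        has_sum_ereal[OF has_sum_infsum[OF periodize_summable[OF g(2) K]]]] by blast
qed

end

section \<open>Boltzmann factors and the correlation function\<close>

lemma boltzmann_le:
  assumes "\<beta> > 0" "ereal a \<le> u"
  shows "boltzmann \<beta> u \<le> ennreal (exp (- (\<beta> * a)))"
  using assms by (cases u) (auto simp: boltzmann_def intro!: ennreal_leI)

lemma boltzmann_ge:
  assumes "\<beta> > 0" "u \<le> ereal a"
  shows "ennreal (exp (- (\<beta> * a))) \<le> boltzmann \<beta> u"
  using assms by (cases u) (auto simp: boltzmann_def intro!: ennreal_leI)

lemma boltzmann_add:
  assumes "u \<noteq> - \<infinity>" "v \<noteq> - \<infinity>"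
  shows "boltzmann \<beta> (u + v) = boltzmann \<beta> u * boltzmann \<beta> v"
  using assms
  by (cases u; cases v) (auto simp: boltzmann_def algebra_simps ennreal_mult[symmetric] exp_add[symmetric])

lemma boltzmann_sum:
  assumes "finite P" "\<And>p. p \<in> P \<Longrightarrow> f p \<noteq> - \<infinity>"
  shows "boltzmann \<beta> (\<Sum>p\<in>P. f p) = (\<Prod>p\<in>P. boltzmann \<beta> (f p)) \<and> (\<Sum>p\<in>P. f p) \<noteq> - \<infinity>"
  using assms
proof (induction P)
  case empty
  then show ?case by (simp add: boltzmann_def zero_ereal_def)
next
  case (insert p P)
  then show ?case by (simp add: boltzmann_add ereal_plus_eq_MInfty)
qed

lemma boltzmann_measurable [measurable]: "boltzmann \<beta> \<in> borel_measurable borel"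
proof -
  have "boltzmann \<beta> = (\<lambda>u. if u = \<infinity> then 0 else if u = - \<infinity> then top else ennreal (exp (- \<beta> * real_of_ereal u)))"
    by (auto simp: fun_eq_iff boltzmann_def split: ereal.splits)
  also have "\<dots> \<in> borel_measurable borel" by measurable
  finally show ?thesis .
qed

section \<open>Half-open cubes: measurability and volume\<close>

lemma vec_halfopen_in_borel: "{y :: real ^ 'd. \<forall>i. l i < y $ i \<and> y $ i \<le> u i} \<in> sets borel"
proof -
  have "{y \<in> space borel. \<forall>i\<in>(UNIV :: 'd set). l i < y $ i \<and> y $ i \<le> u i} \<in> sets borel"
    by measurable
  then show ?thesis by simp
qed

lemma emeasure_halfopen_cube:
  assumes "\<delta> \<ge> 0"
  shows "emeasure lborel {y :: real ^ 'd. \<forall>i. l i < y $ i \<and> y $ i \<le> l i + \<delta>} = ennreal (\<delta> ^ CARD('d))"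
proof -
  let ?S = "{y :: real ^ 'd. \<forall>i. l i < y $ i \<and> y $ i \<le> l i + \<delta>}"
  let ?a = "\<chi> i. l i" and ?b = "\<chi> i. l i + \<delta>"
  have d: "(?b - ?a) \<bullet> e = \<delta>" if "e \<in> Basis" for e :: "real ^ 'd"
    using that by (auto simp: Basis_vec_def inner_axis)
  have le: "?a \<bullet> e \<le> ?b \<bullet> e" if "e \<in> Basis" for e :: "real ^ 'd"
    using that assms by (auto simp: Basis_vec_def inner_axis)
  have p: "(\<Prod>e\<in>(Basis :: (real ^ 'd) set). (?b - ?a) \<bullet> e) = \<delta> ^ CARD('d)"
    by (simp add: d del: inner_diff_left)
  have "emeasure lborel (box ?a ?b) \<le> emeasure lborel ?S"
    using vec_halfopen_in_borel[of l "\<lambda>i. l i + \<delta>"] by (intro emeasure_mono) (auto simp: mem_box_cart less_imp_le)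
  moreover have "emeasure lborel ?S \<le> emeasure lborel (cbox ?a ?b)"
    by (intro emeasure_mono) (auto simp: mem_box_cart less_imp_le)
  moreover have "emeasure lborel (box ?a ?b) = ennreal (\<delta> ^ CARD('d))"
    "emeasure lborel (cbox ?a ?b) = ennreal (\<delta> ^ CARD('d))"
    using emeasure_lborel_box[of ?a ?b] emeasure_lborel_cbox[of ?a ?b] le p by simp_all
  ultimately show ?thesis by simp
qed

lemma cell_in_borel: "cell L \<in> sets borel"
  using vec_halfopen_in_borel[of "\<lambda>_. - L" "\<lambda>_. L"] by (simp add: cell_def)

lemma cube_index_eq_iff:
  assumes "\<delta> > 0"
  shows "cube_index \<delta> y = q \<longleftrightarrow> (\<forall>i. \<delta> * (real_of_int (q $ i) - 1) < y $ i \<and> y $ i \<le> \<delta> * (real_of_int (q $ i) - 1) + \<delta>)"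
proof -
  have "\<lceil>t / \<delta>\<rceil> = k \<longleftrightarrow> \<delta> * (real_of_int k - 1) < t \<and> t \<le> \<delta> * (real_of_int k - 1) + \<delta>" for t k
    using assms by (simp add: ceiling_eq_iff field_simps)
  then show ?thesis by (simp add: cube_index_def vec_eq_iff)
qed

lemma cube_index_in_torus:
  assumes "\<delta> > 0" "L = real_of_int K * \<delta>" "x \<in> cell L"
  shows "cube_index \<delta> x \<in> torus K"
proof -
  have "- real_of_int K < x $ i / \<delta> \<and> x $ i / \<delta> \<le> real_of_int K" for i
    using assms by (auto simp: cell_def field_simps dest!: spec[of _ i])
  then show ?thesis
    unfolding torus_def cube_index_def
    by (auto simp: ceiling_le_iff less_ceiling_iff)
qed

lemma cube_in_cell:
  assumes \<delta>: "\<delta> > 0" and L: "L = real_of_int K * \<delta>" and q: "cube_index \<delta> y \<in> torus K"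
  shows "y \<in> cell L"
proof -
  have "- L < y $ i \<and> y $ i \<le> L" for i
  proof -
    have "- K < \<lceil>y $ i / \<delta>\<rceil>" "\<lceil>y $ i / \<delta>\<rceil> \<le> K"
      using q by (auto simp: torus_def cube_index_def)
    then have "- real_of_int K < y $ i / \<delta>" "y $ i / \<delta> \<le> real_of_int K"
      by (auto simp: ceiling_le_iff less_ceiling_iff)
    then show ?thesis using \<delta> by (simp add: L field_simps)
  qed
  then show ?thesis by (simp add: cell_def)
qed

lemma cube_index_measurable:
  assumes "\<delta> > 0"
  shows "cube_index \<delta> \<in> measurable borel (count_space (UNIV :: (int ^ 'd) set))"
  unfolding measurable_count_space_eq2_countable
proof (intro conjI ballI)
  fix q :: "int ^ 'd"
  have "cube_index \<delta> -` {q} \<inter> space borel = {y. cube_index \<delta> y = q}" by auto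
  also have "\<dots> \<in> sets borel"
    unfolding cube_index_eq_iff[OF assms] by (rule vec_halfopen_in_borel)
  finally show "cube_index \<delta> -` {q} \<inter> space borel \<in> sets borel" .
qed auto

lemma emeasure_cube:
  assumes \<delta>: "\<delta> > 0" and L: "L = real_of_int K * \<delta>" and q: "(q :: int ^ 'd) \<in> torus K"
  shows "emeasure (restrict_space lborel (cell L)) {y \<in> cell L. cube_index \<delta> y = q}
    = ennreal (\<delta> ^ CARD('d))"
proof -
  have eq: "{y \<in> cell L. cube_index \<delta> y = q} = {y. cube_index \<delta> y = q}"
    using cube_in_cell[OF \<delta> L] q by auto
  have "emeasure (restrict_space lborel (cell L)) {y. cube_index \<delta> y = q} = emeasure lborel {y. cube_index \<delta> y = q}"
    using cube_in_cell[OF \<delta> L] q cell_in_borel by (intro emeasure_restrict_space) auto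
  also have "\<dots> = ennreal (\<delta> ^ CARD('d))"
    unfolding cube_index_eq_iff[OF \<delta>] using \<delta> by (intro emeasure_halfopen_cube) simp
  finally show ?thesis by (simp only: eq)
qed

text \<open>For \<open>Z = 0\<close> and \<open>Z = \<infinity>\<close> the left-hand side vanishes, so that no bounds on the partition function
  are needed.\<close>

lemma fact_quotient_le:
  assumes "ennreal (fact N) * k \<le> ennreal (fact m * X) * Z" "X \<ge> 0"
  shows "ennreal (fact N / fact m) * (1 / Z) * k \<le> ennreal X"
proof -
  have "ennreal (fact N / fact m) * k \<le> ennreal X * Z"
  proof -
    have "ennreal (fact N / fact m) * k = ennreal (1 / fact m) * (ennreal (fact N) * k)"
      by (simp add: mult.assoc[symmetric] ennreal_mult[symmetric])
    also have "\<dots> \<le> ennreal (1 / fact m) * (ennreal (fact m * X) * Z)"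
      by (rule mult_left_mono[OF assms(1)]) simp
    also have "\<dots> = ennreal X * Z"
      using assms(2) by (simp add: mult.assoc[symmetric] ennreal_mult[symmetric])
    finally show ?thesis .
  qed
  then have *: "(1 / Z) * (ennreal (fact N / fact m) * k) \<le> (1 / Z) * (ennreal X * Z)"
    by (rule mult_left_mono) simp
  show ?thesis
  proof (cases "Z = 0")
    case True
    then have "ennreal (fact N / fact m) * k = 0"
      using \<open>ennreal (fact N / fact m) * k \<le> ennreal X * Z\<close> by simp
    then show ?thesis by (metis mult.assoc mult.commute mult_zero_left zero_le)
  next
    case False
    have "(1 / Z) * (ennreal X * Z) = ennreal X * ((1 / Z) * Z)" by (simp add: mult_ac)
    also have "(1 / Z) * Z \<le> 1"
      using False by (cases "Z = \<infinity>") (auto simp: ennreal_divide_times ennreal_divide_self top.not_eq_extremum)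
    finally have "(1 / Z) * (ennreal X * Z) \<le> ennreal X" by (simp add: mult_left_mono)
    then show ?thesis using * by (simp add: mult_ac)
  qed
qed


section \<open>The uniform bound for potentials with power decay\<close>

context tempered_potential
begin

text \<open>Since no periodized term is \<open>- \<infinity>\<close>, exponentiation turns the
  extended-real energy into a product. The second equation excludes \<open>n = 0\<close>, where the
  value 1 is a convention.\<close>

lemma correlation_function_eq_pair_weight:
  fixes \<beta> L :: real
  assumes L: "L > 0" and n: "n \<le> N"
  defines "b \<equiv> \<lambda>x y. boltzmann \<beta> (periodic_potential \<phi> L (x - y))"
  shows "partition_function \<phi> \<beta> L N = (\<integral>\<^sup>+y. pair_weight b {1..N} y \<partial>cell_measure L {1..N})"
    and "n > 0 \<Longrightarrow> correlation_function \<phi> \<beta> L n N x =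
      ennreal (fact N / fact (N - n)) * (1 / partition_function \<phi> \<beta> L N) *
        (\<integral>\<^sup>+y. pair_weight b ({1..n} \<union> {n<..N}) (\<lambda>i. if i \<in> {n<..N} then y i else x i) \<partial>cell_measure L {n<..N})"
proof -
  have energy: "boltzmann \<beta> (periodic_energy \<phi> L N y) = pair_weight b {1..N} y" for y
  proof -
    have P: "{(i, j). 1 \<le> i \<and> i < j \<and> j \<le> N} = {(i, j). i \<in> {1..N} \<and> j \<in> {1..N} \<and> i < j}" by auto
    have fin: "finite {(i, j). i \<in> {1..N} \<and> j \<in> {1..N} \<and> i < j}"
      by (rule finite_subset[of _ "{1..N} \<times> {1..N}"]) auto
    have "periodic_energy \<phi> L N y = (\<Sum>p\<in>{(i, j). i \<in> {1..N} \<and> j \<in> {1..N} \<and> i < j}. periodic_potential \<phi> L (y (fst p) - y (snd p)))"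
      unfolding periodic_energy_def periodic_potential_def of_int_vec_def P by (simp add: case_prod_beta)
    then show ?thesis
      using boltzmann_sum[OF fin, of "\<lambda>p. periodic_potential \<phi> L (y (fst p) - y (snd p))" \<beta>]
        periodic_potential_not_MInf[OF L]
      by (simp add: pair_weight_def b_def case_prod_beta)
  qed
  show "partition_function \<phi> \<beta> L N = (\<integral>\<^sup>+y. pair_weight b {1..N} y \<partial>cell_measure L {1..N})"
    unfolding partition_function_def energy ..
  have un: "{1..n} \<union> {n<..N} = {1..N}" using n by auto
  assume "n > 0"
  have "pair_weight b {1..N} (merge {1..n} {n<..N} (x, y)) = pair_weight b {1..N} (\<lambda>i. if i \<in> {n<..N} then y i else x i)" for y
    by (rule pair_weight_cong) (auto simp: merge_def)
  then show "correlation_function \<phi> \<beta> L n N x =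
      ennreal (fact N / fact (N - n)) * (1 / partition_function \<phi> \<beta> L N) *
        (\<integral>\<^sup>+y. pair_weight b ({1..n} \<union> {n<..N}) (\<lambda>i. if i \<in> {n<..N} then y i else x i) \<partial>cell_measure L {n<..N})"
    using \<open>n > 0\<close> by (simp only: correlation_function_def energy un if_False) simp
qed

text \<open>The order of the choices avoids circularity: \<open>C'\<close> measures the attraction
  in units of \<open>M ^ d\<close> and is free of \<open>M\<close>; then \<open>core\<close>
  determines \<open>M\<close>; then follow \<open>H\<close>, \<open>z\<close> and
  \<open>\<xi>\<close>. None of them depends on \<open>L\<close>.\<close>

theorem correlation_function_bound:
  assumes core: "\<And>c. \<exists>M\<^sub>0. \<forall>M\<ge>M\<^sub>0. \<forall>x. infnorm x \<le> 2 / real M \<longrightarrow> \<phi> x \<ge> ereal (c * real M ^ CARD('d))"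
    and \<beta>: "\<beta> > 0" and \<rho>: "\<rho> > 0"
  shows "\<exists>\<xi>>0. \<forall>L\<ge>2. \<forall>n N. n \<le> N \<and> real N \<le> \<rho> * (2 * L) ^ CARD('d) \<longrightarrow>
    (\<forall>x. (\<forall>i\<in>{1..n}. x i \<in> cell L) \<longrightarrow> correlation_function \<phi> \<beta> L n N x \<le> ennreal (\<xi> ^ n))"
proof -
  let ?d = "real CARD('d)"
  define \<epsilon> where "\<epsilon> = s - ?d"
  have eps: "\<epsilon> > 0" using s_gt by (simp add: \<epsilon>_def)
  obtain B where B: "B \<ge> 0"
    "\<And>M::nat. M \<ge> 1 \<Longrightarrow> (\<lambda>k::int ^ 'd. (1 + real (max_abs k) / real M) powr (- ?d - \<epsilon> / 2)) summable_on UNIV"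
    "\<And>M::nat. M \<ge> 1 \<Longrightarrow> (\<Sum>\<^sub>\<infinity>k::int ^ 'd. (1 + real (max_abs k) / real M) powr (- ?d - \<epsilon> / 2)) \<le> B * real M ^ CARD('d)"
    using lattice_power_sum[where 'd = 'd, OF half_gt_zero[OF eps]] by blast
  define C' where "C' = \<beta> * (G\<^sub>1 * 2 powr s) * B"
  define n1 where "n1 = real (card {k :: int ^ 'd. max_abs k \<le> 1})"
  have C'0: "C' \<ge> 0" using \<beta> G1 B by (simp add: C'_def)
  obtain M\<^sub>0 where M0: "\<And>M x. M \<ge> M\<^sub>0 \<Longrightarrow> infnorm x \<le> 2 / real M \<Longrightarrow> \<phi> x \<ge> ereal ((10 * C' + 8) / \<beta> * real M ^ CARD('d))"
    using core by blast
  \<comment> \<open>The last bound on \<open>M\<close> makes \<open>n1\<close> times the number of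
    particles per cube at most 1/4, where \<open>n1\<close> counts a cube with its neighbours;
    \<open>H\<close> can then be chosen below.\<close>
  define M where "M = max (max 2 M\<^sub>0) (nat \<lceil>8 * \<rho> * n1\<rceil>)"
  have M: "M \<ge> 2" "M \<ge> M\<^sub>0" "real M \<ge> 8 * \<rho> * n1" unfolding M_def by linarith+
  \<comment> \<open>The surplus \<open>\<epsilon> = s - d\<close> is split: one half lets
    \<open>W\<close> grow, the other keeps \<open>g * W\<close> summable.\<close>
  define W where "W n = (1 + real n / real M) powr (\<epsilon> / 2)" for n
  define g where "g n = \<beta> * (G\<^sub>1 * 2 powr s * profile M n)" for n
  define C where "C = C' * real M ^ CARD('d)"
  define A where "A = \<beta> * ((10 * C' + 8) / \<beta> * real M ^ CARD('d))"
  have base: "1 + real n / real M > 0" "1 + real n / real M \<ge> 1" for n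
    using M(1) by (auto intro: add_pos_nonneg)
  have W1: "W n \<ge> 1" for n unfolding W_def using base eps by (intro ge_one_powr_ge_zero) auto
  have Wmult: "W (m + n) \<le> W m * W n" for m n
  proof -
    have "1 + real (m + n) / real M \<le> (1 + real m / real M) * (1 + real n / real M)"
      using M(1) by (simp add: field_simps)
    then have "W (m + n) \<le> ((1 + real m / real M) * (1 + real n / real M)) powr (\<epsilon> / 2)"
      unfolding W_def using base[of "m + n"] eps by (intro powr_mono2) auto
    also have "\<dots> = W m * W n" unfolding W_def by (rule powr_mult)
    finally show ?thesis .
  qed
  have Wmono: "mono W"
    unfolding W_def using eps M(1)
    by (intro monoI powr_mono2) (auto simp: divide_right_mono intro: add_nonneg_nonneg)
  have gW: "g n * W n = \<beta> * (G\<^sub>1 * 2 powr s) * (1 + real n / real M) powr (- ?d - \<epsilon> / 2)" for n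
  proof -
    have "profile M n * W n = (1 + real n / real M) powr (- s + \<epsilon> / 2)"
      unfolding profile_def W_def by (simp only: powr_add)
    also have "- s + \<epsilon> / 2 = - ?d - \<epsilon> / 2" by (simp add: \<epsilon>_def field_simps)
    finally show ?thesis by (simp add: g_def mult_ac)
  qed
  have g0: "g n \<ge> 0" for n using \<beta> G1 profile_nonneg by (simp add: g_def)
  have gW_summable: "(\<lambda>k :: int ^ 'd. g (max_abs k) * W (max_abs k)) summable_on UNIV"
    unfolding gW using M(1) B by (intro summable_on_cmult_right) auto
  have gW_sum: "(\<Sum>\<^sub>\<infinity>k :: int ^ 'd. g (max_abs k) * W (max_abs k)) \<le> C"
  proof -
    have "(\<Sum>\<^sub>\<infinity>k :: int ^ 'd. g (max_abs k) * W (max_abs k))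
        = \<beta> * (G\<^sub>1 * 2 powr s) * (\<Sum>\<^sub>\<infinity>k :: int ^ 'd. (1 + real (max_abs k) / real M) powr (- ?d - \<epsilon> / 2))"
      unfolding gW by (rule infsum_cmult_right')
    also have "\<dots> \<le> \<beta> * (G\<^sub>1 * 2 powr s) * (B * real M ^ CARD('d))"
      using \<beta> G1 M(1) by (intro mult_left_mono B) auto
    finally show ?thesis by (simp add: C_def C'_def mult_ac)
  qed
  have A_ge: "A \<ge> 10 * C + 8"
  proof -
    have "real M ^ CARD('d) \<ge> 1" using M(1) by (intro one_le_power) auto
    moreover have "A = (10 * C' + 8) * real M ^ CARD('d)" using \<beta> by (simp add: A_def)
    ultimately show ?thesis by (simp add: C_def distrib_right)
  qed
  obtain G\<^sub>2 where G2: "G\<^sub>2 \<ge> 0" "\<And>x. 1 / real M \<le> infnorm x \<Longrightarrow> \<phi> x \<le> ereal (G\<^sub>2 * (1 + infnorm x) powr (- s))"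
    using upper[of "1 / real M"] M(1) by auto
  define \<eta> where "\<eta> = \<rho> * (2 / real M) ^ CARD('d)"
  define C2 where "C2 = (\<Sum>\<^sub>\<infinity>k :: int ^ 'd. \<beta> * (G\<^sub>2 * 2 powr s * profile M (max_abs k)))"
  \<comment> \<open>The requirement is \<open>\<eta> * D \<le> H / 2\<close>, although
    \<open>D\<close> itself contains \<open>n1 * H\<close> from neighbouring cubes. That part
    contributes at most \<open>H / 4\<close> by the choice of \<open>M\<close>, and the term
    \<open>4 * \<eta> * C2\<close> leaves \<open>H / 4\<close> for the rest.\<close>
  define H where "H = 4 * \<eta> * C2 + 1"
  \<comment> \<open>The potential is unbounded above only for neighbouring cubes, where the value \<open>H\<close> makes \<open>f\<close>
    reach the threshold of \<open>insertion_integral_ge\<close>.\<close>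
  define f where "f n = (if n \<le> 1 then H else \<beta> * (G\<^sub>2 * 2 powr s * profile M n))" for n
  define D where "D = (\<Sum>\<^sub>\<infinity>k :: int ^ 'd. f (max_abs k))"
  have eta0: "\<eta> > 0" using \<rho> M(1) by (simp add: \<eta>_def)
  have p0: "\<beta> * (G\<^sub>2 * 2 powr s * profile M n) \<ge> 0" for n using \<beta> G2 profile_nonneg by simp
  have C20: "C2 \<ge> 0" unfolding C2_def by (intro infsum_nonneg p0)
  have H0: "H > 0" using eta0 C20 by (simp add: H_def add_nonneg_pos)
  have f0: "f n \<ge> 0" for n using H0 p0 by (simp add: f_def)
  have p_summable: "(\<lambda>k :: int ^ 'd. \<beta> * (G\<^sub>2 * 2 powr s * profile M (max_abs k))) summable_on UNIV"
    using M(1) by (intro summable_on_cmult_right profile_summable) auto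
  have ind: "((\<lambda>k :: int ^ 'd. if max_abs k \<le> 1 then H else 0) has_sum n1 * H) UNIV"
    by (rule has_sum_finite_neutralI[of "{k. max_abs k \<le> 1}"]) (auto simp: finite_max_abs_le n1_def)
  have dom: "((\<lambda>k :: int ^ 'd. (if max_abs k \<le> 1 then H else 0) + \<beta> * (G\<^sub>2 * 2 powr s * profile M (max_abs k))) has_sum n1 * H + C2) UNIV"
    unfolding C2_def by (intro has_sum_add ind has_sum_infsum p_summable)
  have f_le: "f n \<le> (if n \<le> 1 then H else 0) + \<beta> * (G\<^sub>2 * 2 powr s * profile M n)" for n
    using p0 by (simp add: f_def)
  have f_summable: "(\<lambda>k :: int ^ 'd. f (max_abs k)) summable_on UNIV"
    by (rule summable_on_comparison_test[OF has_sum_imp_summable[OF dom]]) (use f_le f0 in auto)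
  have D_le: "D \<le> n1 * H + C2"
    unfolding D_def by (rule has_sum_mono[OF has_sum_infsum[OF f_summable] dom]) (rule f_le)
  have "\<eta> * n1 \<le> 1 / 4"
  proof -
    have "(2 / real M) ^ CARD('d) \<le> (2 / real M) ^ 1" using M(1) by (intro power_decreasing) (auto simp: Suc_leI)
    then have "\<eta> * n1 \<le> \<rho> * (2 / real M) * n1"
      unfolding \<eta>_def using \<rho> by (intro mult_right_mono mult_left_mono) (auto simp: n1_def)
    also have "\<dots> \<le> 1 / 4" using M(1,3) by (simp add: field_simps)
    finally show ?thesis .
  qed
  then have "\<eta> * n1 * H \<le> 1 / 4 * H" using H0 by (intro mult_right_mono) auto
  moreover have "\<eta> * C2 \<le> H / 4" by (simp add: H_def)
  moreover have "\<eta> * D \<le> \<eta> * (n1 * H + C2)" using eta0 D_le by simp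
  ultimately have etaD: "\<eta> * D \<le> H / 2" by (simp add: algebra_simps)
  have D0: "D \<ge> 0" unfolding D_def by (intro infsum_nonneg f0)
  define \<kappa> where "\<kappa> = (\<Sum>\<^sub>\<infinity>k :: int ^ 'd. exp (- W (max_abs k)))"
  have expW_summable: "(\<lambda>k :: int ^ 'd. exp (- W (max_abs k))) summable_on UNIV"
  proof -
    obtain B' where B': "\<And>t. t \<ge> 1 \<Longrightarrow> exp (- (t powr (\<epsilon> / 2))) \<le> B' * t powr (- s)"
      using exp_neg_le_powr[of "\<epsilon> / 2" s] eps by auto
    have "(\<lambda>k :: int ^ 'd. B' * profile M (max_abs k)) summable_on UNIV"
      using M(1) by (intro summable_on_cmult_right profile_summable) auto
    then show ?thesis
      by (rule summable_on_comparison_test) (use B' base in \<open>auto simp: W_def profile_def\<close>)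
  qed
  have kappa0: "\<kappa> \<ge> 0" unfolding \<kappa>_def by (intro infsum_nonneg) auto
  \<comment> \<open>Half of the cubes have total volume \<open>(2 * L) ^ d / 2\<close> and insertion
    factor at least \<open>exp (- H)\<close>; against the density bound this gives
    \<open>2 * \<rho> * exp H\<close>.\<close>
  define z where "z = max 1 (2 * \<rho> * exp H)"
  define \<xi> where "\<xi> = max z (exp C * exp \<kappa> * exp (\<kappa> * z) * z)"
  have "correlation_function \<phi> \<beta> L n N x \<le> ennreal (\<xi> ^ n)"
    if L: "L \<ge> 2" and nN: "n \<le> N" and N: "real N \<le> \<rho> * (2 * L) ^ CARD('d)"
      and x: "\<And>i. i \<in> {1..n} \<Longrightarrow> x i \<in> cell L" for L n N x
  proof (cases "n = 0")
    case True
    then show ?thesis by (simp add: correlation_function_def)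
  next
    case False
    \<comment> \<open>Rounding \<open>L * M\<close> down and adjusting the side to
      \<open>L / K\<close> lets the cubes tile the cell exactly; as \<open>L * M \<ge> 4\<close>,
      the side stays between \<open>1 / M\<close> and \<open>2 / M\<close>.\<close>
    define K where "K = \<lfloor>L * real M\<rfloor>"
    define \<delta> where "\<delta> = L / real_of_int K"
    have LM: "L * real M \<ge> 2 * 2" using L M(1) by (intro mult_mono) auto
    have K: "real_of_int K \<le> L * real M" "real_of_int K \<ge> L * real M / 2"
      using LM unfolding K_def by linarith+
    have K0: "K > 0" using K(2) LM by linarith
    have LK: "L = real_of_int K * \<delta>" using K0 by (simp add: \<delta>_def)
    have d1: "1 / real M \<le> \<delta>" using K K0 M(1) by (simp add: \<delta>_def field_simps)
    have d2: "\<delta> \<le> 2 / real M" using K K0 M(1) by (simp add: \<delta>_def field_simps)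
    have d0: "\<delta> > 0" using K0 L by (simp add: \<delta>_def)
    have L0: "L > 0" using L by simp
    let ?Q = "torus K :: (int ^ 'd) set"
    let ?\<nu> = "restrict_space lborel (cell L) :: (real ^ 'd) measure"
    let ?b = "\<lambda>x y. boltzmann \<beta> (periodic_potential \<phi> L (x - y))"
    let ?c = "cube_index \<delta> :: real ^ 'd \<Rightarrow> int ^ 'd"
    let ?h = "\<lambda>p q. W (torus_dist K p q)"
    have space: "space ?\<nu> = cell L" by (simp add: space_restrict_space)
    have c_meas: "?c \<in> measurable ?\<nu> (count_space UNIV)"
      using cube_index_measurable[OF d0] by (intro measurable_restrict_space1) simp
    have vol: "emeasure ?\<nu> {y \<in> space ?\<nu>. ?c y = q} = ennreal (\<delta> ^ CARD('d))" if "q \<in> ?Q" for q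
      unfolding space by (rule emeasure_cube[OF d0 LK that])
    have card_Q: "real (card ?Q) * \<delta> ^ CARD('d) = (2 * L) ^ CARD('d)"
      using K0 by (simp add: card_torus LK power_mult_distrib mult_ac)
    have delta_pow: "\<delta> ^ CARD('d) \<le> (2 / real M) ^ CARD('d)"
      using d0 d2 by (intro power_mono) auto
    have N_le: "real N \<le> \<eta> * real (card ?Q)"
    proof -
      have "real N \<le> \<rho> * (real (card ?Q) * \<delta> ^ CARD('d))" using N by (simp add: card_Q)
      also have "\<dots> \<le> \<rho> * (real (card ?Q) * (2 / real M) ^ CARD('d))"
        using delta_pow \<rho> by (intro mult_left_mono) auto
      finally show ?thesis by (simp add: \<eta>_def mult_ac)
    qed
    have kappa': "(\<Sum>q\<in>?Q. exp (- ?h p q)) \<le> \<kappa>" for p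
      unfolding \<kappa>_def using expW_summable K0 by (intro sum_torus_dist_le) auto
    interpret lattice_gas ?Q "periodized g K" ?h A C ?\<nu> ?b ?c \<kappa> \<kappa> z N
    proof (intro lattice_gas.intro cell_kernel.intro lattice_gas_axioms.intro)
      show "finite ?Q" by (rule finite_torus)
      show "periodized g K p q \<ge> 0" for p q :: "int ^ 'd" by (rule periodized_nonneg[OF g0])
      show "periodized g K p q = periodized g K q p" for p q :: "int ^ 'd" by (rule periodized_sym)
      show "?h p q \<ge> 1" for p q :: "int ^ 'd" by (rule W1)
      show "?h p p = 1" for p :: "int ^ 'd" by (simp add: W_def)
      show "(\<Sum>q\<in>?Q. periodized g K p q * ?h a q) \<le> C * ?h a p" for a p :: "int ^ 'd"
      proof -
        have "(\<Sum>q\<in>?Q. periodized g K p q * ?h a q) \<le> (\<Sum>\<^sub>\<infinity>k :: int ^ 'd. g (max_abs k) * W (max_abs k)) * ?h a p"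
          by (rule periodized_weighted_row[OF g0 K0 W1 Wmult Wmono gW_summable])
        also have "\<dots> \<le> C * ?h a p"
          using W1[of "torus_dist K a p"] by (intro mult_right_mono gW_sum) auto
        finally show ?thesis .
      qed
      show "A \<ge> 10 * C + 8" by (rule A_ge)
      show "sigma_finite_measure ?\<nu>"
        using cell_in_borel by (intro sigma_finite_measure_restrict_space sigma_finite_lborel) auto
      show "?b x y = ?b y x" for x y
        using periodic_potential_even[of L "x - y"] by simp
      have [measurable]: "periodic_potential \<phi> L \<in> borel_measurable borel"
        by (rule periodic_potential_measurable[OF L0])
      have [measurable]: "(\<lambda>x. x) \<in> measurable ?\<nu> borel"
        by (intro measurable_restrict_space1) simp
      have "(\<lambda>p. fst p - snd p) \<in> measurable (?\<nu> \<Otimes>\<^sub>M ?\<nu>) borel"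
        by measurable
      then show "case_prod ?b \<in> borel_measurable (?\<nu> \<Otimes>\<^sub>M ?\<nu>)"
        unfolding case_prod_beta by measurable
      show "?c \<in> measurable ?\<nu> (count_space UNIV)" by (rule c_meas)
      show "?c y \<in> ?Q" if "y \<in> space ?\<nu>" for y
        using cube_index_in_torus[OF d0 LK] that by (simp add: space)
      show "?b y u \<le> ennreal (exp (periodized g K (?c y) (?c u) - (if ?c y = ?c u then A else 0)))" for y u
      proof -
        let ?e = "(10 * C' + 8) / \<beta> * real M ^ CARD('d)"
        let ?P = "periodized (\<lambda>n. G\<^sub>1 * 2 powr s * profile M n) K (?c y) (?c u)"
        have gP: "periodized g K (?c y) (?c u) = \<beta> * ?P"
          unfolding periodized_def g_def by (rule infsum_cmult_right')
        have e0: "?e \<ge> 0" using \<beta> C'0 by simp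
        show ?thesis
        proof (cases "?c y = ?c u")
          case True
          have "infnorm (y - u) \<le> 2 / real M"
            using infnorm_le_same_cube[OF d0 True] d2 by simp
          then have "\<phi> (y - u) \<ge> ereal ?e" by (rule M0[OF M(2)])
          from boltzmann_le[OF \<beta> periodic_potential_lower[OF M(1) d1 K0 LK this]]
          have "?b y u \<le> ennreal (exp (- (\<beta> * (max 0 ?e - ?P))))" .
          also have "- (\<beta> * (max 0 ?e - ?P)) = \<beta> * ?P - A"
            unfolding max_absorb2[OF e0] by (simp add: A_def right_diff_distrib)
          finally show ?thesis unfolding gP using True by simp
        next
          case False
          \<comment> \<open>In different cubes only the tail bound is available. It is nonpositive,
            so the maximum with 0 discards it and the periodized attraction alone remains.\<close>
          let ?e' = "- (G\<^sub>1 * (1 + infnorm (y - u)) powr (- s))"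
          have "ereal ?e' \<le> \<phi> (y - u)" using G1(2)[of "y - u"] by simp
          from boltzmann_le[OF \<beta> periodic_potential_lower[OF M(1) d1 K0 LK this]]
          have "?b y u \<le> ennreal (exp (- (\<beta> * (max 0 ?e' - ?P))))" .
          moreover have "max 0 ?e' = 0" using G1(1) by (intro max_absorb1) simp
          ultimately show ?thesis unfolding gP using False by simp
        qed
      qed
      show "(\<integral>\<^sup>+y. ennreal (exp (- ?h p (?c y))) \<partial>?\<nu>) \<le> ennreal \<kappa>" for p
      proof -
        have "(\<integral>\<^sup>+y. ennreal (exp (- ?h p (?c y))) \<partial>?\<nu>)
            = (\<integral>\<^sup>+y. (\<Sum>q\<in>?Q. ennreal (exp (- ?h p q)) * indicator {y \<in> space ?\<nu>. ?c y = q} y) \<partial>?\<nu>)"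
        proof (rule nn_integral_cong)
          fix y assume y: "y \<in> space ?\<nu>"
          have "(\<Sum>q\<in>?Q. ennreal (exp (- ?h p q)) * indicator {y \<in> space ?\<nu>. ?c y = q} y)
              = (\<Sum>q\<in>?Q. if q = ?c y then ennreal (exp (- ?h p q)) else 0)"
            by (rule sum.cong) (use y in \<open>auto simp: indicator_def\<close>)
          then show "ennreal (exp (- ?h p (?c y))) = (\<Sum>q\<in>?Q. ennreal (exp (- ?h p q)) * indicator {y \<in> space ?\<nu>. ?c y = q} y)"
            using cube_index_in_torus[OF d0 LK] y by (simp add: space finite_torus)
        qed
        also have "\<dots> = (\<Sum>q\<in>?Q. ennreal (exp (- ?h p q)) * emeasure ?\<nu> {y \<in> space ?\<nu>. ?c y = q})"
        proof -
          note [measurable] = c_meas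
          show ?thesis by (subst nn_integral_sum) (auto simp: nn_integral_cmult intro!: sum.cong)
        qed
        also have "\<dots> \<le> (\<Sum>q\<in>?Q. ennreal (exp (- ?h p q)) * 1)"
        proof (intro sum_mono mult_left_mono)
          fix q assume "q \<in> ?Q"
          \<comment> \<open>The cubes have volume at most 1, so one \<open>\<kappa>\<close> bounds
            both the integral and the sum.\<close>
          have "\<delta> \<le> 1" using d2 M(1) by (elim order_trans) simp
          then have "\<delta> ^ CARD('d) \<le> 1" using d0 by (intro power_le_one) auto
          then show "emeasure ?\<nu> {y \<in> space ?\<nu>. ?c y = q} \<le> 1" using \<open>q \<in> ?Q\<close> by (simp only: vol ennreal_le_1)
        qed auto
        also have "\<dots> = ennreal (\<Sum>q\<in>?Q. exp (- ?h p q))" by simp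
        also have "\<dots> \<le> ennreal \<kappa>" by (intro ennreal_leI kappa')
        finally show ?thesis .
      qed
      show "(\<Sum>q\<in>?Q. exp (- ?h p q)) \<le> \<kappa>" for p by (rule kappa')
      show "\<kappa> \<ge> 0" by (rule kappa0)
      show "z \<ge> 1" by (simp add: z_def)
      show "of_nat (Suc (card J)) \<le> ennreal z * (\<integral>\<^sup>+y. (\<Prod>j\<in>J. ?b y (u j)) \<partial>?\<nu>)"
        if J: "finite J" "card J < N" and u: "\<And>j. j \<in> J \<Longrightarrow> u j \<in> space ?\<nu>" for J :: "nat set" and u
      proof -
        have "ennreal (real (card ?Q) / 2 * \<delta> ^ CARD('d) * exp (- H)) \<le> (\<integral>\<^sup>+y. (\<Prod>j\<in>J. ?b y (u j)) \<partial>?\<nu>)"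
        proof (rule insertion_integral_ge[where c = ?c and \<Xi> = "periodized f K" and D = D])
          show "ennreal (exp (- periodized f K (?c y) (?c v))) \<le> ?b y v"
            if "periodized f K (?c y) (?c v) < H" for y v
          proof -
            \<comment> \<open>A single image at index distance at most 1 would already contribute
              \<open>H\<close> to the periodization.\<close>
            have far: "2 \<le> max_abs (?c y - ?c v + (2 * K) *s r)" for r
            proof (rule ccontr)
              assume "\<not> 2 \<le> max_abs (?c y - ?c v + (2 * K) *s r)"
              then have "f (max_abs (?c y - ?c v + (2 * K) *s r)) = H" by (simp add: f_def)
              then show False
                using periodized_ge_term[OF f_summable K0 f0, of "?c y" "?c v" r] that by simp
            qed
            let ?f = "\<lambda>n. f n / \<beta>"
            have "periodic_potential \<phi> L (y - v) \<le> ereal (periodized ?f K (?c y) (?c v))"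
            proof (rule periodic_potential_upper[OF M(1) d1 K0 LK G2(2,1) _ _ far])
              show "?f n = G\<^sub>2 * 2 powr s * profile M n" if "n \<ge> 2" for n
                using that \<beta> by (simp add: f_def)
              show "(\<lambda>k :: int ^ 'd. ?f (max_abs k)) summable_on UNIV"
                unfolding divide_inverse by (rule summable_on_cmult_left[OF f_summable])
            qed
            from boltzmann_ge[OF \<beta> this]
            have "ennreal (exp (- (\<beta> * periodized ?f K (?c y) (?c v)))) \<le> ?b y v" .
            moreover have "periodized f K (?c y) (?c v) = \<beta> * periodized ?f K (?c y) (?c v)"
              unfolding periodized_def infsum_cmult_right'[symmetric] using \<beta> by simp
            ultimately show ?thesis by simp
          qed
          show "real (card J) * D \<le> H * real (card ?Q) / 2"
          proof -
            have "real (card J) * D \<le> \<eta> * real (card ?Q) * D"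
              using J N_le D0 by (intro mult_right_mono) auto
            also have "\<dots> = real (card ?Q) * (\<eta> * D)" by simp
            also have "\<dots> \<le> real (card ?Q) * (H / 2)" by (intro mult_left_mono etaD) auto
            finally show ?thesis by (simp add: mult.commute)
          qed
          show "(\<Sum>q\<in>?Q. periodized f K q p) \<le> D" for p
            using periodized_column[OF f_summable K0, of p] by (simp add: D_def)
          show "?c (u j) \<in> ?Q" if "j \<in> J" for j
            using cube_index_in_torus[OF d0 LK, of "u j"] u[OF that] by (simp add: space)
        qed (use J u c_meas vol d0 H0 finite_torus periodized_nonneg[OF f0] in \<open>auto simp: space\<close>)
        then have "ennreal z * ennreal (real (card ?Q) / 2 * \<delta> ^ CARD('d) * exp (- H))
            \<le> ennreal z * (\<integral>\<^sup>+y. (\<Prod>j\<in>J. ?b y (u j)) \<partial>?\<nu>)"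
          by (rule mult_left_mono) simp
        moreover have "of_nat (Suc (card J)) \<le> ennreal z * ennreal (real (card ?Q) / 2 * \<delta> ^ CARD('d) * exp (- H))"
        proof -
          have v: "real (card ?Q) / 2 * \<delta> ^ CARD('d) * exp (- H) = (2 * L) ^ CARD('d) / 2 * exp (- H)"
            using card_Q by simp
          have "real (Suc (card J)) \<le> real N" using J by simp
          also have "\<dots> \<le> \<rho> * (2 * L) ^ CARD('d)" by (rule N)
          also have "\<dots> = 2 * \<rho> * exp H * ((2 * L) ^ CARD('d) / 2 * exp (- H))"
            by (simp add: exp_minus)
          also have "\<dots> \<le> z * ((2 * L) ^ CARD('d) / 2 * exp (- H))"
            unfolding z_def using L0 by (intro mult_right_mono) auto
          finally have "real (Suc (card J)) \<le> z * (real (card ?Q) / 2 * \<delta> ^ CARD('d) * exp (- H))"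
            by (simp only: v)
          then have "ennreal (real (Suc (card J))) \<le> ennreal (z * (real (card ?Q) / 2 * \<delta> ^ CARD('d) * exp (- H)))"
            by (rule ennreal_leI)
          also have "\<dots> = ennreal z * ennreal (real (card ?Q) / 2 * \<delta> ^ CARD('d) * exp (- H))"
            using d0 by (intro ennreal_mult) (auto simp: z_def)
          finally show ?thesis by (simp only: ennreal_of_nat_eq_real_of_nat)
        qed
        ultimately show ?thesis by (rule order_trans[rotated])
      qed
    qed
    have xi: "xi = \<xi>" by (simp add: xi_def \<xi>_def)
    have cm: "cell_measure L I = PiM I (\<lambda>_. ?\<nu>)" for I by (simp add: cell_measure_def)
    have Z: "corr {} {1..N} undefined = partition_function \<phi> \<beta> L N"
      unfolding correlation_function_eq_pair_weight(1)[OF L0 nN] corr_def cm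
      by (intro nn_integral_cong) (auto intro: pair_weight_cong)
    have "ennreal (fact (card {1..N})) * corr {1..n} {n<..N} x
        \<le> ennreal (fact (card {n<..N}) * xi ^ card {1..n} * z ^ (card {1..N} - card {1..n} - card {n<..N})) * corr {} {1..N} undefined"
      by (rule corr_le) (use nN x in \<open>auto simp: space\<close>)
    then have "ennreal (fact N) * corr {1..n} {n<..N} x \<le> ennreal (fact (N - n) * \<xi> ^ n) * partition_function \<phi> \<beta> L N"
      unfolding xi Z by simp
    then have "ennreal (fact N / fact (N - n)) * (1 / partition_function \<phi> \<beta> L N) * corr {1..n} {n<..N} x \<le> ennreal (\<xi> ^ n)"
      by (rule fact_quotient_le) (simp add: \<xi>_def z_def)
    then show ?thesis
      using correlation_function_eq_pair_weight(2)[OF L0 nN, of \<beta> x] False by (simp add: corr_def cm)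
  qed
  moreover have "\<xi> > 0" by (simp add: \<xi>_def z_def less_max_iff_disj)
  ultimately show ?thesis by blast
qed

end


section \<open>Reduction of the three conditions to power decay\<close>

lemma powr_tail_bound:
  fixes G R s B t :: real
  assumes R: "R > 0" and s: "s > 0" and t: "t \<ge> 0"
  defines "E \<equiv> max 0 G * (1 + 1 / R) powr s + max 0 B * (1 + R) powr s"
  shows "R \<le> t \<Longrightarrow> G * t powr (- s) \<le> E * (1 + t) powr (- s)"
    and "t < R \<Longrightarrow> B \<le> E * (1 + t) powr (- s)"
proof -
  have le: "max 0 G * (1 + 1 / R) powr s \<le> E" "max 0 B * (1 + R) powr s \<le> E" by (auto simp: E_def)
  show "G * t powr (- s) \<le> E * (1 + t) powr (- s)" if "R \<le> t"
  proof -
    have t0: "t > 0" using R that by simp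
    \<comment> \<open>Beyond \<open>R\<close>, \<open>t\<close> and \<open>1 + t\<close> are
      comparable; below \<open>R\<close>, \<open>(1 + t) powr (- s)\<close> is bounded away from 0,
      so a multiple of it exceeds any constant.\<close>
    have "1 + t \<le> (1 + 1 / R) * t" using that R by (simp add: field_simps)
    then have "((1 + 1 / R) * t) powr (- s) \<le> (1 + t) powr (- s)"
      using t0 s by (intro powr_mono2') auto
    then have "(1 + 1 / R) powr s * ((1 + 1 / R) powr (- s) * t powr (- s)) \<le> (1 + 1 / R) powr s * (1 + t) powr (- s)"
      by (simp only: powr_mult) (rule mult_left_mono, auto)
    moreover have "(1 + 1 / R) powr s * (1 + 1 / R) powr (- s) = 1"
      using R add_pos_pos[of 1 "1 / R"] by (simp add: powr_minus)
    ultimately have *: "t powr (- s) \<le> (1 + 1 / R) powr s * (1 + t) powr (- s)"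
      by (simp add: mult.assoc[symmetric])
    have "G * t powr (- s) \<le> max 0 G * t powr (- s)" by (intro mult_right_mono) auto
    also have "\<dots> \<le> max 0 G * ((1 + 1 / R) powr s * (1 + t) powr (- s))" by (intro mult_left_mono *) auto
    also have "\<dots> \<le> E * (1 + t) powr (- s)"
      unfolding mult.assoc[symmetric] by (intro mult_right_mono le) auto
    finally show ?thesis .
  qed
  show "B \<le> E * (1 + t) powr (- s)" if "t < R"
  proof -
    have "(1 + R) powr (- s) \<le> (1 + t) powr (- s)" using that s t by (intro powr_mono2') auto
    then have "(1 + R) powr s * (1 + R) powr (- s) \<le> (1 + R) powr s * (1 + t) powr (- s)"
      by (rule mult_left_mono) simp
    moreover have "(1 + R) powr s * (1 + R) powr (- s) = 1" using R by (simp add: powr_minus)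
    ultimately have "max 0 B * 1 \<le> max 0 B * ((1 + R) powr s * (1 + t) powr (- s))"
      by (intro mult_left_mono) auto
    also have "\<dots> \<le> E * (1 + t) powr (- s)"
      unfolding mult.assoc[symmetric] by (intro mult_right_mono le) auto
    finally show ?thesis by simp
  qed
qed

text \<open>At \<open>t = 2 / M\<close> the factor \<open>(2 / M) ^ d\<close> cancels the
  \<open>2 ^ d\<close> put into the constant and leaves
  \<open>\<Phi> (2 / M) \<ge> c * M ^ d\<close>. Monotonicity carries this to all smaller positive
  distances.\<close>

lemma cond_RP_core:
  fixes \<phi> :: "real ^ 'd \<Rightarrow> ereal"
  assumes "cond_RP \<phi>"
  shows "\<exists>M\<^sub>0. \<forall>M\<ge>M\<^sub>0. \<forall>x. infnorm x \<le> 2 / real M \<longrightarrow> \<phi> x \<ge> ereal (c * real M ^ CARD('d))"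
proof -
  obtain R\<^sub>1 \<Phi> where RP: "R\<^sub>1 > 0" "antimono_on {0<..} \<Phi>"
      "filterlim (\<lambda>t. \<Phi> t * t ^ CARD('d)) at_top (at_right (0::real))" "\<phi> 0 = \<infinity>"
      "\<And>x. x \<noteq> 0 \<Longrightarrow> infnorm x \<le> R\<^sub>1 \<Longrightarrow> \<phi> x \<ge> ereal (\<Phi> (infnorm x))"
    using assms unfolding cond_RP_def by blast
  have "\<forall>\<^sub>F t in at_right 0. c * 2 ^ CARD('d) \<le> \<Phi> t * t ^ CARD('d)"
    using RP(3) unfolding filterlim_at_top by blast
  then obtain \<tau> where \<tau>: "\<tau> > 0" "\<And>t. 0 < t \<Longrightarrow> t < \<tau> \<Longrightarrow> c * 2 ^ CARD('d) \<le> \<Phi> t * t ^ CARD('d)"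
    unfolding eventually_at_right_field by auto
  show ?thesis
  proof (intro exI allI impI)
    fix M :: nat and x :: "real ^ 'd"
    assume M: "nat \<lceil>2 / min \<tau> R\<^sub>1\<rceil> + 1 \<le> M" and x: "infnorm x \<le> 2 / real M"
    have m0: "min \<tau> R\<^sub>1 > 0" using \<tau>(1) RP(1) by simp
    have "2 / min \<tau> R\<^sub>1 < real M" using M by linarith
    moreover have M0: "real M > 0" using M by simp
    ultimately have t: "2 / real M < min \<tau> R\<^sub>1"
      using m0 by (simp only: pos_divide_less_eq mult.commute)
    show "\<phi> x \<ge> ereal (c * real M ^ CARD('d))"
    proof (cases "x = 0")
      case True
      then show ?thesis by (simp add: RP(4))
    next
      case False
      then have x0: "infnorm x > 0" by (simp add: infnorm_pos_lt)
      have "c * 2 ^ CARD('d) \<le> \<Phi> (2 / real M) * (2 / real M) ^ CARD('d)"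
        using t M0 by (intro \<tau>(2)) auto
      then have "c * real M ^ CARD('d) \<le> \<Phi> (2 / real M)"
        using M0 by (simp add: power_divide field_simps)
      also have "\<dots> \<le> \<Phi> (infnorm x)"
        using monotone_onD[OF RP(2), of "infnorm x" "2 / real M"] x0 M0 x by simp
      finally show ?thesis
        using RP(5)[OF False] x t by (intro order_trans[OF _ RP(5)[OF False]]) auto
    qed
  qed
qed

text \<open>Beyond \<open>R\<^sub>2\<close> the tail condition applies. Within it, constant bounds
  are converted into the same power: from below by \<open>cond_BB\<close>, and from above, away from
  the origin, by \<open>cond_RP\<close>.\<close>

lemma tempered_potentialI:
  fixes \<phi> :: "real ^ 'd \<Rightarrow> ereal"
  assumes "\<And>x. \<phi> x \<noteq> - \<infinity>" "\<And>x. \<phi> (- x) = \<phi> x" "\<phi> \<in> borel_measurable borel"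
    and RP: "cond_RP \<phi>" and BB: "cond_BB \<phi>" and T: "cond_T \<phi>"
  obtains s G\<^sub>1 where "tempered_potential \<phi> s G\<^sub>1"
proof -
  obtain G R\<^sub>2 \<epsilon> where T': "R\<^sub>2 > 0" "\<epsilon> > 0"
    "\<And>x. infnorm x \<ge> R\<^sub>2 \<Longrightarrow> \<bar>\<phi> x\<bar> \<le> ereal (G * infnorm x powr (- real CARD('d) - \<epsilon>))"
    using T unfolding cond_T_def by blast
  obtain M where M: "\<And>x. \<phi> x \<ge> - ereal M" using BB unfolding cond_BB_def by blast
  define s where "s = real CARD('d) + \<epsilon>"
  have s: "s > real CARD('d)" "s > 0" using T'(2) by (auto simp: s_def add_pos_pos)
  have tail: "\<bar>\<phi> x\<bar> \<le> ereal (G * infnorm x powr (- s))" if "infnorm x \<ge> R\<^sub>2" for x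
  proof -
    have "- s = - real CARD('d) - \<epsilon>" by (simp add: s_def)
    then show ?thesis using T'(3)[OF that] by simp
  qed
  define E where "E B = max 0 G * (1 + 1 / R\<^sub>2) powr s + max 0 B * (1 + R\<^sub>2) powr s" for B
  have E0: "E B \<ge> 0" for B by (simp add: E_def)
  have far: "\<bar>\<phi> x\<bar> \<le> ereal (E B * (1 + infnorm x) powr (- s))" if "infnorm x \<ge> R\<^sub>2" for x B
    using powr_tail_bound(1)[OF T'(1) s(2) infnorm_pos_le that, of G B]
    by (intro order_trans[OF tail[OF that]]) (simp add: E_def)
  have near: "B \<le> E B * (1 + infnorm x) powr (- s)" if "infnorm x < R\<^sub>2" for x :: "real ^ 'd" and B
    using powr_tail_bound(2)[OF T'(1) s(2) infnorm_pos_le that, of B G] by (simp add: E_def)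
  have "tempered_potential \<phi> s (E M)"
  proof
    show "- ereal (E M * (1 + infnorm x) powr (- s)) \<le> \<phi> x" for x
    proof (cases "infnorm x < R\<^sub>2")
      case True
      from near[OF this, of M] have "- ereal (E M * (1 + infnorm x) powr (- s)) \<le> - ereal M" by simp
      then show ?thesis using M by (rule order_trans)
    next
      case False
      then have "R\<^sub>2 \<le> infnorm x" by simp
      from far[OF this, of M] show ?thesis by (cases "\<phi> x") auto
    qed
    show "\<exists>B\<ge>0. \<forall>x. r \<le> infnorm x \<longrightarrow> \<phi> x \<le> ereal (B * (1 + infnorm x) powr (- s))" if "r > 0" for r
    proof -
      obtain B where B: "\<And>x. r \<le> infnorm x \<Longrightarrow> \<phi> x \<le> ereal B"
        using RP \<open>r > 0\<close> unfolding cond_RP_def by blast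
      have "\<phi> x \<le> ereal (E B * (1 + infnorm x) powr (- s))" if "r \<le> infnorm x" for x
      proof (cases "infnorm x < R\<^sub>2")
        case True
        from near[OF this, of B] have "ereal B \<le> ereal (E B * (1 + infnorm x) powr (- s))" by simp
        then show ?thesis by (rule order_trans[OF B[OF that]])
      next
        case False
        then have "R\<^sub>2 \<le> infnorm x" by simp
        from far[OF this, of B] show ?thesis by (cases "\<phi> x") auto
      qed
      then show ?thesis using E0 by blast
    qed
  qed (use assms s E0 in auto)
  then show ?thesis by (rule that)
qed

theorem theorem3p15:
  fixes \<phi> :: "real ^ 'd \<Rightarrow> ereal" and rho_max \<beta> :: real
  assumes "\<And>x. \<phi> x \<noteq> - \<infinity>"
    and "\<And>x. \<phi> (- x) = \<phi> x"
    and "\<phi> \<in> borel_measurable borel"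
    and "cond_RP \<phi>" and "cond_BB \<phi>" and "cond_T \<phi>"
    and "rho_max > 0" and "\<beta> > 0"
  shows "\<exists>\<xi>>0. \<exists>L\<^sub>0>0. \<forall>L\<ge>L\<^sub>0. \<forall>(n::nat) (N::nat).
           1 \<le> N \<and> n \<le> N \<and> real N \<le> rho_max * (2 * L) ^ CARD('d) \<longrightarrow>
           (\<forall>x. (\<forall>i\<in>{1..n}. x i \<in> cell L) \<longrightarrow>
              correlation_function \<phi> \<beta> L n N x \<le> ennreal (\<xi> ^ n))"
proof -
  obtain s G\<^sub>1 where "tempered_potential \<phi> s G\<^sub>1"
    by (rule tempered_potentialI[OF assms(1-6)])
  then interpret tempered_potential \<phi> s G\<^sub>1 .
  obtain \<xi> where "\<xi> > 0" "\<forall>L\<ge>2. \<forall>n N. n \<le> N \<and> real N \<le> rho_max * (2 * L) ^ CARD('d) \<longrightarrow>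
    (\<forall>x. (\<forall>i\<in>{1..n}. x i \<in> cell L) \<longrightarrow> correlation_function \<phi> \<beta> L n N x \<le> ennreal (\<xi> ^ n))"
    using correlation_function_bound[OF cond_RP_core[OF assms(4)] assms(8,7)] by blast
  \<comment> \<open>The threshold 2 is the same for all potentials and densities; its purpose is the
    bound \<open>L * M \<ge> 4\<close> behind the cube sides.\<close>
  then show ?thesis by (intro exI[of _ \<xi>] conjI exI[of _ 2]) auto
qed

end
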